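(* Let $Z$ be a Dedekind domain with fraction field $Q$, let $K_1,\ldots,K_n$ be finite field extensions of $Q$, and put $K=K_1\oplus\ldots\oplus K_n$. Let $\mathcal{O}_i$ be the integral closure of $Z$ in $K_i$ and $\mathcal{O}=\mathcal{O}_1\oplus\ldots\oplus\mathcal{O}_n$, and assume $\mathcal{O}$ is finitely generated as a $Z$-module. Fix integers $s_1,\ldots,s_n\geq 1$ and let $V=K_1^{s_1}\oplus\ldots\oplus K_n^{s_n}$, with $K$ acting component-wise diagonally. Let $R$ be an order in $K$ with conductor $\mathfrak{f}=(R:\mathcal{O})=\{x\in K: x\mathcal{O}\subseteq R\}$, written as $\mathfrak{f}=\mathfrak{f}_1\oplus\ldots\oplus\mathfrak{f}_n$ with $\mathfrak{f}_i$ an $\mathcal{O}_i$-ideal. Let $M$ be a sub-$R$-module of $V$ which is a lattice in $V$. Then there exist a sub-$R$-module $M'$ of $V$ which is a lattice in $V$, and fractional $\mathcal{O}_i$-ideals $I_i$ ($i=1,\ldots,n$), such that (i) $M'\simeq M$ as $R$-modules; (ii) $M'\mathcal{O}=\bigoplus_{i=1}^n\left(\mathcal{O}_i^{s_i-1}\oplus I_i\right)$; (iii) $\bigoplus_{i=1}^n\left(\mathfrak{f}_i^{s_i-1}\oplus \mathfrak{f}_iI_i\right)\subseteq M'\subseteq \bigoplus_{i=1}^n\left(\mathcal{O}_i^{s_i-1}\oplus I_i\right)$.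
   Context: All rings are commutative and unitary. A lattice in a finite-dimensional $Q$-vector space $W$ is a finitely generated sub-$Z$-module of $W$ containing a $Q$-basis of $W$. An order in $K$ is a subring of $K$ that is a lattice in $K$. A fractional $\mathcal{O}_i$-ideal is a finitely generated nonzero sub-$\mathcal{O}_i$-module of $K_i$. $M\mathcal{O}$ denotes the $\mathcal{O}$-submodule of $V$ generated by $M$. *)

theory Defs
  imports "HOL-Algebra.Algebra"
begin

section \<open>Submodules, lattices, isomorphisms\<close>

definition generated_submodule ::
    "('r, 'm) ring_scheme \<Rightarrow> ('r, 'v, 'n) module_scheme \<Rightarrow> 'v set \<Rightarrow> 'v set" where
  "generated_submodule A W S = \<Inter>{N. submodule N A W \<and> S \<subseteq> N}"

definition fin_gen_submodule ::
    "'v set \<Rightarrow> ('r, 'm) ring_scheme \<Rightarrow> ('r, 'v, 'n) module_scheme \<Rightarrow> bool" where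
  "fin_gen_submodule N A W \<longleftrightarrow>
     submodule N A W \<and> (\<exists>S. finite S \<and> S \<subseteq> carrier W \<and> N = generated_submodule A W S)"

definition lin_independent ::
    "('r, 'm) ring_scheme \<Rightarrow> ('r, 'v, 'n) module_scheme \<Rightarrow> 'v set \<Rightarrow> bool" where
  "lin_independent F W B \<longleftrightarrow>
     (\<forall>S c. finite S \<and> S \<subseteq> B \<and> c \<in> S \<rightarrow> carrier F \<and>
        (\<Oplus>\<^bsub>W\<^esub> b \<in> S. c b \<odot>\<^bsub>W\<^esub> b) = \<zero>\<^bsub>W\<^esub> \<longrightarrow> (\<forall>b\<in>S. c b = \<zero>\<^bsub>F\<^esub>))"

definition is_basis ::
    "('r, 'm) ring_scheme \<Rightarrow> ('r, 'v, 'n) module_scheme \<Rightarrow> 'v set \<Rightarrow> bool" where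
  "is_basis F W B \<longleftrightarrow>
     B \<subseteq> carrier W \<and> lin_independent F W B \<and> generated_submodule F W B = carrier W"

text \<open>\<open>Z\<close> is a subring of the field \<open>Q\<close>, and \<open>W\<close> is a \<open>Q\<close>-vector space.\<close>

definition is_lattice ::
    "'q set \<Rightarrow> ('q, 'm) ring_scheme \<Rightarrow> ('q, 'v, 'n) module_scheme \<Rightarrow> 'v set \<Rightarrow> bool" where
  "is_lattice Z Q W L \<longleftrightarrow>
     fin_gen_submodule L (Q\<lparr>carrier := Z\<rparr>) W \<and> (\<exists>B \<subseteq> L. is_basis Q W B)"

definition modules_isomorphic ::
    "('r, 'm) ring_scheme \<Rightarrow> ('r, 'v, 'n) module_scheme \<Rightarrow> ('r, 'w, 'k) module_scheme \<Rightarrow> bool"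
  where
  "modules_isomorphic A M N \<longleftrightarrow>
     (\<exists>\<phi>. bij_betw \<phi> (carrier M) (carrier N) \<and>
        (\<forall>x\<in>carrier M. \<forall>y\<in>carrier M. \<phi> (x \<oplus>\<^bsub>M\<^esub> y) = \<phi> x \<oplus>\<^bsub>N\<^esub> \<phi> y) \<and>
        (\<forall>a\<in>carrier A. \<forall>x\<in>carrier M. \<phi> (a \<odot>\<^bsub>M\<^esub> x) = a \<odot>\<^bsub>N\<^esub> \<phi> x))"

definition regular_module :: "('a, 'm) ring_scheme \<Rightarrow> ('a, 'a) module" where
  "regular_module A = \<lparr>carrier = carrier A, monoid.mult = (\<otimes>\<^bsub>A\<^esub>), one = \<one>\<^bsub>A\<^esub>,
     ring.zero = \<zero>\<^bsub>A\<^esub>, add = (\<oplus>\<^bsub>A\<^esub>), smult = (\<otimes>\<^bsub>A\<^esub>)\<rparr>"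

definition restrict_scalars :: "('q \<Rightarrow> 'r) \<Rightarrow> ('r, 'v) module \<Rightarrow> ('q, 'v) module" where
  "restrict_scalars h W = \<lparr>carrier = carrier W, monoid.mult = (\<otimes>\<^bsub>W\<^esub>), one = \<one>\<^bsub>W\<^esub>,
     ring.zero = \<zero>\<^bsub>W\<^esub>, add = (\<oplus>\<^bsub>W\<^esub>), smult = (\<lambda>a. smult W (h a))\<rparr>"


section \<open>Integral closure, Dedekind domains, fractional ideals\<close>

text \<open>In HOL-Algebra a polynomial is the list of its coefficients, leading coefficient first.\<close>

definition integral_closure :: "'a set \<Rightarrow> ('a, 'm) ring_scheme \<Rightarrow> 'a set" where
  "integral_closure A K =
     {x \<in> carrier K. \<exists>p. polynomial\<^bsub>K\<^esub> A p \<and> p \<noteq> [] \<and> lead_coeff p = \<one>\<^bsub>K\<^esub> \<and>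
        ring.eval K p x = \<zero>\<^bsub>K\<^esub>}"

definition is_fraction_field_of :: "('q, 'm) ring_scheme \<Rightarrow> 'q set \<Rightarrow> bool" where
  "is_fraction_field_of Q Z \<longleftrightarrow>
     field Q \<and> subring Z Q \<and>
     (\<forall>x\<in>carrier Q. \<exists>a\<in>Z. \<exists>b\<in>Z - {\<zero>\<^bsub>Q\<^esub>}. x = a \<otimes>\<^bsub>Q\<^esub> inv\<^bsub>Q\<^esub> b)"

text \<open>Noetherian, integrally closed in its fraction field \<open>Q\<close>, and of Krull dimension at most one;
  fields are Dedekind domains under this convention.\<close>

definition dedekind_domain_with_fraction_field :: "'q set \<Rightarrow> ('q, 'm) ring_scheme \<Rightarrow> bool" where
  "dedekind_domain_with_fraction_field Z Q \<longleftrightarrow>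
     is_fraction_field_of Q Z \<and>
     noetherian_domain (Q\<lparr>carrier := Z\<rparr>) \<and>
     integral_closure Z Q = Z \<and>
     (\<forall>P. primeideal P (Q\<lparr>carrier := Z\<rparr>) \<and> P \<noteq> {\<zero>\<^bsub>Q\<^esub>} \<longrightarrow> maximalideal P (Q\<lparr>carrier := Z\<rparr>))"

text \<open>A field extension of \<open>Q\<close> is a field \<open>K\<close> with a ring homomorphism \<open>h\<close> from \<open>Q\<close>.\<close>

definition finite_field_extension ::
    "('q, 'm) ring_scheme \<Rightarrow> ('q \<Rightarrow> 'a) \<Rightarrow> ('a, 'n) ring_scheme \<Rightarrow> bool" where
  "finite_field_extension Q h K \<longleftrightarrow>
     field Q \<and> field K \<and> h \<in> ring_hom Q K \<and>
     ring.finite_dimension K (h ` carrier Q) (carrier K)"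

definition fractional_ideal :: "'a set \<Rightarrow> 'a set \<Rightarrow> ('a, 'm) ring_scheme \<Rightarrow> bool" where
  "fractional_ideal I \<O> K \<longleftrightarrow>
     fin_gen_submodule I (K\<lparr>carrier := \<O>\<rparr>) (regular_module K) \<and> I \<noteq> {\<zero>\<^bsub>K\<^esub>}"


section \<open>The algebra \<open>K\<close> and the module \<open>V\<close>\<close>

definition product_ring :: "'i set \<Rightarrow> ('i \<Rightarrow> ('a, 'm) ring_scheme) \<Rightarrow> ('i \<Rightarrow> 'a) ring" where
  "product_ring I K =
     \<lparr>carrier = (\<Pi>\<^sub>E i\<in>I. carrier (K i)),
      monoid.mult = (\<lambda>x y. \<lambda>i\<in>I. x i \<otimes>\<^bsub>K i\<^esub> y i),
      one = (\<lambda>i\<in>I. \<one>\<^bsub>K i\<^esub>),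
      ring.zero = (\<lambda>i\<in>I. \<zero>\<^bsub>K i\<^esub>),
      add = (\<lambda>x y. \<lambda>i\<in>I. x i \<oplus>\<^bsub>K i\<^esub> y i)\<rparr>"

definition diagonal :: "'i set \<Rightarrow> ('i \<Rightarrow> 'q \<Rightarrow> 'a) \<Rightarrow> 'q \<Rightarrow> ('i \<Rightarrow> 'a)" where
  "diagonal I h q = (\<lambda>i\<in>I. h i q)"

text \<open>The pair \<open>(i, j)\<close> indexes the \<open>j\<close>-th coordinate of the summand \<open>K\<^sub>i\<^bsup>s\<^sub>i\<^esup>\<close>.\<close>

definition coords :: "nat \<Rightarrow> (nat \<Rightarrow> nat) \<Rightarrow> (nat \<times> nat) set" where
  "coords n s = (SIGMA i:{1..n}. {1..s i})"

text \<open>The module record extends the ring record, so \<open>mult\<close> and \<open>one\<close> have to be given values;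
  they play no role.\<close>

definition power_sum_module ::
    "nat \<Rightarrow> (nat \<Rightarrow> nat) \<Rightarrow> (nat \<Rightarrow> ('a, 'm) ring_scheme) \<Rightarrow> (nat \<Rightarrow> 'a, nat \<times> nat \<Rightarrow> 'a) module"
  where
  "power_sum_module n s K = (let P = product_ring (coords n s) (\<lambda>(i, j). K i) in
     \<lparr>carrier = carrier P, monoid.mult = (\<otimes>\<^bsub>P\<^esub>), one = \<one>\<^bsub>P\<^esub>,
      ring.zero = \<zero>\<^bsub>P\<^esub>, add = (\<oplus>\<^bsub>P\<^esub>),
      smult = (\<lambda>c v. \<lambda>(i, j)\<in>coords n s. c i \<otimes>\<^bsub>K i\<^esub> v (i, j))\<rparr>)"

text \<open>The direct sum over \<open>i\<close> of \<open>A\<^sub>i\<^bsup>s\<^sub>i - 1\<^esup> \<oplus> B\<^sub>i\<close>.\<close>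

definition split_sum ::
    "nat \<Rightarrow> (nat \<Rightarrow> nat) \<Rightarrow> (nat \<Rightarrow> 'a set) \<Rightarrow> (nat \<Rightarrow> 'a set) \<Rightarrow> (nat \<times> nat \<Rightarrow> 'a) set" where
  "split_sum n s A B = (\<Pi>\<^sub>E (i, j)\<in>coords n s. if j < s i then A i else B i)"

definition is_order ::
    "'q set \<Rightarrow> ('q, 'm) ring_scheme \<Rightarrow> ('q \<Rightarrow> 'r) \<Rightarrow> ('r, 'n) ring_scheme \<Rightarrow> 'r set \<Rightarrow> bool" where
  "is_order Z Q h K R \<longleftrightarrow> subring R K \<and> is_lattice Z Q (restrict_scalars h (regular_module K)) R"

definition conductor :: "('r, 'm) ring_scheme \<Rightarrow> 'r set \<Rightarrow> 'r set \<Rightarrow> 'r set" where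
  "conductor K R \<O> = {x \<in> carrier K. \<forall>y\<in>\<O>. x \<otimes>\<^bsub>K\<^esub> y \<in> R}"

end

theory Submission
  imports Defs
begin

text \<open>
  By the linear automorphisms of \<open>V\<close> over \<open>K\<close> it suffices to bring the \<open>\<O>\<close>-lattice
  \<open>N = M\<O>\<close> into the form \<open>\<Oplus>\<^sub>i (\<O>\<^sub>i\<^bsup>s\<^sub>i - 1\<^esup> \<oplus> I\<^sub>i)\<close> (Steinitz): the lower bound in (iii) is
  \<open>\<ff> N \<subseteq> R M = M\<close>. This is done one coordinate at a time. For coordinates \<open>p \<noteq> q\<close> of the
  same summand there is a functional \<open>b v\<^sub>p + a v\<^sub>q\<close> with \<open>b \<noteq> 0\<close> which maps \<open>N\<close> onto \<open>\<O>\<^sub>i\<close>; taking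
  it as the new coordinate \<open>p\<close>, a vector of \<open>N\<close> on which it is \<open>1\<close> splits off. To find it, fix
  \<open>b\<close> with \<open>b v\<^sub>p \<in> \<O>\<^sub>i\<close> on \<open>N\<close>; only the finitely many primes containing the values of \<open>b v\<^sub>p\<close> on
  the vectors of \<open>N\<close> supported at \<open>p\<close> must be avoided, and \<open>a\<close> is found because the fractional
  ideal of the \<open>v\<^sub>q\<close> is invertible.

  Invertibility uses only that \<open>\<O>\<^sub>i\<close> is noetherian of dimension at most one and contains every
  \<open>x\<close> with \<open>x L \<subseteq> L\<close> for some nonzero ideal \<open>L\<close>. For the integral closure these properties
  follow from the ascending chain condition for submodules of finitely generated \<open>Z\<close>-modules.
\<close>

section \<open>Ideals of a Dedekind ring inside its fraction field\<close>

text \<open>One \<open>K\<close>-linear automorphism \<phi> settles all claims together. It is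
  linear over \<open>R\<close>, over \<O> and over \<open>Z\<close>, so
  \<open>M' = \<phi>(M)\<close> is isomorphic to \<open>M\<close>, is again a lattice, and satisfies
  \<open>M'\<O> = \<phi>(M\<O>)\<close>. This is why the splitting is realised by changes of
  coordinates of \<open>V\<close> and not by an abstract decomposition of \<open>N\<close> into
  projective modules. The obstacle is that the change of coordinates must be invertible, which
  forces \<open>b \<noteq> 0\<close>; so \<open>b\<close> is fixed in advance and all the freedom is
  in \<open>a\<close>. A prime that does not contain the values of \<open>b v_p\<close> on the
  vectors supported at \<open>p\<close> is harmless, because the term in \<open>a\<close> vanishes
  on these vectors. Their values form a nonzero ideal because \<open>N\<close> spans
  \<open>V\<close>, so the primes left are finitely many and nonzero. The last coordinate of each
  summand is the partner \<open>q\<close> in every step and is never normalised itself. The ideal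
  class of the summand gathers there: \<open>I_i\<close> is the projection of the final module to
  coordinate \<open>s_i\<close>.\<close>

definition (in ring) submod :: "'a set \<Rightarrow> 'a set \<Rightarrow> bool" where
  "submod A N \<longleftrightarrow> N \<subseteq> carrier R \<and> \<zero> \<in> N \<and> (\<forall>x\<in>N. \<forall>y\<in>N. x \<oplus> y \<in> N) \<and> (\<forall>a\<in>A. \<forall>x\<in>N. a \<otimes> x \<in> N)"

text \<open>The ascending chain condition as well-foundedness, larger submodules counting as
  smaller. In this form it gives noetherian induction and passes through lexicographic products and
  inverse images. \<open>U\<close> only bounds the submodules and need not be one itself.\<close>

definition (in ring) acc_on :: "'a set \<Rightarrow> 'a set \<Rightarrow> bool" where
  "acc_on A U \<longleftrightarrow> wf {(N', N). submod A N \<and> submod A N' \<and> N \<subset> N' \<and> N' \<subseteq> U}"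

definition (in ring) prime_in :: "'a set \<Rightarrow> 'a set \<Rightarrow> bool" where
  "prime_in A P \<longleftrightarrow> submod A P \<and> P \<subseteq> A \<and> \<one> \<notin> P \<and>
     (\<forall>x\<in>A. \<forall>y\<in>A. x \<otimes> y \<in> P \<longrightarrow> x \<in> P \<or> y \<in> P)"

text \<open>Nonzero primes are maximal, phrased elementwise: each \<open>x\<close> outside
  \<open>P\<close> is a unit modulo \<open>P\<close>. No quotient ring has to be formed.\<close>

definition (in ring) dim_le_one :: "'a set \<Rightarrow> bool" where
  "dim_le_one A \<longleftrightarrow> (\<forall>P. prime_in A P \<and> P \<noteq> {\<zero>} \<longrightarrow>
     (\<forall>x\<in>A - P. \<exists>p\<in>P. \<exists>y\<in>A. \<one> = p \<oplus> x \<otimes> y))"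

context ring
begin

lemma submodI:
  assumes "N \<subseteq> carrier R" "\<zero> \<in> N" "\<And>x y. x \<in> N \<Longrightarrow> y \<in> N \<Longrightarrow> x \<oplus> y \<in> N"
    "\<And>a x. a \<in> A \<Longrightarrow> x \<in> N \<Longrightarrow> a \<otimes> x \<in> N"
  shows "submod A N"
  using assms by (auto simp: submod_def)

lemma submodD:
  assumes "submod A N"
  shows "\<And>x. x \<in> N \<Longrightarrow> x \<in> carrier R" "\<zero> \<in> N" "\<And>x y. x \<in> N \<Longrightarrow> y \<in> N \<Longrightarrow> x \<oplus> y \<in> N"
    "\<And>a x. a \<in> A \<Longrightarrow> x \<in> N \<Longrightarrow> a \<otimes> x \<in> N"
  using assms by (auto simp: submod_def)

lemma submod_uminus:
  assumes "subring A R" "submod A N" "x \<in> N"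
  shows "\<ominus> x \<in> N"
proof -
  have "\<ominus> \<one> \<in> A" using subringE(5)[OF assms(1)] subringE(3)[OF assms(1)] by blast
  then have "(\<ominus> \<one>) \<otimes> x \<in> N" using assms submodD by blast
  moreover have "x \<in> carrier R" using assms submodD by blast
  ultimately show ?thesis by (simp add: l_minus)
qed

lemma submod_minus:
  assumes "subring A R" "submod A N" "x \<in> N" "y \<in> N"
  shows "x \<ominus> y \<in> N"
  using submod_uminus[OF assms(1,2,4)] submodD(3)[OF assms(2,3)] by (simp add: minus_eq)

lemma acc_on_mono: "acc_on A Y \<Longrightarrow> U \<subseteq> Y \<Longrightarrow> acc_on A U"
  unfolding acc_on_def by (erule wf_subset) auto

lemma acc_on_induct [consumes 3, case_names step]:
  assumes "acc_on A U" "submod A N" "N \<subseteq> U"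
    and "\<And>N. submod A N \<Longrightarrow> N \<subseteq> U \<Longrightarrow>
      (\<And>N'. submod A N' \<Longrightarrow> N' \<subseteq> U \<Longrightarrow> N \<subset> N' \<Longrightarrow> P N') \<Longrightarrow> P N"
  shows "P N"
  using assms(2,3)
proof (induction N rule: wf_induct_rule[OF assms(1)[unfolded acc_on_def]])
  case (1 N)
  then show ?case using assms(4)[of N] by auto
qed

end

locale field_subring = field K for K :: "('a, 'k) ring_scheme" (structure) +
  fixes A :: "'a set"
  assumes subring_A: "subring A K"
begin

lemma A_carrier [simp]: "x \<in> A \<Longrightarrow> x \<in> carrier K"
  using subringE(1)[OF subring_A] by blast

lemma A_closed [simp]: "\<zero> \<in> A" "\<one> \<in> A" "x \<in> A \<Longrightarrow> y \<in> A \<Longrightarrow> x \<oplus> y \<in> A"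
  "x \<in> A \<Longrightarrow> y \<in> A \<Longrightarrow> x \<otimes> y \<in> A" "x \<in> A \<Longrightarrow> \<ominus> x \<in> A" "x \<in> A \<Longrightarrow> y \<in> A \<Longrightarrow> x \<ominus> y \<in> A"
  using subringE[OF subring_A] by (auto simp: minus_eq)

text \<open>The ideal \<open>I + xA\<close> is the larger ideal to which the arguments by noetherian
  induction and by maximality pass.\<close>

lemma submod_adjoin:
  assumes "submod A I" "x \<in> carrier K"
  shows "submod A {i \<oplus> x \<otimes> a | i a. i \<in> I \<and> a \<in> A}"
proof (rule submodI)
  note I = submodD[OF assms(1)]
  show "{i \<oplus> x \<otimes> a | i a. i \<in> I \<and> a \<in> A} \<subseteq> carrier K" using I assms by auto
  show "\<zero> \<in> {i \<oplus> x \<otimes> a | i a. i \<in> I \<and> a \<in> A}"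
    using I(2) assms by (auto intro!: exI[of _ \<zero>])
next
  note I = submodD[OF assms(1)]
  fix u v assume "u \<in> {i \<oplus> x \<otimes> a | i a. i \<in> I \<and> a \<in> A}" "v \<in> {i \<oplus> x \<otimes> a | i a. i \<in> I \<and> a \<in> A}"
  then obtain i a j b where *: "u = i \<oplus> x \<otimes> a" "v = j \<oplus> x \<otimes> b" "i \<in> I" "j \<in> I" "a \<in> A" "b \<in> A"
    by auto
  then have "u \<oplus> v = (i \<oplus> j) \<oplus> x \<otimes> (a \<oplus> b)"
    using I(1) assms by (simp add: r_distr a_ac)
  moreover have "i \<oplus> j \<in> I" "a \<oplus> b \<in> A" using * I by auto
  ultimately show "u \<oplus> v \<in> {i \<oplus> x \<otimes> a | i a. i \<in> I \<and> a \<in> A}" by blast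
next
  note I = submodD[OF assms(1)]
  fix c u assume "u \<in> {i \<oplus> x \<otimes> a | i a. i \<in> I \<and> a \<in> A}" "c \<in> A"
  then obtain i a where *: "u = i \<oplus> x \<otimes> a" "i \<in> I" "a \<in> A" by auto
  then have "c \<otimes> u = (c \<otimes> i) \<oplus> x \<otimes> (c \<otimes> a)"
    using I(1) assms \<open>c \<in> A\<close> by (simp add: r_distr m_ac)
  moreover have "c \<otimes> i \<in> I" "c \<otimes> a \<in> A" using * I \<open>c \<in> A\<close> by auto
  ultimately show "c \<otimes> u \<in> {i \<oplus> x \<otimes> a | i a. i \<in> I \<and> a \<in> A}" by blast
qed

lemma adjoin_psubset:
  assumes "submod A I" "x \<in> A" "x \<notin> I"
  shows "I \<subset> {i \<oplus> x \<otimes> a | i a. i \<in> I \<and> a \<in> A}"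
proof -
  note I = submodD[OF assms(1)]
  have "i \<in> {i \<oplus> x \<otimes> a | i a. i \<in> I \<and> a \<in> A}" if "i \<in> I" for i
  proof -
    have "i = i \<oplus> x \<otimes> \<zero>" using that I(1) assms(2) by simp
    then show ?thesis using that A_closed(1) by blast
  qed
  moreover have "x \<in> {i \<oplus> x \<otimes> a | i a. i \<in> I \<and> a \<in> A}"
  proof -
    have "x = \<zero> \<oplus> x \<otimes> \<one>" using assms(2) by simp
    then show ?thesis using I(2) A_closed(2) by blast
  qed
  ultimately show ?thesis using assms(3) by blast
qed

lemma adjoin_subset: "I \<subseteq> A \<Longrightarrow> x \<in> A \<Longrightarrow> {i \<oplus> x \<otimes> a | i a. i \<in> I \<and> a \<in> A} \<subseteq> A"
  by auto

lemma prime_inD: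
  assumes "prime_in A P"
  shows "submod A P" "P \<subseteq> A" "\<one> \<notin> P" "\<And>x y. x \<in> A \<Longrightarrow> y \<in> A \<Longrightarrow> x \<otimes> y \<in> P \<Longrightarrow> x \<in> P \<or> y \<in> P"
  using assms by (auto simp: prime_in_def)

end

text \<open>The working notion of a Dedekind ring. \<open>stabilizer\<close> is integral closedness
  in the shape in which it is applied, to a multiplier of a nonzero ideal;
  \<open>denominator\<close> says that \<open>K\<close> is the field of fractions of
  \<open>A\<close>. A field is included: it has no nonzero primes, and statements about them are
  vacuous.\<close>

locale dedekind_subring = field_subring +
  assumes acc: "acc_on A A"
    and dim1: "dim_le_one A"
    and stabilizer: "\<And>L x. submod A L \<Longrightarrow> L \<subseteq> A \<Longrightarrow> L \<noteq> {\<zero>} \<Longrightarrow> x \<in> carrier K \<Longrightarrow>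
      (\<And>l. l \<in> L \<Longrightarrow> x \<otimes> l \<in> L) \<Longrightarrow> x \<in> A"
    and denominator: "\<And>y. y \<in> carrier K \<Longrightarrow> \<exists>c\<in>A - {\<zero>}. c \<otimes> y \<in> A"
begin

section \<open>Products of primes inside ideals\<close>

definition list_prod :: "'a list \<Rightarrow> 'a" where
  "list_prod xs = foldr (\<otimes>) xs \<one>"

lemma list_prod_simps [simp]: "list_prod [] = \<one>" "list_prod (x # xs) = x \<otimes> list_prod xs"
  by (auto simp: list_prod_def)

lemma list_prod_closed: "set xs \<subseteq> A \<Longrightarrow> list_prod xs \<in> A"
  by (induction xs) auto

lemma list_prod_append:
  "set xs \<subseteq> A \<Longrightarrow> set ys \<subseteq> A \<Longrightarrow> list_prod (xs @ ys) = list_prod xs \<otimes> list_prod ys"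
  by (induction xs) (auto simp: list_prod_closed m_assoc)

text \<open>The inclusion \<open>P_1 ... P_r \<subseteq> I\<close> for an ideal \<open>I\<close>:
  products of representatives generate the product ideal, so testing these suffices and no product
  of ideals is formed. The empty list stands for the unit ideal.\<close>

definition contains_product :: "'a set \<Rightarrow> 'a set list \<Rightarrow> bool" where
  "contains_product I Ps \<longleftrightarrow> (\<forall>xs. list_all2 (\<in>) xs Ps \<longrightarrow> list_prod xs \<in> I)"

lemma choice_in_A:
  assumes "list_all2 (\<in>) xs Ps" "\<forall>P\<in>set Ps. P \<subseteq> A"
  shows "set xs \<subseteq> A"
  using assms by (induction rule: list_all2_induct) auto

lemma contains_product_append:
  assumes "contains_product I Ps" "contains_product J Qs" "\<forall>P\<in>set (Ps @ Qs). P \<subseteq> A"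
    and "\<And>x y. x \<in> I \<Longrightarrow> y \<in> J \<Longrightarrow> x \<otimes> y \<in> L"
  shows "contains_product L (Ps @ Qs)"
  unfolding contains_product_def
proof (intro allI impI)
  fix xs assume "list_all2 (\<in>) xs (Ps @ Qs)"
  then obtain ys zs where *: "xs = ys @ zs" "list_all2 (\<in>) ys Ps" "list_all2 (\<in>) zs Qs"
    by (auto simp: list_all2_append2)
  then have "list_prod xs = list_prod ys \<otimes> list_prod zs"
    using assms(3) choice_in_A[of ys Ps] choice_in_A[of zs Qs] by (auto intro!: list_prod_append)
  then show "list_prod xs \<in> L" using * assms by (auto simp: contains_product_def)
qed

text \<open>Noetherian induction: if \<open>I\<close> is proper and not prime, witnesses
  \<open>x\<close>, \<open>y\<close> give larger ideals \<open>I + xA\<close> and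
  \<open>I + yA\<close> whose product lies in \<open>I\<close>. Concatenating their lists of primes
  gives one for \<open>I\<close>.\<close>

lemma ideal_contains_prime_product:
  assumes "submod A I" "I \<subseteq> A" "I \<noteq> {\<zero>}"
  shows "\<exists>Ps. (\<forall>P\<in>set Ps. prime_in A P \<and> P \<noteq> {\<zero>}) \<and> contains_product I Ps"
  using acc assms
proof (induction I rule: acc_on_induct)
  case (step I)
  note I = submodD[OF step(1)]
  show ?case
  proof (cases "\<one> \<in> I")
    case True
    then show ?thesis by (intro exI[of _ "[]"]) (auto simp: contains_product_def)
  next
    case one: False
    show ?thesis
    proof (cases "prime_in A I")
      case True
      have "contains_product I [I]"
        unfolding contains_product_def using I by (auto simp: list_all2_Cons2)
      then show ?thesis using True step by (intro exI[of _ "[I]"]) auto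
    next
      case False
      then obtain x y where xy: "x \<in> A" "y \<in> A" "x \<otimes> y \<in> I" "x \<notin> I" "y \<notin> I"
        using one step by (auto simp: prime_in_def)
      define U where "U = {i \<oplus> x \<otimes> a | i a. i \<in> I \<and> a \<in> A}"
      define Y where "Y = {i \<oplus> y \<otimes> a | i a. i \<in> I \<and> a \<in> A}"
      have U: "submod A U" "U \<subseteq> A" "I \<subset> U" unfolding U_def
        using submod_adjoin adjoin_subset adjoin_psubset step xy by auto
      have Y: "submod A Y" "Y \<subseteq> A" "I \<subset> Y" unfolding Y_def
        using submod_adjoin adjoin_subset adjoin_psubset step xy by auto
      have nz: "U \<noteq> {\<zero>}" "Y \<noteq> {\<zero>}" using U(3) Y(3) I(2) by auto
      obtain Ps where Ps: "\<forall>P\<in>set Ps. prime_in A P \<and> P \<noteq> {\<zero>}" "contains_product U Ps"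
        using step.IH[OF U nz(1)] by blast
      obtain Qs where Qs: "\<forall>P\<in>set Qs. prime_in A P \<and> P \<noteq> {\<zero>}" "contains_product Y Qs"
        using step.IH[OF Y nz(2)] by blast
      have "contains_product I (Ps @ Qs)"
      proof (rule contains_product_append[OF Ps(2) Qs(2)])
        show "\<forall>P\<in>set (Ps @ Qs). P \<subseteq> A" using Ps Qs prime_inD(2) by auto
        fix u v assume "u \<in> U" "v \<in> Y"
        then obtain i a j b where *: "i \<in> I" "j \<in> I" "a \<in> A" "b \<in> A"
          "u = i \<oplus> x \<otimes> a" "v = j \<oplus> y \<otimes> b"
          by (auto simp: U_def Y_def)
        have A: "i \<in> A" "j \<in> A" using * step by auto
        have "u \<otimes> v = (j \<oplus> y \<otimes> b) \<otimes> i \<oplus> ((x \<otimes> a) \<otimes> j \<oplus> (a \<otimes> b) \<otimes> (x \<otimes> y))"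
          using * A xy by (simp add: r_distr l_distr m_ac a_ac)
        moreover have "(j \<oplus> y \<otimes> b) \<otimes> i \<in> I" "(x \<otimes> a) \<otimes> j \<in> I" "(a \<otimes> b) \<otimes> (x \<otimes> y) \<in> I"
          using * A xy by (auto intro!: I(4))
        ultimately show "u \<otimes> v \<in> I" using I(3) by auto
      qed
      then show ?thesis using Ps Qs by (intro exI[of _ "Ps @ Qs"]) auto
    qed
  qed
qed

text \<open>If no factor were inside \<open>P\<close>, a representative outside \<open>P\<close>
  could be chosen from each, and by primeness their product would be outside
  \<open>P\<close>.\<close>

lemma prime_contains_factor:
  assumes "prime_in A P" "contains_product P Ps" "\<forall>P'\<in>set Ps. P' \<subseteq> A"
  shows "\<exists>P'\<in>set Ps. P' \<subseteq> P"
proof (rule ccontr)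
  assume neg: "\<not> ?thesis"
  have "\<exists>xs. list_all2 (\<in>) xs Ps \<and> list_prod xs \<notin> P"
    using neg assms(3)
  proof (induction Ps)
    case Nil
    then show ?case using prime_inD(3)[OF assms(1)] by auto
  next
    case (Cons P' Ps)
    then obtain xs where xs: "list_all2 (\<in>) xs Ps" "list_prod xs \<notin> P" by auto
    obtain x where x: "x \<in> P'" "x \<notin> P" using Cons by auto
    have "set xs \<subseteq> A" using xs(1) Cons.prems choice_in_A by auto
    moreover have "x \<in> A" using x Cons.prems by auto
    ultimately have "x \<otimes> list_prod xs \<notin> P"
      using prime_inD(4)[OF assms(1), of x "list_prod xs"] x xs list_prod_closed by blast
    then show ?case using xs x by (intro exI[of _ "x # xs"]) auto
  qed
  then show False using assms(2) by (auto simp: contains_product_def)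
qed

lemma nonzero_prime_maximal:
  assumes "prime_in A P" "P \<noteq> {\<zero>}" "prime_in A P'" "P \<subseteq> P'"
  shows "P = P'"
proof (rule ccontr)
  assume "P \<noteq> P'"
  then obtain x where x: "x \<in> P'" "x \<notin> P" using assms(4) by auto
  note P' = prime_inD[OF assms(3)]
  obtain p y where "p \<in> P" "y \<in> A" "\<one> = p \<oplus> x \<otimes> y"
    using dim1 assms(1,2) x P'(2) unfolding dim_le_one_def by blast
  moreover have "x \<otimes> y = y \<otimes> x" using x P'(2) calculation by (auto simp: m_comm)
  ultimately have "\<one> \<in> P'"
    using x assms(4) submodD[OF P'(1)] by auto
  then show False using P'(3) by simp
qed

text \<open>A prime above \<open>I\<close> contains a product of nonzero primes, hence one of the
  factors, and equals it because nonzero primes are maximal. So all these primes occur in one finite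
  list.\<close>

lemma finite_primes_above:
  assumes "submod A I" "I \<subseteq> A" "I \<noteq> {\<zero>}"
  shows "finite {P. prime_in A P \<and> I \<subseteq> P}"
proof -
  obtain Ps where Ps: "\<forall>P\<in>set Ps. prime_in A P \<and> P \<noteq> {\<zero>}" "contains_product I Ps"
    using ideal_contains_prime_product[OF assms] by blast
  have PsA: "\<forall>P'\<in>set Ps. P' \<subseteq> A" using Ps(1) prime_inD(2) by auto
  have "P \<in> set Ps" if P: "prime_in A P" "I \<subseteq> P" for P
  proof -
    have "contains_product P Ps" using Ps(2) P(2) by (auto simp: contains_product_def)
    then obtain P' where P': "P' \<in> set Ps" "P' \<subseteq> P"
      using prime_contains_factor[OF P(1)] PsA by blast
    then show ?thesis using nonzero_prime_maximal[of P' P] Ps(1) P by auto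
  qed
  then have "{P. prime_in A P \<and> I \<subseteq> P} \<subseteq> set Ps" by auto
  then show ?thesis using finite_subset by blast
qed

text \<open>The chain condition takes the place of Zorn's lemma. If
  \<open>x \<otimes> y \<in> I\<close> with \<open>x\<close>, \<open>y\<close> outside
  \<open>I\<close>, then \<open>I + xA\<close> is still proper: \<open>1 = i + xa\<close> would give
  \<open>y = yi + a(xy) \<in> I\<close>.\<close>

lemma proper_ideal_in_prime:
  assumes "submod A I" "I \<subseteq> A" "\<one> \<notin> I"
  shows "\<exists>P. prime_in A P \<and> I \<subseteq> P"
  using acc assms
proof (induction I rule: acc_on_induct)
  case (step I)
  note I = submodD[OF step(1)]
  show ?case
  proof (cases "prime_in A I")
    case False
    then obtain x y where xy: "x \<in> A" "y \<in> A" "x \<otimes> y \<in> I" "x \<notin> I" "y \<notin> I"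
      using step by (auto simp: prime_in_def)
    define U where "U = {i \<oplus> x \<otimes> a | i a. i \<in> I \<and> a \<in> A}"
    have U: "submod A U" "U \<subseteq> A" "I \<subset> U" unfolding U_def
      using submod_adjoin adjoin_subset adjoin_psubset step xy by auto
    have "\<one> \<notin> U"
    proof
      assume "\<one> \<in> U"
      then obtain i a where *: "i \<in> I" "a \<in> A" "\<one> = i \<oplus> x \<otimes> a" by (auto simp: U_def)
      have "y = y \<otimes> (i \<oplus> x \<otimes> a)" using xy by (subst *(3)[symmetric]) simp
      also have "\<dots> = y \<otimes> i \<oplus> a \<otimes> (x \<otimes> y)"
        using * xy I(1) by (simp add: r_distr m_ac)
      also have "\<dots> \<in> I" using I * xy by auto
      finally show False using xy by simp
    qed
    then show ?thesis using step.IH[OF U] U(3) by blast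
  qed auto
qed

lemma one_mem_ideal_if_in_no_prime:
  assumes "submod A I" "I \<subseteq> A" "\<And>P. prime_in A P \<Longrightarrow> \<not> I \<subseteq> P"
  shows "\<one> \<in> I"
  using proper_ideal_in_prime[of I] assms by blast

section \<open>Inverses of ideals\<close>

text \<open>For \<open>p \<noteq> 0\<close> in \<open>P\<close>, a shortest product of nonzero
  primes contained in \<open>pA\<close> has \<open>P\<close> among its factors. The product of the
  other factors is not contained in \<open>pA\<close>, and \<open>x = y / p\<close> works for an
  element \<open>y\<close> of it outside \<open>pA\<close>.\<close>

lemma prime_inverse_element:
  assumes "prime_in A P" "P \<noteq> {\<zero>}"
  shows "\<exists>x\<in>carrier K - A. \<forall>p\<in>P. x \<otimes> p \<in> A"
proof -
  note P = prime_inD[OF assms(1)]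
  note PM = submodD[OF P(1)]
  obtain p where p: "p \<in> P" "p \<noteq> \<zero>" using assms(2) PM(2) by auto
  have pA: "p \<in> A" using p P by auto
  define I where "I = {p \<otimes> a | a. a \<in> A}"
  have I: "submod A I"
  proof (rule submodI)
    show "I \<subseteq> carrier K" using pA by (auto simp: I_def)
    show "\<zero> \<in> I" using pA by (auto simp: I_def intro!: exI[of _ \<zero>])
    show "x \<oplus> y \<in> I" if xy: "x \<in> I" "y \<in> I" for x y
    proof -
      obtain a b where "a \<in> A" "b \<in> A" "x = p \<otimes> a" "y = p \<otimes> b"
        using xy unfolding I_def by blast
      then show ?thesis using pA by (auto simp: I_def r_distr intro!: exI[of _ "a \<oplus> b"])
    qed
    show "c \<otimes> x \<in> I" if cx: "c \<in> A" "x \<in> I" for c x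
    proof -
      obtain a where "a \<in> A" "x = p \<otimes> a" using cx by (auto simp: I_def)
      then show ?thesis using pA that by (auto simp: I_def m_ac intro!: exI[of _ "c \<otimes> a"])
    qed
  qed
  have IA: "I \<subseteq> A" using pA by (auto simp: I_def)
  have "p \<in> I" using pA by (auto simp: I_def intro!: exI[of _ \<one>])
  then have I0: "I \<noteq> {\<zero>}" using p by auto
  have IP: "I \<subseteq> P"
  proof
    fix x assume "x \<in> I"
    then obtain a where "a \<in> A" "x = a \<otimes> p" using pA by (auto simp: I_def m_comm)
    then show "x \<in> P" using PM p by auto
  qed
  define good where "good Ps \<longleftrightarrow> (\<forall>P\<in>set Ps. prime_in A P \<and> P \<noteq> {\<zero>}) \<and> contains_product I Ps" for Ps
  have "\<exists>Ps. good Ps" using ideal_contains_prime_product[OF I IA I0] by (auto simp: good_def)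
  then obtain Ps where Ps: "good Ps" "\<And>Qs. good Qs \<Longrightarrow> length Ps \<le> length Qs"
    by (metis ex_has_least_nat[of good _ length])
  have PsA: "\<forall>P'\<in>set Ps. P' \<subseteq> A" using Ps(1) prime_inD(2) by (auto simp: good_def)
  have "contains_product P Ps" using Ps(1) IP by (auto simp: good_def contains_product_def)
  then obtain P' where "P' \<in> set Ps" "P' \<subseteq> P"
    using prime_contains_factor[OF assms(1)] PsA by blast
  then have "P \<in> set Ps"
    using nonzero_prime_maximal[of P' P] Ps(1) assms(1) by (auto simp: good_def)
  then obtain Qs1 Qs2 where Q: "Ps = Qs1 @ P # Qs2" by (meson split_list)
  \<comment> \<open>Minimal length: with one occurrence of \<open>P\<close> removed, the product of
    the list is no longer inside \<open>pA\<close>.\<close>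
  then have "\<not> good (Qs1 @ Qs2)" using Ps(2)[of "Qs1 @ Qs2"] by auto
  then obtain xs where xs: "list_all2 (\<in>) xs (Qs1 @ Qs2)" "list_prod xs \<notin> I"
    using Ps(1) Q by (auto simp: good_def contains_product_def)
  then obtain ys zs where yz: "xs = ys @ zs" "list_all2 (\<in>) ys Qs1" "list_all2 (\<in>) zs Qs2"
    by (auto simp: list_all2_append2)
  have yzA: "set ys \<subseteq> A" "set zs \<subseteq> A"
    using yz choice_in_A[of ys Qs1] choice_in_A[of zs Qs2] PsA Q by auto
  define y where "y = list_prod xs"
  have yA: "y \<in> A" using yz yzA by (auto simp: y_def intro!: list_prod_closed)
  have pinv: "inv p \<in> carrier K" "p \<otimes> inv p = \<one>" "inv p \<otimes> p = \<one>"
    using p(2) pA field_Units by auto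
  define x where "x = y \<otimes> inv p"
  have xc: "x \<in> carrier K" using yA pinv by (auto simp: x_def)
  have xp: "p \<otimes> x = y" using pinv yA pA
    by (simp add: x_def m_lcomm[of p y "inv p"])
  have "x \<notin> A" using xp xs(2) by (auto simp: I_def y_def)
  moreover have "x \<otimes> u \<in> A" if u: "u \<in> P" for u
  proof -
    have uA: "u \<in> A" using u P by auto
    \<comment> \<open>Putting \<open>u \<in> P\<close> in the place of the removed factor gives a
      product in \<open>pA\<close>, and this product is \<open>u \<otimes> y\<close>.\<close>
    have "list_all2 (\<in>) (ys @ u # zs) Ps" unfolding Q using yz u by (intro list_all2_appendI) auto
    then have "list_prod (ys @ u # zs) \<in> I" using Ps(1) by (auto simp: good_def contains_product_def)
    moreover have "list_prod (ys @ u # zs) = u \<otimes> y"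
      unfolding y_def yz(1) using yzA uA
      by (simp add: list_prod_append list_prod_closed m_lcomm)
    ultimately obtain a where a: "a \<in> A" "u \<otimes> y = p \<otimes> a" by (auto simp: I_def)
    have "x \<otimes> u = inv p \<otimes> (u \<otimes> y)" using uA yA pinv by (simp add: x_def m_ac)
    also have "\<dots> = a" using a pinv pA by (simp flip: m_assoc)
    finally show ?thesis using a by simp
  qed
  ultimately show ?thesis using xc by blast
qed

text \<open>Let \<open>J'\<close> be the set of \<open>a\<close> with
  \<open>aJ \<subseteq> A\<close>. If \<open>J'J \<subseteq> P\<close>, then an \<open>x\<close>
  outside \<open>A\<close> with \<open>xP \<subseteq> A\<close> satisfies
  \<open>xJ'J \<subseteq> A\<close>, that is \<open>xJ' \<subseteq> J'\<close>, which forces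
  \<open>x \<in> A\<close>. So \<open>J\<close> is invertible at \<open>P\<close>. The bound
  \<open>c\<close> shows that \<open>J'\<close> is nonzero.\<close>

lemma local_inverse_element:
  assumes J: "submod A J" "J \<noteq> {\<zero>}" and c: "c \<in> carrier K" "c \<noteq> \<zero>" "\<And>j. j \<in> J \<Longrightarrow> c \<otimes> j \<in> A"
    and P: "prime_in A P" "P \<noteq> {\<zero>}"
  shows "\<exists>a\<in>carrier K. (\<forall>j\<in>J. a \<otimes> j \<in> A) \<and> (\<exists>j\<in>J. a \<otimes> j \<notin> P)"
proof (rule ccontr)
  note JD = submodD[OF J(1)]
  assume "\<not> ?thesis"
  then have neg: "a \<otimes> j \<in> P" if "a \<in> carrier K" "\<forall>j\<in>J. a \<otimes> j \<in> A" "j \<in> J" for a j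
    using that by blast
  obtain x where x: "x \<in> carrier K" "x \<notin> A" "\<And>p. p \<in> P \<Longrightarrow> x \<otimes> p \<in> A"
    using prime_inverse_element[OF P] by blast
  obtain j where j: "j \<in> J" "j \<noteq> \<zero>" using J JD(2) by auto
  have jc: "j \<in> carrier K" using j JD by auto
  \<comment> \<open>Multiplication by a fixed nonzero \<open>j \<in> J\<close> moves the fractional
    ideal of all such \<open>a\<close> into \<open>A\<close>, where \<open>stabilizer\<close> can be
    applied.\<close>
  define L where "L = {a \<otimes> j | a. a \<in> carrier K \<and> (\<forall>j\<in>J. a \<otimes> j \<in> A)}"
  have "submod A L"
  proof (rule submodI)
    show "L \<subseteq> carrier K" using jc by (auto simp: L_def)
    show "\<zero> \<in> L" using jc JD(1) by (auto simp: L_def intro!: exI[of _ \<zero>])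
    show "u \<oplus> v \<in> L" if uv: "u \<in> L" "v \<in> L" for u v
    proof -
      obtain a b where "a \<in> carrier K" "\<forall>j\<in>J. a \<otimes> j \<in> A" "u = a \<otimes> j"
        "b \<in> carrier K" "\<forall>j\<in>J. b \<otimes> j \<in> A" "v = b \<otimes> j"
        using uv unfolding L_def by blast
      then show ?thesis using jc JD(1)
        by (auto simp: L_def l_distr intro!: exI[of _ "a \<oplus> b"])
    qed
    show "d \<otimes> u \<in> L" if du: "d \<in> A" "u \<in> L" for d u
    proof -
      obtain a where "a \<in> carrier K" "\<forall>j\<in>J. a \<otimes> j \<in> A" "u = a \<otimes> j"
        using du by (auto simp: L_def)
      then show ?thesis using jc JD(1) that
        by (auto simp: L_def m_assoc intro!: exI[of _ "d \<otimes> a"])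
    qed
  qed
  moreover have "L \<subseteq> A" using j by (auto simp: L_def)
  moreover have "L \<noteq> {\<zero>}"
  proof -
    have "c \<otimes> j \<in> L" using c by (auto simp: L_def)
    moreover have "c \<otimes> j \<noteq> \<zero>" using c j jc integral by blast
    ultimately show ?thesis by auto
  qed
  moreover have "x \<otimes> l \<in> L" if l: "l \<in> L" for l
  proof -
    obtain a where a: "a \<in> carrier K" "\<forall>j\<in>J. a \<otimes> j \<in> A" "l = a \<otimes> j"
      using l by (auto simp: L_def)
    have "\<forall>j\<in>J. (x \<otimes> a) \<otimes> j \<in> A" using x a JD(1) neg[OF a(1,2)] by (simp add: m_assoc)
    then show ?thesis using a x jc by (auto simp: L_def m_assoc intro!: exI[of _ "x \<otimes> a"])
  qed
  ultimately have "x \<in> A" using stabilizer x(1) by blast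
  then show False using x(2) by simp
qed

section \<open>Avoiding finitely many primes\<close>

text \<open>Distinct nonzero primes are incomparable, so each \<open>P \<in> S\<close> has an
  element outside \<open>P0\<close>. The product of these elements is in every
  \<open>P \<in> S\<close> and stays outside the prime \<open>P0\<close>.\<close>

lemma element_avoiding_primes:
  assumes "finite S" and S: "\<And>P. P \<in> S \<Longrightarrow> prime_in A P \<and> P \<noteq> {\<zero>}" "P0 \<notin> S" "prime_in A P0" "P0 \<noteq> {\<zero>}"
  shows "\<exists>e\<in>A. (\<forall>P\<in>S. e \<in> P) \<and> e \<notin> P0"
  using assms
proof (induction S)
  case empty
  then show ?case using prime_inD(3) by (intro bexI[of _ \<one>]) auto
next
  case (insert P S)
  then obtain e where e: "e \<in> A" "\<forall>P\<in>S. e \<in> P" "e \<notin> P0" by blast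
  have "\<not> P \<subseteq> P0" using nonzero_prime_maximal[of P P0] insert.prems by auto
  then obtain x where x: "x \<in> P" "x \<notin> P0" by auto
  have xA: "x \<in> A" using x insert.prems prime_inD(2) by blast
  have PS: "submod A P'" if "P' \<in> insert P S" for P' using insert.prems prime_inD(1) that by blast
  have "e \<otimes> x \<in> P" using e x submodD(4)[OF PS] by auto
  moreover have "e \<otimes> x \<in> P'" if "P' \<in> S" for P'
    using submodD(4)[of A P' x e] PS that e xA by (auto simp: m_comm)
  moreover have "e \<otimes> x \<notin> P0" using prime_inD(4)[OF insert.prems(3) e(1) xA] e x by auto
  ultimately show ?case using e xA by (intro bexI[of _ "e \<otimes> x"]) auto
qed

text \<open>Replaces the Chinese remainder theorem: the primes are treated one after the other, and
  the correction for a new prime is multiplied by an element of all the previous ones.\<close>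

lemma multiplier_avoiding_primes:
  assumes J: "submod A (u ` N)" "u ` N \<noteq> {\<zero>}"
    and c: "c \<in> carrier K" "c \<noteq> \<zero>" "\<And>v. v \<in> N \<Longrightarrow> c \<otimes> u v \<in> A"
    and m: "\<And>v. v \<in> N \<Longrightarrow> m v \<in> A"
    and S: "finite S" "\<And>P. P \<in> S \<Longrightarrow> prime_in A P \<and> P \<noteq> {\<zero>}"
  shows "\<exists>a\<in>carrier K. (\<forall>v\<in>N. a \<otimes> u v \<in> A) \<and> (\<forall>P\<in>S. \<exists>v\<in>N. m v \<oplus> a \<otimes> u v \<notin> P)"
  using S
proof (induction S)
  case empty
  have "u v \<in> carrier K" if "v \<in> N" for v using J that submodD(1) by blast
  then show ?case by (intro bexI[of _ \<zero>]) auto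
next
  case (insert P S)
  then obtain a where a: "a \<in> carrier K" "\<forall>v\<in>N. a \<otimes> u v \<in> A" "\<forall>P\<in>S. \<exists>v\<in>N. m v \<oplus> a \<otimes> u v \<notin> P"
    by auto
  have uc: "u v \<in> carrier K" if "v \<in> N" for v using J that submodD(1) by blast
  show ?case
  proof (cases "\<exists>v\<in>N. m v \<oplus> a \<otimes> u v \<notin> P")
    case True
    then show ?thesis using a by auto
  next
    case False
    have P: "prime_in A P" "P \<noteq> {\<zero>}" using insert.prems by auto
    obtain e where e: "e \<in> A" "\<forall>P\<in>S. e \<in> P" "e \<notin> P"
      using element_avoiding_primes[of S P] insert P by blast
    obtain b w where b: "b \<in> carrier K" "\<forall>v\<in>N. b \<otimes> u v \<in> A" "w \<in> N" "b \<otimes> u w \<notin> P"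
      using local_inverse_element[OF J c(1,2) _ P] c(3) by auto
    define a' where "a' = a \<oplus> e \<otimes> b"
    have eq: "m v \<oplus> a' \<otimes> u v = (m v \<oplus> a \<otimes> u v) \<oplus> e \<otimes> (b \<otimes> u v)" if "v \<in> N" for v
      using that uc[OF that] m[OF that] a(1) b(1) e(1) by (simp add: a'_def l_distr m_assoc a_assoc)
    have "a' \<in> carrier K" using a b e by (simp add: a'_def)
    moreover have "a' \<otimes> u v \<in> A" if "v \<in> N" for v
      using that uc[OF that] a b e by (simp add: a'_def l_distr m_assoc)
    \<comment> \<open>In this case all values \<open>m v \<oplus> a \<otimes> u v\<close> lie in
      \<open>P\<close>, so the new value at \<open>w\<close> is congruent modulo \<open>P\<close> to
      \<open>e \<otimes> (b \<otimes> u w)\<close>, a product of two elements outside the prime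
      \<open>P\<close>.\<close>
    moreover have "m w \<oplus> a' \<otimes> u w \<notin> P"
    proof
      assume in_P: "m w \<oplus> a' \<otimes> u w \<in> P"
      have *: "m w \<oplus> a \<otimes> u w \<in> P" "m w \<oplus> a \<otimes> u w \<in> A" "e \<otimes> (b \<otimes> u w) \<in> A"
        using False b a e m by auto
      then have "e \<otimes> (b \<otimes> u w) = (m w \<oplus> a' \<otimes> u w) \<ominus> (m w \<oplus> a \<otimes> u w)"
        unfolding eq[OF b(3)] minus_eq using A_carrier
        by (smt (verit) a_comm a_assoc add.inv_closed add.m_closed r_neg r_zero)
      also have "\<dots> \<in> P" using submod_minus[OF subring_A prime_inD(1)[OF P(1)] in_P *(1)] .
      finally show False using prime_inD(4)[OF P(1) e(1)] b e by auto
    qed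
    moreover have "\<exists>v\<in>N. m v \<oplus> a' \<otimes> u v \<notin> P'" if P': "P' \<in> S" for P'
    proof -
      obtain v where v: "v \<in> N" "m v \<oplus> a \<otimes> u v \<notin> P'" using a P' by auto
      have sP: "submod A P'" using insert.prems P' prime_inD(1) by blast
      have "(b \<otimes> u v) \<otimes> e \<in> P'" using submodD(4)[OF sP] b e v P' by blast
      then have eb: "e \<otimes> (b \<otimes> u v) \<in> P'" using b v e by (simp add: m_comm)
      have "m v \<oplus> a' \<otimes> u v \<notin> P'"
      proof
        assume "m v \<oplus> a' \<otimes> u v \<in> P'"
        from submod_minus[OF subring_A sP this eb]
        have "(m v \<oplus> a \<otimes> u v) \<oplus> e \<otimes> (b \<otimes> u v) \<ominus> e \<otimes> (b \<otimes> u v) \<in> P'"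
          by (simp only: eq[OF v(1)])
        moreover have "e \<otimes> (b \<otimes> u v) \<in> carrier K" "m v \<oplus> a \<otimes> u v \<in> carrier K"
          using v b a e m by auto
        ultimately show False using v(2) by (simp add: minus_eq a_assoc r_neg)
      qed
      then show ?thesis using v by blast
    qed
    ultimately show ?thesis using b(3) by (intro bexI[of _ a']) auto
  qed
qed

end

section \<open>Integral extensions of a noetherian ring of dimension one\<close>

text \<open>The span of a list, peeling off one generator at a time. The inductions follow this
  recursion: a coefficient at the first generator, and a rest in the span of the others.\<close>

fun (in ring) span_list :: "'a set \<Rightarrow> 'a list \<Rightarrow> 'a set" where
  "span_list B [] = {\<zero>}"
| "span_list B (t # ts) = {b \<otimes> t \<oplus> w | b w. b \<in> B \<and> w \<in> span_list B ts}"

context field_subring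
begin

lemma submod_span_list:
  assumes "set ts \<subseteq> carrier K"
  shows "submod A (span_list A ts)"
  using assms
proof (induction ts)
  case Nil
  then show ?case by (auto simp: submod_def)
next
  case (Cons t ts)
  then have S: "submod A (span_list A ts)" and t: "t \<in> carrier K" by auto
  note SD = submodD[OF S]
  show ?case
  proof (rule submodI)
    show "span_list A (t # ts) \<subseteq> carrier K" using t SD by auto
    have "\<zero> = \<zero> \<otimes> t \<oplus> \<zero>" using t by simp
    then show "\<zero> \<in> span_list A (t # ts)" using SD(2) A_closed(1) by (simp, blast)
  next
    fix x y assume "x \<in> span_list A (t # ts)" "y \<in> span_list A (t # ts)"
    then obtain b w c v where *: "b \<in> A" "w \<in> span_list A ts" "c \<in> A" "v \<in> span_list A ts"
      "x = b \<otimes> t \<oplus> w" "y = c \<otimes> t \<oplus> v" by auto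
    have "x \<oplus> y = (b \<oplus> c) \<otimes> t \<oplus> (w \<oplus> v)"
      using * t SD(1) by (simp add: l_distr a_ac)
    moreover have "b \<oplus> c \<in> A" "w \<oplus> v \<in> span_list A ts" using * SD by auto
    ultimately show "x \<oplus> y \<in> span_list A (t # ts)" by (simp, blast)
  next
    fix a x assume a: "a \<in> A" and "x \<in> span_list A (t # ts)"
    then obtain b w where *: "b \<in> A" "w \<in> span_list A ts" "x = b \<otimes> t \<oplus> w" by auto
    have "a \<otimes> x = (a \<otimes> b) \<otimes> t \<oplus> a \<otimes> w"
      using * t SD(1) a by (simp add: r_distr m_assoc)
    moreover have "a \<otimes> b \<in> A" "a \<otimes> w \<in> span_list A ts" using * SD a by auto
    ultimately show "a \<otimes> x \<in> span_list A (t # ts)" by (simp, blast)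
  qed
qed

lemma span_list_superset:
  assumes "set ts \<subseteq> carrier K"
  shows "set ts \<subseteq> span_list A ts"
  using assms
proof (induction ts)
  case (Cons t ts)
  have S: "submod A (span_list A ts)" using Cons submod_span_list by auto
  note SD = submodD[OF S]
  have "t = \<one> \<otimes> t \<oplus> \<zero>" using Cons.prems by simp
  then have "t \<in> span_list A (t # ts)" using SD(2) A_closed(2) by (simp, blast)
  moreover have "x \<in> span_list A (t # ts)" if x: "x \<in> set ts" for x
  proof -
    have "x = \<zero> \<otimes> t \<oplus> x" using Cons.prems x by auto
    moreover have "x \<in> span_list A ts" using x Cons by auto
    ultimately show ?thesis using A_closed(1) by (simp, blast)
  qed
  ultimately show ?case by auto
qed auto

text \<open>The submodule \<open>N\<close> is determined, among the submodules containing it, by its ideal of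
  leading coefficients at \<open>t\<close> together with its intersection with the span of \<open>ts\<close>.\<close>

lemma acc_on_span_list:
  assumes "acc_on A A" "set ts \<subseteq> carrier K"
  shows "acc_on A (span_list A ts)"
  using assms(2)
proof (induction ts)
  case Nil
  have "{(N', N). submod A N \<and> submod A N' \<and> N \<subset> N' \<and> N' \<subseteq> {\<zero>}} = {}"
    by (auto simp: submod_def)
  then show ?case unfolding acc_on_def span_list.simps by (simp only:) (simp add: wf_def)
next
  case (Cons t ts)
  define S where "S = span_list A ts"
  have S: "submod A S" and t: "t \<in> carrier K" and IH: "acc_on A S"
    using Cons submod_span_list by (auto simp: S_def)
  note SD = submodD[OF S]
  define lead where "lead N = {b \<in> A. \<exists>w\<in>S. b \<otimes> t \<oplus> w \<in> N}" for N
  define rel where "rel U = {(N', N). submod A N \<and> submod A N' \<and> N \<subset> N' \<and> N' \<subseteq> U}" for U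
  have lead: "submod A (lead N)" if N: "submod A N" for N
  proof (rule submodI)
    note ND = submodD[OF N]
    show "lead N \<subseteq> carrier K" by (auto simp: lead_def)
    have "\<zero> \<otimes> t \<oplus> \<zero> \<in> N" using ND t by auto
    then show "\<zero> \<in> lead N" using SD(2) A_closed(1) unfolding lead_def by blast
  next
    note ND = submodD[OF N]
    fix b c assume "b \<in> lead N" "c \<in> lead N"
    then obtain w v where *: "b \<in> A" "c \<in> A" "w \<in> S" "v \<in> S" "b \<otimes> t \<oplus> w \<in> N" "c \<otimes> t \<oplus> v \<in> N"
      by (auto simp: lead_def)
    have "(b \<oplus> c) \<otimes> t \<oplus> (w \<oplus> v) = (b \<otimes> t \<oplus> w) \<oplus> (c \<otimes> t \<oplus> v)"
      using * t SD(1) by (simp add: l_distr a_ac)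
    also have "\<dots> \<in> N" using ND * by auto
    finally show "b \<oplus> c \<in> lead N" using * SD(3) unfolding lead_def by auto
  next
    note ND = submodD[OF N]
    fix a b assume a: "a \<in> A" and "b \<in> lead N"
    then obtain w where *: "b \<in> A" "w \<in> S" "b \<otimes> t \<oplus> w \<in> N" by (auto simp: lead_def)
    have "(a \<otimes> b) \<otimes> t \<oplus> a \<otimes> w = a \<otimes> (b \<otimes> t \<oplus> w)"
      using * t SD(1) a by (simp add: r_distr m_assoc)
    also have "\<dots> \<in> N" using ND * a by auto
    finally show "a \<otimes> b \<in> lead N" using * a SD(4) unfolding lead_def by auto
  qed
  \<comment> \<open>A larger submodule has a larger ideal of leading coefficients, or the same ideal
    and a larger intersection with \<open>S\<close>: lexicographic descent on the pair.\<close>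
  have "wf (inv_image (rel A <*lex*> rel S) (\<lambda>N. (lead N, N \<inter> S)))"
    using assms(1) IH by (auto simp: acc_on_def rel_def)
  moreover have "rel (span_list A (t # ts)) \<subseteq> inv_image (rel A <*lex*> rel S) (\<lambda>N. (lead N, N \<inter> S))"
  proof (rule subrelI)
    fix N' N assume "(N', N) \<in> rel (span_list A (t # ts))"
    then have N: "submod A N" "submod A N'" "N \<subset> N'" "N' \<subseteq> span_list A (t # ts)"
      by (auto simp: rel_def)
    have int: "submod A (M \<inter> S)" if "submod A M" for M
      using that S by (auto simp: submod_def)
    have "lead N \<subseteq> lead N'" using N by (auto simp: lead_def)
    moreover have "N \<inter> S \<subset> N' \<inter> S" if eq: "lead N = lead N'"
    proof (rule ccontr)
      assume "\<not> N \<inter> S \<subset> N' \<inter> S"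
      then have eq2: "N \<inter> S = N' \<inter> S" using N by auto
      obtain x where x: "x \<in> N'" "x \<notin> N" using N by auto
      then obtain b w where bw: "b \<in> A" "w \<in> S" "x = b \<otimes> t \<oplus> w"
        using N(4) by (auto simp: S_def)
      \<comment> \<open>\<open>x\<close> and an element of \<open>N\<close> with the same leading
        coefficient \<open>b\<close> differ by an element of
        \<open>N' \<inter> S = N \<inter> S\<close>, so \<open>x\<close> would lie in
        \<open>N\<close>.\<close>
      then have "b \<in> lead N" using x eq by (auto simp: lead_def)
      then obtain v where v: "v \<in> S" "b \<otimes> t \<oplus> v \<in> N" by (auto simp: lead_def)
      have c: "b \<otimes> t \<in> carrier K" "v \<in> carrier K" "w \<in> carrier K" using bw v t SD(1) by auto
      have "x \<ominus> (b \<otimes> t \<oplus> v) \<in> N'" using submod_minus[OF subring_A N(2) x(1)] v N(3) by auto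
      moreover have eq3: "x \<ominus> (b \<otimes> t \<oplus> v) = w \<ominus> v" unfolding bw(3) minus_eq using c
        by (simp add: minus_add a_ac r_neg1 r_neg)
      moreover have "w \<ominus> v \<in> S" using submod_minus[OF subring_A S bw(2) v(1)] .
      ultimately have "w \<ominus> v \<in> N" using eq2 by auto
      then have "(b \<otimes> t \<oplus> v) \<oplus> (w \<ominus> v) \<in> N" using v submodD(3)[OF N(1)] by auto
      moreover have "(b \<otimes> t \<oplus> v) \<oplus> (w \<ominus> v) = x"
        unfolding bw(3) minus_eq using c by (simp add: a_assoc a_lcomm[of v w] r_neg)
      ultimately show False using x by simp
    qed
    ultimately show "(N', N) \<in> inv_image (rel A <*lex*> rel S) (\<lambda>N. (lead N, N \<inter> S))"
      using lead[OF N(1)] lead[OF N(2)] int[OF N(1)] int[OF N(2)]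
      by (auto simp: rel_def lead_def)
  qed
  ultimately show ?case unfolding acc_on_def rel_def using wf_subset by blast
qed

text \<open>The powers are listed in descending order because a polynomial is a coefficient list
  with the leading coefficient first: the coefficients of a combination form \<open>p\<close> as
  they stand. The length is exactly \<open>k\<close>, leading zeros included.\<close>

lemma span_powers_eval:
  assumes "x \<in> carrier K" "l \<in> carrier K" "w \<in> span_list A (map (\<lambda>j. x [^] j \<otimes> l) (rev [0..<k]))"
  shows "\<exists>p. set p \<subseteq> A \<and> length p = k \<and> w = eval p x \<otimes> l"
  using assms(3)
proof (induction k arbitrary: w)
  case 0
  then show ?case using assms by auto
next
  case (Suc k)
  then obtain b v where bv: "b \<in> A" "v \<in> span_list A (map (\<lambda>j. x [^] j \<otimes> l) (rev [0..<k]))"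
    "w = b \<otimes> (x [^] k \<otimes> l) \<oplus> v" by auto
  then obtain p where p: "set p \<subseteq> A" "length p = k" "v = eval p x \<otimes> l" using Suc.IH by blast
  have "set p \<subseteq> carrier K" using p by auto
  then have "eval p x \<in> carrier K" using eval_in_carrier assms by auto
  then have "w = eval (b # p) x \<otimes> l" using p bv assms by (simp add: l_distr m_assoc)
  then show ?case using p bv by (intro exI[of _ "b # p"]) auto
qed

lemma eval_map_uminus:
  assumes "set p \<subseteq> carrier K" "x \<in> carrier K"
  shows "eval (map (a_inv K) p) x = \<ominus> eval p x"
  using assms by (induction p) (auto simp: eval_in_carrier l_minus minus_add)

text \<open>No determinants are needed: the chain of modules generated by
  \<open>l, x l, \<dots>, x\<^bsup>k - 1\<^esup> l\<close> for a nonzero \<open>l \<in> L\<close> becomes stationary.\<close>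

lemma stabilizer_integral:
  assumes acc: "acc_on A A" and ts: "set ts \<subseteq> carrier K"
    and L: "submod A L" "L \<subseteq> span_list A ts" "L \<noteq> {\<zero>}"
    and x: "x \<in> carrier K" "\<And>l. l \<in> L \<Longrightarrow> x \<otimes> l \<in> L"
  shows "x \<in> integral_closure A K"
proof -
  note LD = submodD[OF L(1)]
  obtain l where l: "l \<in> L" "l \<noteq> \<zero>" using L LD(2) by auto
  have lc: "l \<in> carrier K" using l LD by auto
  have pow: "x [^] k \<otimes> l \<in> L" for k :: nat
  proof (induction k)
    case (Suc k)
    have "x [^] Suc k \<otimes> l = x \<otimes> (x [^] k \<otimes> l)" using x lc by (simp add: m_ac)
    then show ?case using Suc x by auto
  qed (use l lc in auto)
  define N where "N k = span_list A (map (\<lambda>j. x [^] j \<otimes> l) (rev [0..<k]))" for k :: nat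
  have N: "submod A (N k)" for k
    unfolding N_def using x lc by (auto intro!: submod_span_list)
  have NS: "N (Suc k) = {b \<otimes> (x [^] k \<otimes> l) \<oplus> w | b w. b \<in> A \<and> w \<in> N k}" for k
    by (simp add: N_def)
  have mono: "N k \<subseteq> N (Suc k)" for k
  proof
    fix w assume w: "w \<in> N k"
    then have "w = \<zero> \<otimes> (x [^] k \<otimes> l) \<oplus> w" using x lc submodD(1)[OF N] by auto
    then show "w \<in> N (Suc k)" using w A_closed(1) unfolding NS by blast
  qed
  have NL: "N k \<subseteq> L" for k
  proof (induction k)
    case 0
    then show ?case using LD by (simp add: N_def)
  next
    case (Suc k)
    then show ?case unfolding NS using LD pow by auto
  qed
  have "\<exists>k. N (Suc k) = N k"
  proof (rule ccontr)
    assume "\<not> ?thesis"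
    then have "\<forall>k. (N (Suc k), N k) \<in>
      {(N', N). submod A N \<and> submod A N' \<and> N \<subset> N' \<and> N' \<subseteq> span_list A ts}"
      using N mono subset_trans[OF NL L(2)] by (simp add: psubset_eq) metis
    then show False
      using acc_on_span_list[OF acc ts] unfolding acc_on_def wf_iff_no_infinite_down_chain by blast
  qed
  then obtain k where k: "N (Suc k) = N k" by blast
  have "x [^] k \<otimes> l = \<one> \<otimes> (x [^] k \<otimes> l) \<oplus> \<zero>" using x lc by simp
  then have "x [^] k \<otimes> l \<in> N (Suc k)" using A_closed(2) submodD(2)[OF N] unfolding NS by blast
  then obtain p where p: "set p \<subseteq> A" "length p = k" "x [^] k \<otimes> l = eval p x \<otimes> l"
    using span_powers_eval[OF x(1) lc, of _ k] k unfolding N_def by metis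
  have pc: "set p \<subseteq> carrier K" using p by auto
  then have ev: "eval p x \<in> carrier K" using eval_in_carrier x by auto
  \<comment> \<open>Cancelling \<open>l\<close> leaves an equation for \<open>x\<close> alone. As
    \<open>p\<close> has length \<open>k\<close>, prepending \<open>\<one>\<close> to its negative
    gives a monic polynomial of degree \<open>k\<close> with root \<open>x\<close>.\<close>
  then have "eval p x = x [^] k" using p(3) l lc x m_rcancel by auto
  then have "eval (\<one> # map (a_inv K) p) x = \<zero>"
    using eval_map_uminus[OF pc x(1)] p(2) x(1) by (simp add: r_neg)
  moreover have "polynomial A (\<one> # map (a_inv K) p)"
    using p by (auto simp: polynomial_def)
  ultimately show ?thesis unfolding integral_closure_def using x(1)
    by (intro CollectI conjI exI[of _ "\<one> # map (a_inv K) p"]) auto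
qed

lemma subset_integral_closure: "A \<subseteq> integral_closure A K"
proof
  fix b assume b: "b \<in> A"
  then have "eval [\<one>, \<ominus> b] b = \<zero>" by (simp add: r_neg)
  moreover have "polynomial A [\<one>, \<ominus> b]" using b by (auto simp: polynomial_def)
  ultimately show "b \<in> integral_closure A K"
    unfolding integral_closure_def using b by (intro CollectI conjI exI[of _ "[\<one>, \<ominus> b]"]) auto
qed

lemma eval_in_subring:
  assumes "set p \<subseteq> A" "x \<in> A"
  shows "eval p x \<in> A"
proof -
  have "x [^] k \<in> A" for k :: nat using assms by (induction k) auto
  then show ?thesis using assms by (induction p) auto
qed

end

text \<open>A monic equation of minimal degree for \<open>x\<close> modulo a prime \<open>P\<close> has constant term outside
  \<open>P\<close>.\<close>

lemma (in field_subring) prime_integral_base_element: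
  assumes C: "field_subring K C" "C \<subseteq> A" and int: "A \<subseteq> integral_closure C K"
    and P: "prime_in A P" and x: "x \<in> A" "x \<notin> P"
  shows "\<exists>c\<in>C. c \<notin> P \<and> (\<exists>p\<in>P. \<exists>y\<in>A. c = p \<oplus> x \<otimes> y)"
proof -
  note PD = prime_inD[OF P]
  note PM = submodD[OF PD(1)]
  interpret C: field_subring K C by fact
  define good where "good q \<longleftrightarrow> set q \<subseteq> C \<and> q \<noteq> [] \<and> hd q = \<one> \<and> eval q x \<in> P" for q
  obtain q0 where "polynomial C q0" "q0 \<noteq> []" "hd q0 = \<one>" "eval q0 x = \<zero>"
    using x int unfolding integral_closure_def by blast
  then have "good q0" using PM(2) by (auto simp: good_def polynomial_def)
  then obtain q where q: "good q" "\<And>r. good r \<Longrightarrow> length q \<le> length r"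
    by (metis ex_has_least_nat[of good _ length])
  obtain r c where r: "q = r @ [c]" using q(1) by (cases q rule: rev_cases) (auto simp: good_def)
  have rC: "set r \<subseteq> C" "c \<in> C" using q(1) r by (auto simp: good_def)
  have carr: "set r \<subseteq> carrier K" "c \<in> carrier K" "x \<in> carrier K" using rC x by auto
  have rA: "set r \<subseteq> A" "c \<in> A" using rC C by auto
  have evA: "eval r x \<in> A" using eval_in_subring rA x by auto
  have ev: "eval q x = eval r x \<otimes> x \<oplus> c" unfolding r using eval_append_aux carr by blast
  have qP: "eval r x \<otimes> x \<oplus> c \<in> P" using q(1) ev by (auto simp: good_def)
  have "c \<notin> P"
  proof
    assume c: "c \<in> P"
    \<comment> \<open>A constant term in \<open>P\<close> puts \<open>eval r x \<otimes> x\<close>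
      and, as \<open>x \<notin> P\<close>, also \<open>eval r x\<close> in \<open>P\<close>, against
      minimality. For this \<open>r\<close> must be monic, hence nonempty; an empty \<open>r\<close>
      would mean \<open>c = \<one>\<close>.\<close>
    have "r \<noteq> []"
    proof
      assume "r = []"
      then have "c = \<one>" using q(1) r by (auto simp: good_def)
      then show False using c PD(3) by simp
    qed
    have "eval r x \<otimes> x = (eval r x \<otimes> x \<oplus> c) \<ominus> c"
      using evA x carr by (simp add: minus_eq a_assoc r_neg)
    also have "\<dots> \<in> P" using submod_minus[OF subring_A PD(1) qP c] .
    finally have "eval r x \<in> P" using PD(4)[OF evA x(1)] x by auto
    then have "good r" using q(1) r \<open>r \<noteq> []\<close> by (auto simp: good_def)
    then show False using q(2)[of r] r by auto
  qed
  \<comment> \<open>Modulo \<open>P\<close> the equation reads \<open>c = - x r(x)\<close>, which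
    makes \<open>c\<close> a multiple of \<open>x\<close>.\<close>
  moreover have "c = (eval r x \<otimes> x \<oplus> c) \<oplus> x \<otimes> (\<ominus> eval r x)"
  proof -
    have "eval r x \<in> carrier K" using evA by auto
    then show ?thesis using carr by (simp add: r_minus m_comm[of x] a_ac r_neg1 r_neg)
  qed
  moreover have "\<ominus> eval r x \<in> A" using evA by simp
  ultimately show ?thesis using rC(2) qP by blast
qed

text \<open>Two uses of \<open>prime_integral_base_element\<close>. With the zero prime it yields a
  nonzero element of \<open>C\<close> in \<open>P\<close>, so \<open>P \<inter> C\<close> is a
  nonzero prime of \<open>C\<close>. With \<open>P\<close> itself it yields a multiple of
  \<open>x\<close> modulo \<open>P\<close> that lies in \<open>C\<close> outside \<open>P\<close>;
  this is invertible modulo \<open>P \<inter> C\<close>, so \<open>x\<close> is invertible modulo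
  \<open>P\<close>.\<close>

lemma (in field_subring) dim_le_one_integral:
  assumes C: "field_subring K C" "C \<subseteq> A" and int: "A \<subseteq> integral_closure C K"
    and dim: "dim_le_one C"
  shows "dim_le_one A"
  unfolding dim_le_one_def
proof (intro allI impI ballI)
  interpret C: field_subring K C by fact
  fix P x assume P: "prime_in A P \<and> P \<noteq> {\<zero>}" and x: "x \<in> A - P"
  note PD = prime_inD[OF conjunct1[OF P]]
  note PM = submodD[OF PD(1)]
  have zero: "prime_in A {\<zero>}"
    using integral by (auto simp: prime_in_def submod_def)
  have PC: "prime_in C (P \<inter> C)"
    unfolding prime_in_def submod_def using PD(3) PD(4) C PM by (simp add: subset_iff)
  obtain y where y: "y \<in> P" "y \<noteq> \<zero>" using P PM(2) by auto
  then obtain c z where c: "c \<in> C" "c \<noteq> \<zero>" "z \<in> A" "c = \<zero> \<oplus> y \<otimes> z"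
    using prime_integral_base_element[OF C int zero, of y] PD(2) by blast
  then have "c = z \<otimes> y" using y PD(2) by (auto simp: m_comm)
  then have "c \<in> P" using PM(4) c y by auto
  then have nz: "P \<inter> C \<noteq> {\<zero>}" using c by auto
  obtain b p w where b: "b \<in> C" "b \<notin> P" "p \<in> P" "w \<in> A" "b = p \<oplus> x \<otimes> w"
    using prime_integral_base_element[OF C int conjunct1[OF P], of x] x by auto
  then obtain p' b' where *: "p' \<in> P \<inter> C" "b' \<in> C" "\<one> = p' \<oplus> b \<otimes> b'"
    using dim PC nz unfolding dim_le_one_def by blast
  have A: "p \<in> A" "p' \<in> A" "b' \<in> A" "x \<in> A" "w \<in> A" using b * x C PD(2) by auto
  have "\<one> = (p' \<oplus> b' \<otimes> p) \<oplus> x \<otimes> (w \<otimes> b')"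
    unfolding *(3) b(5) using A by (simp add: l_distr r_distr m_ac a_ac)
  moreover have "p' \<oplus> b' \<otimes> p \<in> P" using PM * b A by auto
  moreover have "w \<otimes> b' \<in> A" using A by auto
  ultimately show "\<exists>p\<in>P. \<exists>y\<in>A. \<one> = p \<oplus> x \<otimes> y" by blast
qed

section \<open>Ideals, noetherian rings and maximal ideals in terms of submodules\<close>

lemma (in field_subring) ideal_iff_submod:
  "ideal I (K\<lparr>carrier := A\<rparr>) \<longleftrightarrow> submod A I \<and> I \<subseteq> A"
proof
  assume "ideal I (K\<lparr>carrier := A\<rparr>)"
  then interpret I: ideal I "K\<lparr>carrier := A\<rparr>" .
  have "I \<subseteq> A" using I.a_subset by simp
  moreover have "submod A I"
  proof (rule submodI)
    show "\<zero> \<in> I" using additive_subgroup.zero_closed[OF I.is_additive_subgroup] by simp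
    show "x \<oplus> y \<in> I" if "x \<in> I" "y \<in> I" for x y using additive_subgroup.a_closed[OF I.is_additive_subgroup that] by simp
    show "a \<otimes> x \<in> I" if "a \<in> A" "x \<in> I" for a x using I.I_l_closed[of x a] that by simp
  qed (use \<open>I \<subseteq> A\<close> in auto)
  ultimately show "submod A I \<and> I \<subseteq> A" by blast
next
  assume I: "submod A I \<and> I \<subseteq> A"
  note ID = submodD[OF conjunct1[OF I]]
  interpret S: ring "K\<lparr>carrier := A\<rparr>" using subring_is_ring[OF subring_A] .
  show "ideal I (K\<lparr>carrier := A\<rparr>)"
  proof (rule idealI)
    show "ring (K\<lparr>carrier := A\<rparr>)" by (rule S.ring_axioms)
    show "subgroup I (add_monoid (K\<lparr>carrier := A\<rparr>))"
    proof (rule S.add.subgroupI)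
      fix a assume a: "a \<in> I"
      then have "\<ominus> a \<in> I" using submod_uminus[OF subring_A] I by blast
      moreover have "\<ominus>\<^bsub>K\<lparr>carrier := A\<rparr>\<^esub> a = \<ominus> a"
        using a I by (intro S.minus_equality) (auto simp: l_neg)
      ultimately show "\<ominus>\<^bsub>K\<lparr>carrier := A\<rparr>\<^esub> a \<in> I" by simp
    qed (use I ID in auto)
  next
    fix a x assume "a \<in> I" "x \<in> carrier (K\<lparr>carrier := A\<rparr>)"
    then show "x \<otimes>\<^bsub>K\<lparr>carrier := A\<rparr>\<^esub> a \<in> I" "a \<otimes>\<^bsub>K\<lparr>carrier := A\<rparr>\<^esub> x \<in> I"
      using ID m_comm[of a x] by auto
  qed
qed

text \<open>A strictly ascending sequence is a chain of ideals, so its union is one of its members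
  \<open>f k\<close>, which then contains \<open>f (Suc k)\<close>.\<close>

lemma (in field_subring) noetherian_acc:
  assumes "noetherian_ring (K\<lparr>carrier := A\<rparr>)"
  shows "acc_on A A"
  unfolding acc_on_def wf_iff_no_infinite_down_chain
proof
  interpret S: noetherian_ring "K\<lparr>carrier := A\<rparr>" by fact
  assume "\<exists>f. \<forall>i. (f (Suc i), f i) \<in> {(N', N). submod A N \<and> submod A N' \<and> N \<subset> N' \<and> N' \<subseteq> A}"
  then obtain f where f: "\<And>i::nat. submod A (f i) \<and> submod A (f (Suc i)) \<and> f i \<subset> f (Suc i) \<and> f (Suc i) \<subseteq> A"
    by auto
  have mono: "f i \<subseteq> f j" if "i \<le> j" for i j
    using lift_Suc_mono_le[of f i j] that f by (simp add: psubset_eq)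
  have "ideal (f i) (K\<lparr>carrier := A\<rparr>)" for i
    using f[of i] unfolding ideal_iff_submod by auto
  then have "subset.chain {I. ideal I (K\<lparr>carrier := A\<rparr>)} (range f)"
    unfolding subset_chain_def
  proof (intro conjI ballI)
    fix I J assume "I \<in> range f" "J \<in> range f"
    then obtain i j where "I = f i" "J = f j" by auto
    then show "I \<subseteq> J \<or> J \<subseteq> I" using mono[of i j] mono[of j i] nat_le_linear[of i j] by auto
  qed auto
  then have "\<Union> (range f) \<in> range f" using S.ideal_chain_is_trivial[of "range f"] by blast
  then obtain k where "\<Union> (range f) = f k" by auto
  then have "f (Suc k) \<subseteq> f k" by auto
  then show False using f[of k] by auto
qed

lemma (in field_subring) prime_maximal_dim:
  assumes "\<And>P. primeideal P (K\<lparr>carrier := A\<rparr>) \<Longrightarrow> P \<noteq> {\<zero>} \<Longrightarrow> maximalideal P (K\<lparr>carrier := A\<rparr>)"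
  shows "dim_le_one A"
  unfolding dim_le_one_def
proof (intro allI impI ballI)
  interpret S: cring "K\<lparr>carrier := A\<rparr>"
    using subring_is_domain[OF subring_A] domain.axioms(1) by blast
  fix P x assume P: "prime_in A P \<and> P \<noteq> {\<zero>}" and x: "x \<in> A - P"
  note PD = prime_inD[OF conjunct1[OF P]]
  have "primeideal P (K\<lparr>carrier := A\<rparr>)"
  proof (rule primeidealI)
    show "ideal P (K\<lparr>carrier := A\<rparr>)" unfolding ideal_iff_submod using PD by auto
    show "carrier (K\<lparr>carrier := A\<rparr>) \<noteq> P" using PD(3) A_closed(2) by auto
  qed (use PD(4) S.cring_axioms in auto)
  then interpret M: maximalideal P "K\<lparr>carrier := A\<rparr>" using assms P by blast
  define J where "J = {i \<oplus> x \<otimes> a | i a. i \<in> P \<and> a \<in> A}"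
  have J: "submod A J" "J \<subseteq> A" "P \<subset> J" unfolding J_def
    using submod_adjoin adjoin_subset adjoin_psubset PD x by auto
  then have "ideal J (K\<lparr>carrier := A\<rparr>)" using ideal_iff_submod by auto
  then have "J = A" using M.I_maximal[of J] J by auto
  then have "\<one> \<in> J" by simp
  then show "\<exists>p\<in>P. \<exists>y\<in>A. \<one> = p \<oplus> x \<otimes> y" unfolding J_def by blast
qed

section \<open>Transport along a field embedding\<close>

text \<open>The hypotheses concern \<open>Z\<close> in \<open>Q\<close>, while the integral closure
  is taken over the image of \<open>Z\<close> in \<open>K\<close>; chain condition and dimension
  have to be carried through \<open>h\<close>.\<close>

locale subring_hom = Q: field_subring Q Z + K: field K for Q (structure) and Z and K (structure) +
  fixes h
  assumes hom: "h \<in> ring_hom Q K"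
begin

lemma h_simps [simp]:
  "x \<in> carrier Q \<Longrightarrow> h x \<in> carrier K"
  "x \<in> carrier Q \<Longrightarrow> y \<in> carrier Q \<Longrightarrow> h (x \<oplus>\<^bsub>Q\<^esub> y) = h x \<oplus>\<^bsub>K\<^esub> h y"
  "x \<in> carrier Q \<Longrightarrow> y \<in> carrier Q \<Longrightarrow> h (x \<otimes>\<^bsub>Q\<^esub> y) = h x \<otimes>\<^bsub>K\<^esub> h y"
  "h \<one>\<^bsub>Q\<^esub> = \<one>\<^bsub>K\<^esub>" "h \<zero>\<^bsub>Q\<^esub> = \<zero>\<^bsub>K\<^esub>"
  using hom ring_hom_zero[OF hom Q.ring_axioms K.ring_axioms] by (auto simp: ring_hom_def)

lemma h_inj: "inj_on h (carrier Q)"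
proof -
  interpret ring_hom_ring Q K h
    using hom by (simp add: ring_hom_ring.intro ring_hom_ring_axioms.intro Q.ring_axioms K.ring_axioms)
  interpret ring_hom_cring Q K h
    by (simp add: ring_hom_cring_def Q.cring_axioms K.cring_axioms ring_hom_cring_axioms_def hom)
  have "\<one>\<^bsub>K\<^esub> \<in> h ` carrier Q" using h_simps(4) Q.one_closed by (metis imageI)
  then have "h ` carrier Q \<noteq> {\<zero>\<^bsub>K\<^esub>}" using K.one_not_zero by blast
  then show ?thesis using non_trivial_field_hom_imp_inj Q.field_axioms by blast
qed

lemma image_field_subring: "field_subring K (h ` Z)"
proof -
  interpret ring_hom_ring Q K h
    using hom by (simp add: ring_hom_ring.intro ring_hom_ring_axioms.intro Q.ring_axioms K.ring_axioms)
  show ?thesis using img_is_subring[OF Q.subring_A] K.field_axioms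
    by (simp add: field_subring_def field_subring_axioms_def)
qed

lemma submod_preimage:
  assumes "K.submod (h ` Z) N"
  shows "Q.submod Z {z \<in> Z. h z \<in> N}"
  using K.submodD[OF assms] by (auto intro!: Q.submodI)

text \<open>Taking preimages is strictly monotone on subsets of the image of \<open>Z\<close>, so
  ascending chains there give ascending chains of ideals of \<open>Z\<close>.\<close>

lemma acc_on_image:
  assumes "Q.acc_on Z Z"
  shows "K.acc_on (h ` Z) (h ` Z)"
  unfolding K.acc_on_def
proof (rule wf_subset)
  show "wf (inv_image {(N', N). Q.submod Z N \<and> Q.submod Z N' \<and> N \<subset> N' \<and> N' \<subseteq> Z}
    (\<lambda>N. {z \<in> Z. h z \<in> N}))"
    using assms by (auto simp: Q.acc_on_def)
  have "{z \<in> Z. h z \<in> N} \<subset> {z \<in> Z. h z \<in> N'}" if "N \<subset> N'" "N' \<subseteq> h ` Z" for N N'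
    using that by blast
  then show "{(N', N). K.submod (h ` Z) N \<and> K.submod (h ` Z) N' \<and> N \<subset> N' \<and> N' \<subseteq> h ` Z}
    \<subseteq> inv_image {(N', N). Q.submod Z N \<and> Q.submod Z N' \<and> N \<subset> N' \<and> N' \<subseteq> Z}
    (\<lambda>N. {z \<in> Z. h z \<in> N})"
    using submod_preimage unfolding inv_image_def by blast
qed

lemma dim_le_one_image:
  assumes "Q.dim_le_one Z"
  shows "K.dim_le_one (h ` Z)"
  unfolding K.dim_le_one_def
proof (intro allI impI ballI)
  interpret B: field_subring K "h ` Z" by (rule image_field_subring)
  fix P x assume P: "K.prime_in (h ` Z) P \<and> P \<noteq> {\<zero>\<^bsub>K\<^esub>}" and x: "x \<in> h ` Z - P"
  note PD = B.prime_inD[OF conjunct1[OF P]]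
  define P0 where "P0 = {z \<in> Z. h z \<in> P}"
  have "Q.prime_in Z P0"
    using submod_preimage[OF PD(1)] PD(3) PD(4) by (auto simp: Q.prime_in_def P0_def)
  moreover have "P0 \<noteq> {\<zero>\<^bsub>Q\<^esub>}"
  proof
    assume eq: "P0 = {\<zero>\<^bsub>Q\<^esub>}"
    obtain y where y: "y \<in> P" "y \<noteq> \<zero>\<^bsub>K\<^esub>" using P K.submodD(2)[OF PD(1)] by auto
    then obtain z where "z \<in> Z" "y = h z" using PD(2) by auto
    then have "z \<in> P0" "z \<noteq> \<zero>\<^bsub>Q\<^esub>" using y by (auto simp: P0_def)
    then show False using eq by blast
  qed
  moreover obtain z where z: "z \<in> Z" "x = h z" using x by auto
  then have "z \<in> Z - P0" using x by (auto simp: P0_def)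
  ultimately obtain p y where *: "p \<in> P0" "y \<in> Z" "\<one>\<^bsub>Q\<^esub> = p \<oplus>\<^bsub>Q\<^esub> z \<otimes>\<^bsub>Q\<^esub> y"
    using assms unfolding Q.dim_le_one_def by blast
  have "p \<in> Z" "h p \<in> P" using * by (auto simp: P0_def)
  have "h \<one>\<^bsub>Q\<^esub> = h (p \<oplus>\<^bsub>Q\<^esub> z \<otimes>\<^bsub>Q\<^esub> y)" using * by (simp only:)
  then have "\<one>\<^bsub>K\<^esub> = h p \<oplus>\<^bsub>K\<^esub> x \<otimes>\<^bsub>K\<^esub> h y" using \<open>p \<in> Z\<close> z *(2) by simp
  then show "\<exists>p\<in>P. \<exists>y\<in>h ` Z. \<one>\<^bsub>K\<^esub> = p \<oplus>\<^bsub>K\<^esub> x \<otimes>\<^bsub>K\<^esub> y"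
    using \<open>h p \<in> P\<close> * by blast
qed

end

section \<open>Modules and linear automorphisms\<close>

text \<open>Automorphisms of the ambient module, not maps between submodules: such a map over
  \<open>K\<close> remains linear over every subring and after restriction of scalars, so it carries
  submodules, bases and lattices along at the same time.\<close>

definition linear_auto ::
    "('r, 'm) ring_scheme \<Rightarrow> ('r, 'v, 'n) module_scheme \<Rightarrow> ('v \<Rightarrow> 'v) \<Rightarrow> bool" where
  "linear_auto A W \<phi> \<longleftrightarrow> bij_betw \<phi> (carrier W) (carrier W) \<and>
     (\<forall>x\<in>carrier W. \<forall>y\<in>carrier W. \<phi> (x \<oplus>\<^bsub>W\<^esub> y) = \<phi> x \<oplus>\<^bsub>W\<^esub> \<phi> y) \<and>
     (\<forall>a\<in>carrier A. \<forall>x\<in>carrier W. \<phi> (a \<odot>\<^bsub>W\<^esub> x) = a \<odot>\<^bsub>W\<^esub> \<phi> x)"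

lemma linear_autoD:
  assumes "linear_auto A W \<phi>"
  shows "bij_betw \<phi> (carrier W) (carrier W)"
    "\<And>x. x \<in> carrier W \<Longrightarrow> \<phi> x \<in> carrier W"
    "\<And>x y. x \<in> carrier W \<Longrightarrow> y \<in> carrier W \<Longrightarrow> \<phi> (x \<oplus>\<^bsub>W\<^esub> y) = \<phi> x \<oplus>\<^bsub>W\<^esub> \<phi> y"
    "\<And>a x. a \<in> carrier A \<Longrightarrow> x \<in> carrier W \<Longrightarrow> \<phi> (a \<odot>\<^bsub>W\<^esub> x) = a \<odot>\<^bsub>W\<^esub> \<phi> x"
  using assms by (auto simp: linear_auto_def bij_betw_def)

lemma linear_auto_comp:
  assumes "linear_auto A W \<phi>" "linear_auto A W \<psi>"
  shows "linear_auto A W (\<psi> \<circ> \<phi>)"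
  using linear_autoD[OF assms(1)] linear_autoD[OF assms(2)]
  by (auto simp: linear_auto_def intro: bij_betw_trans)

lemma linear_auto_id: "linear_auto A W (\<lambda>x. x)"
  by (auto simp: linear_auto_def bij_betw_def)

lemma linear_autoI:
  assumes "\<And>x. x \<in> carrier W \<Longrightarrow> \<phi> x \<in> carrier W" "\<And>x. x \<in> carrier W \<Longrightarrow> \<psi> x \<in> carrier W"
    "\<And>x. x \<in> carrier W \<Longrightarrow> \<psi> (\<phi> x) = x" "\<And>x. x \<in> carrier W \<Longrightarrow> \<phi> (\<psi> x) = x"
    "\<And>x y. x \<in> carrier W \<Longrightarrow> y \<in> carrier W \<Longrightarrow> \<phi> (x \<oplus>\<^bsub>W\<^esub> y) = \<phi> x \<oplus>\<^bsub>W\<^esub> \<phi> y"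
    "\<And>a x. a \<in> carrier A \<Longrightarrow> x \<in> carrier W \<Longrightarrow> \<phi> (a \<odot>\<^bsub>W\<^esub> x) = a \<odot>\<^bsub>W\<^esub> \<phi> x"
  shows "linear_auto A W \<phi>"
  unfolding linear_auto_def
  using assms by (auto intro!: bij_betw_byWitness[where f' = \<psi>])

lemma module_subring:
  assumes "module A W" "subring C A"
  shows "module (A\<lparr>carrier := C\<rparr>) W"
proof -
  interpret module A W by fact
  have "cring (A\<lparr>carrier := C\<rparr>)"
    using R.subcring_iff[of C] R.subcringI'[OF assms(2)] subringE(1)[OF assms(2)] by blast
  then show ?thesis
    by (rule moduleI)
      (use subringE(1)[OF assms(2)] M.abelian_group_axioms in
        \<open>auto simp: smult_l_distr smult_r_distr smult_assoc1 subset_iff\<close>)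
qed

lemma linear_auto_subring:
  assumes "linear_auto A W \<phi>" "subring C A"
  shows "linear_auto (A\<lparr>carrier := C\<rparr>) W \<phi>"
  using assms subringE(1)[OF assms(2)] by (auto simp: linear_auto_def subset_iff)

lemma generated_submodule_least:
  "submodule N A W \<Longrightarrow> S \<subseteq> N \<Longrightarrow> generated_submodule A W S \<subseteq> N"
  by (auto simp: generated_submodule_def)

lemma generated_submodule_superset: "S \<subseteq> generated_submodule A W S"
  by (auto simp: generated_submodule_def)

context module
begin

lemma submodule_iff:
  "submodule N R M \<longleftrightarrow> N \<subseteq> carrier M \<and> \<zero>\<^bsub>M\<^esub> \<in> N \<and> (\<forall>x\<in>N. \<forall>y\<in>N. x \<oplus>\<^bsub>M\<^esub> y \<in> N) \<and>
     (\<forall>a\<in>carrier R. \<forall>x\<in>N. a \<odot>\<^bsub>M\<^esub> x \<in> N)"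
proof
  assume N: "submodule N R M"
  then have "\<zero>\<^bsub>M\<^esub> \<in> N" using subgroup.one_closed[OF submodule.axioms(1)[OF N]] by simp
  then show "N \<subseteq> carrier M \<and> \<zero>\<^bsub>M\<^esub> \<in> N \<and> (\<forall>x\<in>N. \<forall>y\<in>N. x \<oplus>\<^bsub>M\<^esub> y \<in> N) \<and>
     (\<forall>a\<in>carrier R. \<forall>x\<in>N. a \<odot>\<^bsub>M\<^esub> x \<in> N)"
    using submoduleE[OF N] by auto
next
  assume *: "N \<subseteq> carrier M \<and> \<zero>\<^bsub>M\<^esub> \<in> N \<and> (\<forall>x\<in>N. \<forall>y\<in>N. x \<oplus>\<^bsub>M\<^esub> y \<in> N) \<and>
     (\<forall>a\<in>carrier R. \<forall>x\<in>N. a \<odot>\<^bsub>M\<^esub> x \<in> N)"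
  have "\<ominus>\<^bsub>M\<^esub> x \<in> N" if "x \<in> N" for x
  proof -
    have "(\<ominus> \<one>) \<odot>\<^bsub>M\<^esub> x \<in> N" using * that by auto
    moreover have "x \<in> carrier M" using * that by auto
    ultimately show ?thesis by (simp add: smult_l_minus)
  qed
  then show "submodule N R M" using * by (intro submoduleI) auto
qed

lemma generated_submodule_submodule:
  assumes "S \<subseteq> carrier M"
  shows "submodule (generated_submodule R M S) R M"
proof -
  have "generated_submodule R M S \<subseteq> carrier M"
    using generated_submodule_least[OF carrier_is_submodule assms] .
  then show ?thesis
    unfolding submodule_iff by (auto simp: generated_submodule_def submodule_iff)
qed

lemma submodule_linear_image:
  assumes "linear_auto R M \<phi>" "submodule N R M"
  shows "submodule (\<phi> ` N) R M"
proof -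
  note \<phi> = linear_autoD[OF assms(1)]
  have N: "N \<subseteq> carrier M" "\<zero>\<^bsub>M\<^esub> \<in> N" "\<And>x y. x \<in> N \<Longrightarrow> y \<in> N \<Longrightarrow> x \<oplus>\<^bsub>M\<^esub> y \<in> N"
    "\<And>a x. a \<in> carrier R \<Longrightarrow> x \<in> N \<Longrightarrow> a \<odot>\<^bsub>M\<^esub> x \<in> N"
    using assms(2) unfolding submodule_iff by auto
  have z: "\<phi> \<zero>\<^bsub>M\<^esub> = \<zero>\<^bsub>M\<^esub>"
    using \<phi>(4)[of \<zero> "\<zero>\<^bsub>M\<^esub>"] \<phi>(2)[of "\<zero>\<^bsub>M\<^esub>"] by simp
  show ?thesis unfolding submodule_iff
  proof (intro conjI ballI)
    show "\<phi> ` N \<subseteq> carrier M" using N(1) \<phi>(2) by auto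
    show "\<zero>\<^bsub>M\<^esub> \<in> \<phi> ` N" using N(2) z by (metis imageI)
  next
    fix x y assume "x \<in> \<phi> ` N" "y \<in> \<phi> ` N"
    then obtain u v where uv: "u \<in> N" "v \<in> N" "x = \<phi> u" "y = \<phi> v" by auto
    then have "x \<oplus>\<^bsub>M\<^esub> y = \<phi> (u \<oplus>\<^bsub>M\<^esub> v)" using \<phi>(3) subsetD[OF N(1)] by simp
    then show "x \<oplus>\<^bsub>M\<^esub> y \<in> \<phi> ` N" using N(3) uv by auto
  next
    fix a x assume a: "a \<in> carrier R" and "x \<in> \<phi> ` N"
    then obtain u where u: "u \<in> N" "x = \<phi> u" by auto
    then have "a \<odot>\<^bsub>M\<^esub> x = \<phi> (a \<odot>\<^bsub>M\<^esub> u)" using \<phi>(4) subsetD[OF N(1)] a by simp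
    then show "a \<odot>\<^bsub>M\<^esub> x \<in> \<phi> ` N" using N(4) u a by auto
  qed
qed

lemma linear_auto_inv:
  assumes "linear_auto R M \<phi>"
  shows "linear_auto R M (inv_into (carrier M) \<phi>)"
proof -
  note \<phi> = linear_autoD[OF assms]
  let ?\<psi> = "inv_into (carrier M) \<phi>"
  have \<psi>: "?\<psi> x \<in> carrier M" "\<phi> (?\<psi> x) = x" if "x \<in> carrier M" for x
    using that bij_betw_inv_into_right[OF \<phi>(1) that] bij_betw_inv_into[OF \<phi>(1)]
    by (auto simp: bij_betw_def)
  have \<psi>l: "?\<psi> (\<phi> x) = x" if "x \<in> carrier M" for x
    using bij_betw_inv_into_left[OF \<phi>(1) that] .
  show ?thesis
  proof (rule linear_autoI[where \<psi> = \<phi>])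
    show "?\<psi> (x \<oplus>\<^bsub>M\<^esub> y) = ?\<psi> x \<oplus>\<^bsub>M\<^esub> ?\<psi> y" if "x \<in> carrier M" "y \<in> carrier M" for x y
    proof -
      have "x \<oplus>\<^bsub>M\<^esub> y = \<phi> (?\<psi> x \<oplus>\<^bsub>M\<^esub> ?\<psi> y)" using that \<psi> \<phi>(3) by simp
      then show ?thesis using \<psi>l \<psi> that by simp
    qed
    show "?\<psi> (a \<odot>\<^bsub>M\<^esub> x) = a \<odot>\<^bsub>M\<^esub> ?\<psi> x" if "a \<in> carrier R" "x \<in> carrier M" for a x
    proof -
      have "a \<odot>\<^bsub>M\<^esub> x = \<phi> (a \<odot>\<^bsub>M\<^esub> ?\<psi> x)" using that \<psi> \<phi>(4) by simp
      then show ?thesis using \<psi>l \<psi> that by simp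
    qed
  qed (use \<psi> \<psi>l \<phi> in auto)
qed

lemma generated_submodule_linear_image:
  assumes "linear_auto R M \<phi>" "S \<subseteq> carrier M"
  shows "generated_submodule R M (\<phi> ` S) = \<phi> ` generated_submodule R M S"
proof -
  \<comment> \<open>One inclusion for every automorphism, by minimality of the generated submodule;
    the reverse one is this applied to the inverse of \<phi>.\<close>
  have sub: "generated_submodule R M (\<psi> ` T) \<subseteq> \<psi> ` generated_submodule R M T"
    if "linear_auto R M \<psi>" "T \<subseteq> carrier M" for \<psi> T
    using that
    by (intro generated_submodule_least submodule_linear_image generated_submodule_submodule
        image_mono generated_submodule_superset)
  note \<phi> = linear_autoD[OF assms(1)]
  let ?\<psi> = "inv_into (carrier M) \<phi>"
  have "?\<psi> ` \<phi> ` S = S"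
  proof -
    have "(\<lambda>x. ?\<psi> (\<phi> x)) ` S = (\<lambda>x. x) ` S"
      using bij_betw_inv_into_left[OF \<phi>(1)] assms(2) by (intro image_cong) auto
    then show ?thesis by (simp add: image_image)
  qed
  then have "generated_submodule R M S \<subseteq> ?\<psi> ` generated_submodule R M (\<phi> ` S)"
    using sub[OF linear_auto_inv[OF assms(1)], of "\<phi> ` S"] assms(2) \<phi>(2) by auto
  then have "\<phi> ` generated_submodule R M S \<subseteq> \<phi> ` ?\<psi> ` generated_submodule R M (\<phi> ` S)" by blast
  also have "\<dots> = generated_submodule R M (\<phi> ` S)"
  proof -
    have "generated_submodule R M (\<phi> ` S) \<subseteq> carrier M"
      using assms(2) \<phi>(2) by (intro generated_submodule_least[OF carrier_is_submodule]) auto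
    then have "(\<lambda>x. \<phi> (?\<psi> x)) ` generated_submodule R M (\<phi> ` S) = (\<lambda>x. x) ` generated_submodule R M (\<phi> ` S)"
      using bij_betw_inv_into_right[OF \<phi>(1)] by (intro image_cong) auto
    then show ?thesis by (simp add: image_image)
  qed
  finally show ?thesis using sub[OF assms] by blast
qed

lemma fin_gen_linear_image:
  assumes "linear_auto R M \<phi>" "fin_gen_submodule N R M"
  shows "fin_gen_submodule (\<phi> ` N) R M"
proof -
  obtain S where S: "finite S" "S \<subseteq> carrier M" "N = generated_submodule R M S" "submodule N R M"
    using assms(2) by (auto simp: fin_gen_submodule_def)
  then show ?thesis unfolding fin_gen_submodule_def
    using generated_submodule_linear_image[OF assms(1) S(2)] submodule_linear_image[OF assms(1)]
      linear_autoD(2)[OF assms(1)]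
    by (intro conjI exI[of _ "\<phi> ` S"]) auto
qed

lemma linear_auto_finsum:
  assumes "linear_auto R M \<phi>" "finite S" "g \<in> S \<rightarrow> carrier M"
  shows "\<phi> (\<Oplus>\<^bsub>M\<^esub> b\<in>S. g b) = (\<Oplus>\<^bsub>M\<^esub> b\<in>S. \<phi> (g b))"
  using assms(2,3)
proof (induction S)
  case empty
  then show ?case
    using linear_autoD(4)[OF assms(1), of \<zero> "\<zero>\<^bsub>M\<^esub>"] linear_autoD(2)[OF assms(1), of "\<zero>\<^bsub>M\<^esub>"] by simp
next
  case (insert b S)
  then have g: "g \<in> S \<rightarrow> carrier M" "g b \<in> carrier M" by auto
  then have "(\<lambda>b. \<phi> (g b)) \<in> S \<rightarrow> carrier M" "\<phi> (g b) \<in> carrier M"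
    using linear_autoD(2)[OF assms(1)] by auto
  then show ?case using insert g linear_autoD(3)[OF assms(1)] by (simp add: M.finsum_insert)
qed

lemma is_basis_linear_image:
  assumes "linear_auto R M \<phi>" "is_basis R M B"
  shows "is_basis R M (\<phi> ` B)"
proof -
  note \<phi> = linear_autoD[OF assms(1)]
  have B: "B \<subseteq> carrier M" "lin_independent R M B" "generated_submodule R M B = carrier M"
    using assms(2) by (auto simp: is_basis_def)
  have inj: "inj_on \<phi> (carrier M)" and img: "\<phi> ` carrier M = carrier M"
    using \<phi>(1) by (auto simp: bij_betw_def)
  have z: "\<phi> \<zero>\<^bsub>M\<^esub> = \<zero>\<^bsub>M\<^esub>"
    using \<phi>(4)[of \<zero> "\<zero>\<^bsub>M\<^esub>"] \<phi>(2)[of "\<zero>\<^bsub>M\<^esub>"] by simp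
  have "lin_independent R M (\<phi> ` B)" unfolding lin_independent_def
  proof (intro allI impI ballI)
    fix S c b
    assume "finite S \<and> S \<subseteq> \<phi> ` B \<and> c \<in> S \<rightarrow> carrier R \<and> (\<Oplus>\<^bsub>M\<^esub>b\<in>S. c b \<odot>\<^bsub>M\<^esub> b) = \<zero>\<^bsub>M\<^esub>"
    then have S: "finite S" "S \<subseteq> \<phi> ` B" "c \<in> S \<rightarrow> carrier R" "(\<Oplus>\<^bsub>M\<^esub>b\<in>S. c b \<odot>\<^bsub>M\<^esub> b) = \<zero>\<^bsub>M\<^esub>" by auto
    assume b: "b \<in> S"
    \<comment> \<open>A relation among the images is pulled back to one among the vectors of
      \<open>T\<close> with the same coefficients; injectivity of \<phi> allows the reindexing of
      the sum.\<close>
    obtain T where T: "T \<subseteq> B" "finite T" "S = \<phi> ` T" using S(1,2) finite_subset_image by metis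
    have Tc: "T \<subseteq> carrier M" using T B by auto
    have c: "c (\<phi> t) \<in> carrier R" if "t \<in> T" for t using S(3) T that by auto
    have "\<phi> (\<Oplus>\<^bsub>M\<^esub>t\<in>T. c (\<phi> t) \<odot>\<^bsub>M\<^esub> t) = (\<Oplus>\<^bsub>M\<^esub>t\<in>T. \<phi> (c (\<phi> t) \<odot>\<^bsub>M\<^esub> t))"
      using T Tc c by (intro linear_auto_finsum[OF assms(1)]) auto
    also have "\<dots> = (\<Oplus>\<^bsub>M\<^esub>t\<in>T. c (\<phi> t) \<odot>\<^bsub>M\<^esub> \<phi> t)"
      using \<phi> c Tc by (intro M.finsum_cong') auto
    also have "\<dots> = (\<Oplus>\<^bsub>M\<^esub>b\<in>S. c b \<odot>\<^bsub>M\<^esub> b)"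
      unfolding T(3) using c \<phi>(2) Tc
      by (intro M.finsum_reindex[symmetric] inj_on_subset[OF inj]) auto
    finally have "\<phi> (\<Oplus>\<^bsub>M\<^esub>t\<in>T. c (\<phi> t) \<odot>\<^bsub>M\<^esub> t) = \<phi> \<zero>\<^bsub>M\<^esub>" using S(4) z by simp
    moreover have "(\<Oplus>\<^bsub>M\<^esub>t\<in>T. c (\<phi> t) \<odot>\<^bsub>M\<^esub> t) \<in> carrier M"
      using c Tc by (intro M.finsum_closed) auto
    ultimately have "(\<Oplus>\<^bsub>M\<^esub>t\<in>T. c (\<phi> t) \<odot>\<^bsub>M\<^esub> t) = \<zero>\<^bsub>M\<^esub>"
      using inj by (auto simp: inj_on_def)
    then have "\<forall>t\<in>T. c (\<phi> t) = \<zero>"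
      using T c by (intro B(2)[unfolded lin_independent_def, THEN spec[of _ T],
        THEN spec[of _ "\<lambda>t. c (\<phi> t)"], THEN mp]) auto
    then show "c b = \<zero>" using b T by auto
  qed
  moreover have "generated_submodule R M (\<phi> ` B) = carrier M"
    using generated_submodule_linear_image[OF assms(1) B(1)] B(3) img by simp
  ultimately show ?thesis using B(1) \<phi>(2) by (auto simp: is_basis_def)
qed

lemma is_lattice_linear_image:
  assumes "linear_auto R M \<phi>" "subring Z R" "is_lattice Z R M L"
  shows "is_lattice Z R M (\<phi> ` L)"
proof -
  interpret Z: module "R\<lparr>carrier := Z\<rparr>" M
    by (rule module_subring[OF module_axioms assms(2)])
  show ?thesis
    using assms(3) Z.fin_gen_linear_image[OF linear_auto_subring[OF assms(1,2)]]
      is_basis_linear_image[OF assms(1)]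
    unfolding is_lattice_def by (meson image_mono)
qed

end

section \<open>Restriction of scalars, regular modules and products of rings\<close>

lemma restrict_scalars_simps [simp]:
  "carrier (restrict_scalars g W) = carrier W" "add (restrict_scalars g W) = add W"
  "ring.zero (restrict_scalars g W) = ring.zero W"
  "a \<odot>\<^bsub>restrict_scalars g W\<^esub> x = g a \<odot>\<^bsub>W\<^esub> x"
  by (simp_all add: restrict_scalars_def)

lemma regular_module_simps [simp]:
  "carrier (regular_module A) = carrier A" "add (regular_module A) = add A"
  "ring.zero (regular_module A) = ring.zero A"
  "a \<odot>\<^bsub>regular_module A\<^esub> x = a \<otimes>\<^bsub>A\<^esub> x"
  by (simp_all add: regular_module_def)

lemma abelian_group_cong:
  assumes "abelian_group G" "carrier H = carrier G" "add H = add G" "ring.zero H = ring.zero G"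
  shows "abelian_group H"
proof -
  interpret abelian_group G by fact
  show ?thesis
  proof (rule abelian_groupI)
    fix x assume "x \<in> carrier H"
    then show "\<exists>y\<in>carrier H. y \<oplus>\<^bsub>H\<^esub> x = \<zero>\<^bsub>H\<^esub>"
      using assms by (intro bexI[of _ "\<ominus>\<^bsub>G\<^esub> x"]) (auto simp: l_neg)
  qed (use assms in \<open>auto simp: a_assoc intro: a_comm\<close>)
qed

lemma module_restrict_scalars:
  assumes "module A W" "cring Q" "g \<in> ring_hom Q A"
  shows "module Q (restrict_scalars g W)"
proof -
  interpret module A W by fact
  interpret Q: cring Q by fact
  have g: "\<And>x. x \<in> carrier Q \<Longrightarrow> g x \<in> carrier A" "\<And>x y. x \<in> carrier Q \<Longrightarrow> y \<in> carrier Q \<Longrightarrow> g (x \<oplus>\<^bsub>Q\<^esub> y) = g x \<oplus>\<^bsub>A\<^esub> g y"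
    "\<And>x y. x \<in> carrier Q \<Longrightarrow> y \<in> carrier Q \<Longrightarrow> g (x \<otimes>\<^bsub>Q\<^esub> y) = g x \<otimes>\<^bsub>A\<^esub> g y" "g \<one>\<^bsub>Q\<^esub> = \<one>\<^bsub>A\<^esub>"
    using assms(3) by (auto simp: ring_hom_def)
  have "abelian_group (restrict_scalars g W)"
    by (rule abelian_group_cong[OF M.abelian_group_axioms]) auto
  then show ?thesis
    by (intro moduleI Q.cring_axioms) (auto simp: g smult_l_distr smult_r_distr smult_assoc1)
qed

lemma module_regular:
  assumes "cring A"
  shows "module A (regular_module A)"
proof -
  interpret cring A by fact
  have "abelian_group (regular_module A)"
    by (rule abelian_group_cong[OF abelian_group_axioms]) auto
  then show ?thesis
    by (intro moduleI cring_axioms) (auto simp: l_distr r_distr m_assoc)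
qed

lemma linear_auto_restrict_scalars:
  assumes "linear_auto A W \<phi>" "g \<in> carrier Q \<rightarrow> carrier A"
  shows "linear_auto Q (restrict_scalars g W) \<phi>"
  using assms by (auto simp: linear_auto_def)

lemma product_ring_simps [simp]:
  "carrier (product_ring I K) = (\<Pi>\<^sub>E i\<in>I. carrier (K i))"
  "x \<otimes>\<^bsub>product_ring I K\<^esub> y = (\<lambda>i\<in>I. x i \<otimes>\<^bsub>K i\<^esub> y i)"
  "\<one>\<^bsub>product_ring I K\<^esub> = (\<lambda>i\<in>I. \<one>\<^bsub>K i\<^esub>)"
  "\<zero>\<^bsub>product_ring I K\<^esub> = (\<lambda>i\<in>I. \<zero>\<^bsub>K i\<^esub>)"
  "x \<oplus>\<^bsub>product_ring I K\<^esub> y = (\<lambda>i\<in>I. x i \<oplus>\<^bsub>K i\<^esub> y i)"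
  by (simp_all add: product_ring_def)

lemma cring_product_ring:
  assumes "\<And>i. i \<in> I \<Longrightarrow> cring (K i)"
  shows "cring (product_ring I K)"
proof (rule cringI)
  note cr = cring.axioms(1)[OF assms]
  note ag = ring.is_abelian_group[OF cr]
  show "abelian_group (product_ring I K)"
  proof (rule abelian_groupI)
    fix x assume x: "x \<in> carrier (product_ring I K)"
    show "\<exists>y\<in>carrier (product_ring I K). y \<oplus>\<^bsub>product_ring I K\<^esub> x = \<zero>\<^bsub>product_ring I K\<^esub>"
      using x ag by (intro bexI[of _ "\<lambda>i\<in>I. \<ominus>\<^bsub>K i\<^esub> x i"])
        (auto intro!: restrict_ext abelian_group.a_inv_closed abelian_group.l_neg)
  qed (use ag in \<open>auto simp: PiE_iff abelian_group.axioms abelian_monoid.a_closed abelian_monoid.zero_closed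
      abelian_monoid.a_assoc abelian_monoid.l_zero intro!: restrict_ext extensionalityI[of _ I]
      intro: abelian_monoid.a_comm\<close>)
  show "comm_monoid (product_ring I K)"
    by (rule comm_monoidI)
      (use assms cr in \<open>auto simp: PiE_iff ring.ring_simprules
        intro!: restrict_ext extensionalityI[of _ I] intro: comm_monoid.m_comm[OF cring.axioms(2)]\<close>)
qed (use cring.axioms(1)[OF assms] in \<open>auto simp: PiE_iff ring.ring_simprules intro!: restrict_ext\<close>)

lemma diagonal_ring_hom:
  assumes "\<And>i. i \<in> I \<Longrightarrow> h i \<in> ring_hom Q (K i)"
  shows "diagonal I h \<in> ring_hom Q (product_ring I K)"
proof -
  have "h i x \<in> carrier (K i)" if "i \<in> I" "x \<in> carrier Q" for i x
    using ring_hom_closed[OF assms] that by blast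
  then show ?thesis
    using assms by (auto simp: ring_hom_def diagonal_def intro!: restrict_ext)
qed

section \<open>The vector space over a product of fields\<close>

lemma power_sum_module_carrier:
  "v \<in> carrier (power_sum_module n s Ks) \<longleftrightarrow>
     v \<in> extensional (coords n s) \<and> (\<forall>i j. (i, j) \<in> coords n s \<longrightarrow> v (i, j) \<in> carrier (Ks i))"
  by (auto simp: power_sum_module_def Let_def PiE_iff)

lemma power_sum_module_apply:
  assumes "(i, j) \<in> coords n s"
  shows "(x \<oplus>\<^bsub>power_sum_module n s Ks\<^esub> y) (i, j) = x (i, j) \<oplus>\<^bsub>Ks i\<^esub> y (i, j)"
    "(a \<odot>\<^bsub>power_sum_module n s Ks\<^esub> x) (i, j) = a i \<otimes>\<^bsub>Ks i\<^esub> x (i, j)"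
    "\<zero>\<^bsub>power_sum_module n s Ks\<^esub> (i, j) = \<zero>\<^bsub>Ks i\<^esub>"
  using assms by (auto simp: power_sum_module_def Let_def)

locale field_product =
  fixes n :: nat and s :: "nat \<Rightarrow> nat" and Ks :: "nat \<Rightarrow> ('a, 'k) ring_scheme"
  assumes field_Ks: "\<And>i. i \<in> {1..n} \<Longrightarrow> field (Ks i)"
begin

declare One_nat_def [simp del]

abbreviation "C \<equiv> coords n s"
abbreviation "V \<equiv> power_sum_module n s Ks"
abbreviation "PK \<equiv> product_ring {1..n} Ks"

lemma coordsD: "(i, j) \<in> C \<Longrightarrow> i \<in> {1..n}" "(i, j) \<in> C \<Longrightarrow> 1 \<le> j" "(i, j) \<in> C \<Longrightarrow> j \<le> s i"
  by (auto simp: coords_def)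

lemma finite_C: "finite C" by (auto simp: coords_def)

lemmas V_carrier = power_sum_module_carrier[where n = n and s = s and Ks = Ks]
lemmas V_apply = power_sum_module_apply[where n = n and s = s and Ks = Ks]

lemma V_ext:
  assumes "x \<in> carrier V" "y \<in> carrier V" "\<And>i j. (i, j) \<in> C \<Longrightarrow> x (i, j) = y (i, j)"
  shows "x = y"
  using assms by (intro extensionalityI[of x C]) (auto simp: V_carrier)

lemma V_mem: "x \<in> carrier V \<Longrightarrow> (i, j) \<in> C \<Longrightarrow> x (i, j) \<in> carrier (Ks i)"
  by (auto simp: V_carrier)

lemma cring_Ks: "i \<in> {1..n} \<Longrightarrow> cring (Ks i)"
  using field_Ks field.axioms(1) domain.axioms(1) by blast

lemma PK_mem: "a \<in> carrier PK \<Longrightarrow> i \<in> {1..n} \<Longrightarrow> a i \<in> carrier (Ks i)"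
  by auto

lemma V_add_closed:
  assumes "x \<in> carrier V" "y \<in> carrier V"
  shows "x \<oplus>\<^bsub>V\<^esub> y \<in> carrier V"
proof -
  have "x \<oplus>\<^bsub>V\<^esub> y \<in> extensional C" by (auto simp: power_sum_module_def Let_def)
  moreover have "(x \<oplus>\<^bsub>V\<^esub> y) (i, j) \<in> carrier (Ks i)" if "(i, j) \<in> C" for i j
  proof -
    interpret cring "Ks i" using cring_Ks[OF coordsD(1)[OF that]] .
    show ?thesis using V_mem[OF assms(1) that] V_mem[OF assms(2) that] by (simp add: V_apply[OF that])
  qed
  ultimately show ?thesis by (auto simp: V_carrier)
qed

lemma V_smult_closed:
  assumes "a \<in> carrier PK" "x \<in> carrier V"
  shows "a \<odot>\<^bsub>V\<^esub> x \<in> carrier V"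
proof -
  have "a \<odot>\<^bsub>V\<^esub> x \<in> extensional C" by (auto simp: power_sum_module_def Let_def)
  moreover have "(a \<odot>\<^bsub>V\<^esub> x) (i, j) \<in> carrier (Ks i)" if "(i, j) \<in> C" for i j
  proof -
    interpret cring "Ks i" using cring_Ks[OF coordsD(1)[OF that]] .
    show ?thesis using V_mem[OF assms(2) that] PK_mem[OF assms(1) coordsD(1)[OF that]]
      by (simp add: V_apply[OF that])
  qed
  ultimately show ?thesis by (auto simp: V_carrier)
qed

lemma cring_PK: "cring PK"
  using cring_Ks by (rule cring_product_ring)

lemma module_V: "module PK V"
proof (rule moduleI)
  show "cring PK" by (rule cring_PK)
  have "cring (product_ring C (\<lambda>(i, j). Ks i))"
    using cring_Ks coordsD(1) by (intro cring_product_ring) auto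
  then have "abelian_group (product_ring C (\<lambda>(i, j). Ks i))"
    using ring.is_abelian_group cring.axioms(1) by blast
  then show "abelian_group V"
    by (rule abelian_group_cong) (auto simp: power_sum_module_def Let_def)
  show "a \<odot>\<^bsub>V\<^esub> x \<in> carrier V" if "a \<in> carrier PK" "x \<in> carrier V" for a x
    using V_smult_closed that by blast
  interpret P: cring PK by (rule cring_PK)
  have PKc: "a \<oplus>\<^bsub>PK\<^esub> b \<in> carrier PK" "a \<otimes>\<^bsub>PK\<^esub> b \<in> carrier PK" "\<one>\<^bsub>PK\<^esub> \<in> carrier PK"
    if "a \<in> carrier PK" "b \<in> carrier PK" for a b
    by (fact P.a_closed[OF that] P.m_closed[OF that] P.one_closed)+
  have laws: "(a \<oplus>\<^bsub>PK\<^esub> b) \<odot>\<^bsub>V\<^esub> x = a \<odot>\<^bsub>V\<^esub> x \<oplus>\<^bsub>V\<^esub> b \<odot>\<^bsub>V\<^esub> x"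
    "(a \<otimes>\<^bsub>PK\<^esub> b) \<odot>\<^bsub>V\<^esub> x = a \<odot>\<^bsub>V\<^esub> (b \<odot>\<^bsub>V\<^esub> x)"
    "a \<odot>\<^bsub>V\<^esub> (x \<oplus>\<^bsub>V\<^esub> y) = a \<odot>\<^bsub>V\<^esub> x \<oplus>\<^bsub>V\<^esub> a \<odot>\<^bsub>V\<^esub> y" "\<one>\<^bsub>PK\<^esub> \<odot>\<^bsub>V\<^esub> x = x"
    if ab: "a \<in> carrier PK" "b \<in> carrier PK" and x: "x \<in> carrier V" and y: "y \<in> carrier V" for a b x y
  proof -
    have pt: "((a \<oplus>\<^bsub>PK\<^esub> b) \<odot>\<^bsub>V\<^esub> x) (i, j) = (a \<odot>\<^bsub>V\<^esub> x \<oplus>\<^bsub>V\<^esub> b \<odot>\<^bsub>V\<^esub> x) (i, j) \<and>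
      ((a \<otimes>\<^bsub>PK\<^esub> b) \<odot>\<^bsub>V\<^esub> x) (i, j) = (a \<odot>\<^bsub>V\<^esub> (b \<odot>\<^bsub>V\<^esub> x)) (i, j) \<and>
      (a \<odot>\<^bsub>V\<^esub> (x \<oplus>\<^bsub>V\<^esub> y)) (i, j) = (a \<odot>\<^bsub>V\<^esub> x \<oplus>\<^bsub>V\<^esub> a \<odot>\<^bsub>V\<^esub> y) (i, j) \<and>
      (\<one>\<^bsub>PK\<^esub> \<odot>\<^bsub>V\<^esub> x) (i, j) = x (i, j)" if ij: "(i, j) \<in> C" for i j
    proof -
      have i: "i \<in> {1..n}" using coordsD(1)[OF ij] .
      interpret cring "Ks i" using cring_Ks[OF i] .
      show ?thesis
        using V_mem[OF x ij] V_mem[OF y ij] PK_mem[OF ab(1) i] PK_mem[OF ab(2) i] i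
        by (simp add: V_apply[OF ij] l_distr r_distr m_assoc)
    qed
    show "(a \<oplus>\<^bsub>PK\<^esub> b) \<odot>\<^bsub>V\<^esub> x = a \<odot>\<^bsub>V\<^esub> x \<oplus>\<^bsub>V\<^esub> b \<odot>\<^bsub>V\<^esub> x"
      by (rule V_ext) (simp_all add: V_add_closed V_smult_closed PKc ab x y pt del: product_ring_simps)
    show "(a \<otimes>\<^bsub>PK\<^esub> b) \<odot>\<^bsub>V\<^esub> x = a \<odot>\<^bsub>V\<^esub> (b \<odot>\<^bsub>V\<^esub> x)"
      by (rule V_ext) (simp_all add: V_add_closed V_smult_closed PKc ab x y pt del: product_ring_simps)
    show "a \<odot>\<^bsub>V\<^esub> (x \<oplus>\<^bsub>V\<^esub> y) = a \<odot>\<^bsub>V\<^esub> x \<oplus>\<^bsub>V\<^esub> a \<odot>\<^bsub>V\<^esub> y"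
      by (rule V_ext) (simp_all add: V_add_closed V_smult_closed PKc ab x y pt del: product_ring_simps)
    show "\<one>\<^bsub>PK\<^esub> \<odot>\<^bsub>V\<^esub> x = x"
      by (rule V_ext) (simp_all add: V_add_closed V_smult_closed PKc ab x y pt del: product_ring_simps)
  qed
  show "\<one>\<^bsub>PK\<^esub> \<odot>\<^bsub>V\<^esub> x = x" if "x \<in> carrier V" for x
    by (rule laws(4)[OF P.one_closed P.one_closed that that])
  fix a x assume ax: "a \<in> carrier PK" "x \<in> carrier V"
  show "a \<odot>\<^bsub>V\<^esub> (x \<oplus>\<^bsub>V\<^esub> y) = a \<odot>\<^bsub>V\<^esub> x \<oplus>\<^bsub>V\<^esub> a \<odot>\<^bsub>V\<^esub> y" if "y \<in> carrier V" for y
    by (rule laws(3)[OF ax(1) ax(1) ax(2) that])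
  fix b assume b: "b \<in> carrier PK"
  show "(a \<oplus>\<^bsub>PK\<^esub> b) \<odot>\<^bsub>V\<^esub> x = a \<odot>\<^bsub>V\<^esub> x \<oplus>\<^bsub>V\<^esub> b \<odot>\<^bsub>V\<^esub> x"
    by (rule laws(1)[OF ax(1) b ax(2) ax(2)])
  show "(a \<otimes>\<^bsub>PK\<^esub> b) \<odot>\<^bsub>V\<^esub> x = a \<odot>\<^bsub>V\<^esub> (b \<odot>\<^bsub>V\<^esub> x)"
    by (rule laws(2)[OF ax(1) b ax(2) ax(2)])
qed

sublocale M: module PK V by (rule module_V)

section \<open>Coordinate vectors and component scalars\<close>

definition single :: "nat \<Rightarrow> nat \<Rightarrow> 'a \<Rightarrow> nat \<times> nat \<Rightarrow> 'a" where
  "single i j x = (\<lambda>(k, l)\<in>C. if k = i \<and> l = j then x else \<zero>\<^bsub>Ks k\<^esub>)"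

text \<open>With \<open>a = \<one>\<close> this is the idempotent of the \<open>i\<close>-th factor
  of \<open>K\<close>. Through these scalars an action of the product ring gives an action of the
  single factor \<open>K_i\<close>.\<close>

definition at_comp :: "nat \<Rightarrow> 'a \<Rightarrow> nat \<Rightarrow> 'a" where
  "at_comp i a = (\<lambda>k\<in>{1..n}. if k = i then a else \<zero>\<^bsub>Ks k\<^esub>)"

lemma single_apply: "(k, l) \<in> C \<Longrightarrow> single i j x (k, l) = (if k = i \<and> l = j then x else \<zero>\<^bsub>Ks k\<^esub>)"
  by (simp add: single_def)

lemma zero_Ks: "i \<in> {1..n} \<Longrightarrow> \<zero>\<^bsub>Ks i\<^esub> \<in> carrier (Ks i)"
  using cring.cring_simprules(2)[OF cring_Ks] by blast

lemma single_closed: "(i, j) \<in> C \<Longrightarrow> x \<in> carrier (Ks i) \<Longrightarrow> single i j x \<in> carrier V"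
  using zero_Ks coordsD(1) by (auto simp: V_carrier single_def)

lemma at_comp_apply: "k \<in> {1..n} \<Longrightarrow> at_comp i a k = (if k = i then a else \<zero>\<^bsub>Ks k\<^esub>)"
  by (simp add: at_comp_def)

lemma at_comp_closed: "a \<in> carrier (Ks i) \<Longrightarrow> at_comp i a \<in> carrier PK"
  using zero_Ks by (auto simp: at_comp_def)

lemma at_comp_smult_apply:
  assumes "v \<in> carrier V" "(k, l) \<in> C"
  shows "(at_comp i a \<odot>\<^bsub>V\<^esub> v) (k, l) = (if k = i then a \<otimes>\<^bsub>Ks i\<^esub> v (k, l) else \<zero>\<^bsub>Ks k\<^esub>)"
proof -
  interpret cring "Ks k" using cring_Ks coordsD(1)[OF assms(2)] .
  show ?thesis
    using assms V_mem[OF assms] coordsD(1)[OF assms(2)] by (auto simp: V_apply at_comp_apply)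
qed

lemma at_comp_smult_single:
  assumes "(i, j) \<in> C" "a \<in> carrier (Ks i)" "x \<in> carrier (Ks i)"
  shows "at_comp i a \<odot>\<^bsub>V\<^esub> single i j x = single i j (a \<otimes>\<^bsub>Ks i\<^esub> x)"
proof -
  interpret cring "Ks i" using cring_Ks coordsD(1)[OF assms(1)] .
  show ?thesis
    using assms at_comp_closed[OF assms(2)] single_closed[OF assms(1,3)]
    by (intro V_ext) (auto simp: at_comp_smult_apply single_apply intro: single_closed)
qed

lemma single_add:
  assumes "(i, j) \<in> C" "x \<in> carrier (Ks i)" "y \<in> carrier (Ks i)"
  shows "single i j x \<oplus>\<^bsub>V\<^esub> single i j y = single i j (x \<oplus>\<^bsub>Ks i\<^esub> y)"
proof (rule V_ext)
  interpret cring "Ks i" using cring_Ks coordsD(1)[OF assms(1)] .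
  show "single i j x \<oplus>\<^bsub>V\<^esub> single i j y \<in> carrier V" "single i j (x \<oplus>\<^bsub>Ks i\<^esub> y) \<in> carrier V"
    using assms by (auto intro: single_closed)
  fix k l assume kl: "(k, l) \<in> C"
  interpret k: cring "Ks k" using cring_Ks coordsD(1)[OF kl] .
  show "(single i j x \<oplus>\<^bsub>V\<^esub> single i j y) (k, l) = single i j (x \<oplus>\<^bsub>Ks i\<^esub> y) (k, l)"
    using kl by (auto simp: V_apply single_apply)
qed

text \<open>\<open>v\<close> is the sum of its coordinate vectors. The partial sums are written down
  explicitly, as \<open>v\<close> with the coordinates outside \<open>F\<close> replaced by zero,
  and \<open>F\<close> grows one coordinate at a time.\<close>

lemma mem_if_singles_mem:
  assumes N: "\<zero>\<^bsub>V\<^esub> \<in> N" "\<And>x y. x \<in> N \<Longrightarrow> y \<in> N \<Longrightarrow> x \<oplus>\<^bsub>V\<^esub> y \<in> N"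
    and v: "v \<in> carrier V" "\<And>i j. (i, j) \<in> C \<Longrightarrow> single i j (v (i, j)) \<in> N"
  shows "v \<in> N"
proof -
  have "(\<lambda>(k, l)\<in>C. if (k, l) \<in> F then v (k, l) else \<zero>\<^bsub>Ks k\<^esub>) \<in> N" if "finite F" "F \<subseteq> C" for F
    using that
  proof (induction F)
    case empty
    have "(\<lambda>(k, l)\<in>C. if (k, l) \<in> {} then v (k, l) else \<zero>\<^bsub>Ks k\<^esub>) = \<zero>\<^bsub>V\<^esub>"
      by (auto simp: power_sum_module_def Let_def)
    then show ?case using N(1) by simp
  next
    case (insert c F)
    obtain i j where c: "c = (i, j)" by (cases c)
    let ?w = "\<lambda>F. \<lambda>(k, l)\<in>C. if (k, l) \<in> F then v (k, l) else \<zero>\<^bsub>Ks k\<^esub>"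
    have w: "?w F \<in> carrier V" for F
      using zero_Ks coordsD(1) V_mem[OF v(1)] by (auto simp: V_carrier)
    have sc: "single i j (v (i, j)) \<in> carrier V"
      using insert.prems c V_mem[OF v(1)] by (auto intro: single_closed)
    have "?w (insert c F) = ?w F \<oplus>\<^bsub>V\<^esub> single i j (v (i, j))"
    proof (rule V_ext[OF w M.M.a_closed[OF w sc]])
      interpret i: cring "Ks i" using cring_Ks coordsD(1) insert.prems c by blast
      fix k l assume kl: "(k, l) \<in> C"
      interpret k: cring "Ks k" using cring_Ks coordsD(1)[OF kl] .
      show "?w (insert c F) (k, l) = (?w F \<oplus>\<^bsub>V\<^esub> single i j (v (i, j))) (k, l)"
        using kl V_mem[OF v(1) kl] insert.hyps c by (auto simp: V_apply single_apply)
    qed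
    moreover have "?w F \<in> N" "single i j (v (i, j)) \<in> N" using insert v(2) c by blast+
    ultimately show ?case using N(2) by (simp only:)
  qed
  from this[OF finite_C] have *: "(\<lambda>(k, l)\<in>C. if (k, l) \<in> C then v (k, l) else \<zero>\<^bsub>Ks k\<^esub>) \<in> N" by simp
  have "(\<lambda>(k, l)\<in>C. if (k, l) \<in> C then v (k, l) else \<zero>\<^bsub>Ks k\<^esub>) = v"
    using v(1) by (auto simp: V_carrier extensional_def)
  then show ?thesis using * by simp
qed

end

section \<open>Unimodular functionals\<close>

locale dedekind_product = field_product n s Ks
  for n :: nat and s :: "nat \<Rightarrow> nat" and Ks :: "nat \<Rightarrow> ('a, 'k) ring_scheme" +
  fixes As :: "nat \<Rightarrow> 'a set"
  assumes dedekind: "\<And>i. i \<in> {1..n} \<Longrightarrow> dedekind_subring (Ks i) (As i)"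
begin

abbreviation "PO \<equiv> (\<Pi>\<^sub>E i\<in>{1..n}. As i)"
abbreviation "OK \<equiv> PK\<lparr>carrier := PO\<rparr>"

lemma subring_As: "i \<in> {1..n} \<Longrightarrow> subring (As i) (Ks i)"
  using dedekind dedekind_subring.axioms(1) field_subring.subring_A by blast

lemma subring_PO: "subring PO PK"
proof -
  note S = subringE[OF subring_As]
  have sub: "PO \<subseteq> carrier PK" unfolding product_ring_simps by (rule PiE_mono) (rule S(1))
  show ?thesis
  proof (rule M.R.subringI)
    show "PO \<subseteq> carrier PK" by (rule sub)
    show "\<one>\<^bsub>PK\<^esub> \<in> PO" using S(3) by auto
    fix x assume x: "x \<in> PO"
    have xK: "x i \<in> carrier (Ks i)" if "i \<in> {1..n}" for i using PK_mem[OF subsetD[OF sub x] that] .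
    have "\<ominus>\<^bsub>PK\<^esub> x = (\<lambda>i\<in>{1..n}. \<ominus>\<^bsub>Ks i\<^esub> x i)"
    proof (rule M.R.minus_equality)
      show "(\<lambda>i\<in>{1..n}. \<ominus>\<^bsub>Ks i\<^esub> x i) \<oplus>\<^bsub>PK\<^esub> x = \<zero>\<^bsub>PK\<^esub>"
        using xK cring.cring_simprules(9)[OF cring_Ks] by (auto intro!: restrict_ext)
      show "x \<in> carrier PK" using x sub by (rule subsetD[rotated])
      show "(\<lambda>i\<in>{1..n}. \<ominus>\<^bsub>Ks i\<^esub> x i) \<in> carrier PK"
        using xK cring.cring_simprules(3)[OF cring_Ks] by auto
    qed
    then show "\<ominus>\<^bsub>PK\<^esub> x \<in> PO" using PiE_mem[OF x] S(5) by auto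
  next
    fix x y assume "x \<in> PO" "y \<in> PO"
    note PiE_mem[OF this(1)] PiE_mem[OF this(2)]
    then show "x \<otimes>\<^bsub>PK\<^esub> y \<in> PO" "x \<oplus>\<^bsub>PK\<^esub> y \<in> PO" using S(6,7) by auto
  qed
qed

sublocale O: module OK V
  by (rule module_subring[OF module_V subring_PO])

lemma PO_submoduleD:
  assumes "submodule N OK V"
  shows "\<And>x. x \<in> N \<Longrightarrow> x \<in> carrier V" "\<zero>\<^bsub>V\<^esub> \<in> N" "\<And>x y. x \<in> N \<Longrightarrow> y \<in> N \<Longrightarrow> x \<oplus>\<^bsub>V\<^esub> y \<in> N"
    "\<And>a x. a \<in> PO \<Longrightarrow> x \<in> N \<Longrightarrow> a \<odot>\<^bsub>V\<^esub> x \<in> N"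
  using assms unfolding O.submodule_iff by auto

lemma at_comp_PO: "i \<in> {1..n} \<Longrightarrow> a \<in> As i \<Longrightarrow> at_comp i a \<in> PO"
  using subringE(2)[OF subring_As] by (auto simp: at_comp_def)

lemma As_carrier: "i \<in> {1..n} \<Longrightarrow> a \<in> As i \<Longrightarrow> a \<in> carrier (Ks i)"
  using subringE(1)[OF subring_As] by blast

text \<open>Together with \<open>spans_V\<close>, this is what the splitting argument keeps of the
  lattice property: a common denominator for each coordinate. Stated per coordinate, it can be
  checked directly after one change of coordinates.\<close>

definition coord_bounded :: "(nat \<times> nat \<Rightarrow> 'a) set \<Rightarrow> bool" where
  "coord_bounded N \<longleftrightarrow> (\<forall>i j. (i, j) \<in> C \<longrightarrow>
     (\<exists>c\<in>carrier (Ks i). c \<noteq> \<zero>\<^bsub>Ks i\<^esub> \<and> (\<forall>v\<in>N. c \<otimes>\<^bsub>Ks i\<^esub> v (i, j) \<in> As i)))"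

text \<open>The multiplier is a unit of \<open>K\<close>, so the notion refers to \<open>K\<close>
  alone; \<open>Z\<close> and \<open>Q\<close> do not enter the splitting argument.\<close>

definition spans_V :: "(nat \<times> nat \<Rightarrow> 'a) set \<Rightarrow> bool" where
  "spans_V N \<longleftrightarrow> (\<forall>v\<in>carrier V. \<exists>c\<in>carrier PK. (\<forall>i\<in>{1..n}. c i \<noteq> \<zero>\<^bsub>Ks i\<^esub>) \<and> c \<odot>\<^bsub>V\<^esub> v \<in> N)"

text \<open>The coordinate \<open>(i, j)\<close> is split off \<open>N\<close> as a summand \<open>\<O>\<^sub>i\<close>.\<close>

definition splits_at :: "(nat \<times> nat) set \<Rightarrow> (nat \<times> nat \<Rightarrow> 'a) set \<Rightarrow> bool" where
  "splits_at D N \<longleftrightarrow> (\<forall>i j. (i, j) \<in> D \<longrightarrow> single i j \<one>\<^bsub>Ks i\<^esub> \<in> N \<and> (\<forall>v\<in>N. v (i, j) \<in> As i))"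

text \<open>Supplies the nonzero vectors on the coordinate axes that keep the ideals in
  \<open>unimodular_functional\<close> nonzero.\<close>

lemma spans_V_single:
  assumes "spans_V N" "(i, j) \<in> C"
  shows "\<exists>c\<in>carrier (Ks i). c \<noteq> \<zero>\<^bsub>Ks i\<^esub> \<and> single i j c \<in> N"
proof -
  have i: "i \<in> {1..n}" using coordsD(1)[OF assms(2)] .
  interpret i: cring "Ks i" by (rule cring_Ks[OF i])
  have sV: "single i j \<one>\<^bsub>Ks i\<^esub> \<in> carrier V" using assms(2) by (simp add: single_closed)
  then obtain c where c: "c \<in> carrier PK" "\<forall>i\<in>{1..n}. c i \<noteq> \<zero>\<^bsub>Ks i\<^esub>" "c \<odot>\<^bsub>V\<^esub> single i j \<one>\<^bsub>Ks i\<^esub> \<in> N"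
    using assms(1) unfolding spans_V_def by blast
  have ci: "c i \<in> carrier (Ks i)" using PK_mem[OF c(1) i] .
  have "c \<odot>\<^bsub>V\<^esub> single i j \<one>\<^bsub>Ks i\<^esub> = single i j (c i)"
  proof (rule V_ext[OF V_smult_closed[OF c(1) sV] single_closed[OF assms(2) ci]])
    fix k l assume kl: "(k, l) \<in> C"
    interpret k: cring "Ks k" using cring_Ks coordsD(1)[OF kl] .
    have "c k \<in> carrier (Ks k)" using PK_mem[OF c(1) coordsD(1)[OF kl]] .
    then show "(c \<odot>\<^bsub>V\<^esub> single i j \<one>\<^bsub>Ks i\<^esub>) (k, l) = single i j (c i) (k, l)"
      using ci by (auto simp: V_apply[OF kl] single_apply[OF kl])
  qed
  then show ?thesis using c i ci by auto
qed

text \<open>A functional over \<open>K_i\<close> sees the action of \<O> on \<open>N\<close> through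
  the scalars \<open>at_comp i a\<close>. It is applied to single coordinates and to the combination
  \<open>b v_p + a v_q\<close>.\<close>

lemma functional_image_submod:
  assumes N: "submodule N OK V" and i: "i \<in> {1..n}"
    and g: "\<And>v. v \<in> carrier V \<Longrightarrow> g v \<in> carrier (Ks i)"
    "\<And>v w. v \<in> carrier V \<Longrightarrow> w \<in> carrier V \<Longrightarrow> g (v \<oplus>\<^bsub>V\<^esub> w) = g v \<oplus>\<^bsub>Ks i\<^esub> g w"
    "\<And>a v. a \<in> carrier (Ks i) \<Longrightarrow> v \<in> carrier V \<Longrightarrow> g (at_comp i a \<odot>\<^bsub>V\<^esub> v) = a \<otimes>\<^bsub>Ks i\<^esub> g v"
  shows "ring.submod (Ks i) (As i) (g ` N)"
proof -
  interpret i: cring "Ks i" by (rule cring_Ks[OF i])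
  note ND = PO_submoduleD[OF N]
  show ?thesis
  proof (rule i.submodI)
    show "g ` N \<subseteq> carrier (Ks i)" using g(1) ND(1) by auto
    have "g (at_comp i \<zero>\<^bsub>Ks i\<^esub> \<odot>\<^bsub>V\<^esub> \<zero>\<^bsub>V\<^esub>) = \<zero>\<^bsub>Ks i\<^esub>"
      using g(3)[OF i.zero_closed ND(1)[OF ND(2)]] g(1)[OF ND(1)[OF ND(2)]] by simp
    moreover have "at_comp i \<zero>\<^bsub>Ks i\<^esub> \<odot>\<^bsub>V\<^esub> \<zero>\<^bsub>V\<^esub> \<in> N"
      using ND(4)[OF at_comp_PO[OF i] ND(2)] subringE(2)[OF subring_As[OF i]] by blast
    ultimately show "\<zero>\<^bsub>Ks i\<^esub> \<in> g ` N" by (metis imageI)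
  next
    fix x y assume "x \<in> g ` N" "y \<in> g ` N"
    then obtain v w where vw: "v \<in> N" "w \<in> N" "x = g v" "y = g w" by blast
    then have "x \<oplus>\<^bsub>Ks i\<^esub> y = g (v \<oplus>\<^bsub>V\<^esub> w)" using g(2)[OF ND(1) ND(1)] by simp
    then show "x \<oplus>\<^bsub>Ks i\<^esub> y \<in> g ` N" using ND(3)[OF vw(1,2)] by simp
  next
    fix a x assume a: "a \<in> As i" and "x \<in> g ` N"
    then obtain v where v: "v \<in> N" "x = g v" by blast
    then have "a \<otimes>\<^bsub>Ks i\<^esub> x = g (at_comp i a \<odot>\<^bsub>V\<^esub> v)"
      using g(3)[OF As_carrier[OF i a] ND(1)] by simp
    then show "a \<otimes>\<^bsub>Ks i\<^esub> x \<in> g ` N" using ND(4)[OF at_comp_PO[OF i a] v(1)] by simp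
  qed
qed

lemma unimodular_functional:
  assumes N: "submodule N OK V" "coord_bounded N" "spans_V N"
    and p: "(i, p) \<in> C" and q: "(i, q) \<in> C" "p \<noteq> q"
  shows "\<exists>a\<in>carrier (Ks i). \<exists>b\<in>carrier (Ks i). b \<noteq> \<zero>\<^bsub>Ks i\<^esub> \<and>
    (\<forall>v\<in>N. b \<otimes>\<^bsub>Ks i\<^esub> v (i, p) \<oplus>\<^bsub>Ks i\<^esub> a \<otimes>\<^bsub>Ks i\<^esub> v (i, q) \<in> As i) \<and>
    (\<exists>v\<in>N. b \<otimes>\<^bsub>Ks i\<^esub> v (i, p) \<oplus>\<^bsub>Ks i\<^esub> a \<otimes>\<^bsub>Ks i\<^esub> v (i, q) = \<one>\<^bsub>Ks i\<^esub>)"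
proof -
  have i: "i \<in> {1..n}" using coordsD(1)[OF p] .
  interpret F: dedekind_subring "Ks i" "As i" by (rule dedekind[OF i])
  note ND = PO_submoduleD[OF N(1)]
  obtain b where b: "b \<in> carrier (Ks i)" "b \<noteq> \<zero>\<^bsub>Ks i\<^esub>" "\<And>v. v \<in> N \<Longrightarrow> b \<otimes>\<^bsub>Ks i\<^esub> v (i, p) \<in> As i"
    using N(2) p unfolding coord_bounded_def by blast
  obtain c where c: "c \<in> carrier (Ks i)" "c \<noteq> \<zero>\<^bsub>Ks i\<^esub>" "\<And>v. v \<in> N \<Longrightarrow> c \<otimes>\<^bsub>Ks i\<^esub> v (i, q) \<in> As i"
    using N(2) q(1) unfolding coord_bounded_def by blast
  \<comment> \<open>On vectors supported at \<open>p\<close> the functional is \<open>b v_p\<close>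
    whatever \<open>a\<close> is. So \<open>J\<close> lies in its image for every later choice of
    \<open>a\<close>, and only primes above \<open>J\<close> can contain the image.\<close>
  define J where "J = {b \<otimes>\<^bsub>Ks i\<^esub> x | x. x \<in> carrier (Ks i) \<and> single i p x \<in> N}"
  have J: "F.submod (As i) J"
  proof (rule F.submodI)
    show "J \<subseteq> carrier (Ks i)" using b(1) by (auto simp: J_def)
    have "single i p \<zero>\<^bsub>Ks i\<^esub> = \<zero>\<^bsub>V\<^esub>"
      using ND(1)[OF ND(2)] by (intro V_ext single_closed[OF p]) (auto simp: single_apply V_apply)
    moreover have "\<zero>\<^bsub>Ks i\<^esub> = b \<otimes>\<^bsub>Ks i\<^esub> \<zero>\<^bsub>Ks i\<^esub>" using b(1) by simp
    ultimately show "\<zero>\<^bsub>Ks i\<^esub> \<in> J" using ND(2) F.zero_closed unfolding J_def by auto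
  next
    fix x y assume "x \<in> J" "y \<in> J"
    then obtain u v where uv: "x = b \<otimes>\<^bsub>Ks i\<^esub> u" "y = b \<otimes>\<^bsub>Ks i\<^esub> v" "u \<in> carrier (Ks i)"
      "v \<in> carrier (Ks i)" "single i p u \<in> N" "single i p v \<in> N" unfolding J_def by blast
    then have "x \<oplus>\<^bsub>Ks i\<^esub> y = b \<otimes>\<^bsub>Ks i\<^esub> (u \<oplus>\<^bsub>Ks i\<^esub> v)" using b(1) by (simp add: F.r_distr)
    moreover have "single i p (u \<oplus>\<^bsub>Ks i\<^esub> v) \<in> N" using single_add[OF p uv(3,4)] ND(3)[OF uv(5,6)] by simp
    ultimately show "x \<oplus>\<^bsub>Ks i\<^esub> y \<in> J" using uv F.a_closed unfolding J_def by blast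
  next
    fix a x assume a: "a \<in> As i" and "x \<in> J"
    then obtain u where u: "x = b \<otimes>\<^bsub>Ks i\<^esub> u" "u \<in> carrier (Ks i)" "single i p u \<in> N"
      unfolding J_def by blast
    have "a \<otimes>\<^bsub>Ks i\<^esub> x = b \<otimes>\<^bsub>Ks i\<^esub> (a \<otimes>\<^bsub>Ks i\<^esub> u)" using u b(1) a by (simp add: F.m_lcomm)
    moreover have "single i p (a \<otimes>\<^bsub>Ks i\<^esub> u) \<in> N"
      using at_comp_smult_single[OF p F.A_carrier[OF a] u(2)] ND(4)[OF at_comp_PO[OF i a] u(3)] by simp
    ultimately show "a \<otimes>\<^bsub>Ks i\<^esub> x \<in> J" using u a unfolding J_def by auto
  qed
  have JA: "J \<subseteq> As i"
  proof
    fix x assume "x \<in> J"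
    then obtain u where u: "x = b \<otimes>\<^bsub>Ks i\<^esub> u" "u \<in> carrier (Ks i)" "single i p u \<in> N"
      unfolding J_def by blast
    then show "x \<in> As i" using b(3)[OF u(3)] p by (simp add: single_apply)
  qed
  have J0: "J \<noteq> {\<zero>\<^bsub>Ks i\<^esub>}"
  proof -
    obtain u where u: "u \<in> carrier (Ks i)" "u \<noteq> \<zero>\<^bsub>Ks i\<^esub>" "single i p u \<in> N"
      using spans_V_single[OF N(3) p] by blast
    then have "b \<otimes>\<^bsub>Ks i\<^esub> u \<in> J" "b \<otimes>\<^bsub>Ks i\<^esub> u \<noteq> \<zero>\<^bsub>Ks i\<^esub>"
      using b F.integral unfolding J_def by blast+
    then show ?thesis by blast
  qed
  define S where "S = {P. F.prime_in (As i) P \<and> J \<subseteq> P}"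
  have S: "finite S" unfolding S_def by (rule F.finite_primes_above[OF J JA J0])
  \<comment> \<open>\<open>J\<close> is nonzero, so the zero prime is not above it;
    \<open>multiplier_avoiding_primes\<close> handles nonzero primes.\<close>
  have S0: "F.prime_in (As i) P \<and> P \<noteq> {\<zero>\<^bsub>Ks i\<^esub>}" if "P \<in> S" for P
    using that J0 F.submodD(2)[OF J] unfolding S_def by auto
  have U: "F.submod (As i) ((\<lambda>v. v (i, q)) ` N)"
    by (rule functional_image_submod[OF N(1) i])
      (auto simp: V_mem[OF _ q(1)] V_apply[OF q(1)] at_comp_apply[OF i])
  have U0: "(\<lambda>v. v (i, q)) ` N \<noteq> {\<zero>\<^bsub>Ks i\<^esub>}"
  proof -
    obtain u where u: "u \<in> carrier (Ks i)" "u \<noteq> \<zero>\<^bsub>Ks i\<^esub>" "single i q u \<in> N"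
      using spans_V_single[OF N(3) q(1)] by blast
    then have "u \<in> (\<lambda>v. v (i, q)) ` N" using q(1) by (intro image_eqI[where x = "single i q u"]) (auto simp: single_apply)
    then show ?thesis using u by blast
  qed
  obtain a where a: "a \<in> carrier (Ks i)" "\<forall>v\<in>N. a \<otimes>\<^bsub>Ks i\<^esub> v (i, q) \<in> As i"
    "\<forall>P\<in>S. \<exists>v\<in>N. b \<otimes>\<^bsub>Ks i\<^esub> v (i, p) \<oplus>\<^bsub>Ks i\<^esub> a \<otimes>\<^bsub>Ks i\<^esub> v (i, q) \<notin> P"
    using F.multiplier_avoiding_primes[where u = "\<lambda>v. v (i, q)" and N = N and m = "\<lambda>v. b \<otimes>\<^bsub>Ks i\<^esub> v (i, p)",
        OF U U0 c(1,2) _ _ S] c(3) b(3) S0 by blast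
  define g where "g v = b \<otimes>\<^bsub>Ks i\<^esub> v (i, p) \<oplus>\<^bsub>Ks i\<^esub> a \<otimes>\<^bsub>Ks i\<^esub> v (i, q)" for v
  have gA: "g v \<in> As i" if "v \<in> N" for v using that a b unfolding g_def by auto
  have G: "F.submod (As i) (g ` N)"
  proof (rule functional_image_submod[OF N(1) i])
    fix v assume v: "v \<in> carrier V"
    note m = V_mem[OF v p] V_mem[OF v q(1)] a(1) b(1)
    show "g v \<in> carrier (Ks i)" using m by (simp add: g_def)
    show "g (at_comp i d \<odot>\<^bsub>V\<^esub> v) = d \<otimes>\<^bsub>Ks i\<^esub> g v" if "d \<in> carrier (Ks i)" for d
      using m that by (simp add: g_def at_comp_smult_apply[OF v p] at_comp_smult_apply[OF v q(1)]
          F.r_distr F.m_lcomm)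
    show "g (v \<oplus>\<^bsub>V\<^esub> w) = g v \<oplus>\<^bsub>Ks i\<^esub> g w" if "w \<in> carrier V" for w
      using m V_mem[OF that p] V_mem[OF that q(1)]
      by (simp add: g_def V_apply[OF p] V_apply[OF q(1)] F.r_distr F.a_ac)
  qed
  \<comment> \<open>A proper ideal of values would lie in a prime \<open>P\<close>; then
    \<open>J \<subseteq> P\<close>, hence \<open>P \<in> S\<close>, but \<open>a\<close> was chosen
    to give a value outside \<open>P\<close>.\<close>
  have "\<one>\<^bsub>Ks i\<^esub> \<in> g ` N"
  proof (rule F.one_mem_ideal_if_in_no_prime[OF G])
    show "g ` N \<subseteq> As i" using gA by blast
    fix P assume P: "F.prime_in (As i) P"
    show "\<not> g ` N \<subseteq> P"
    proof
      assume sub: "g ` N \<subseteq> P"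
      have "J \<subseteq> P"
      proof
        fix x assume "x \<in> J"
        then obtain u where u: "x = b \<otimes>\<^bsub>Ks i\<^esub> u" "u \<in> carrier (Ks i)" "single i p u \<in> N"
          unfolding J_def by blast
        then have "g (single i p u) = x"
          using a(1) b(1) q by (simp add: g_def single_apply[OF p] single_apply[OF q(1)])
        then show "x \<in> P" using u sub by blast
      qed
      then have "P \<in> S" using P by (simp add: S_def)
      then obtain v where "v \<in> N" "g v \<notin> P" using a(3) unfolding g_def by blast
      then show False using sub by blast
    qed
  qed
  then have "\<exists>v\<in>N. g v = \<one>\<^bsub>Ks i\<^esub>" by force
  then show ?thesis using a(1) b(1,2) gA unfolding g_def by blast
qed

end

section \<open>Splitting off coordinates\<close>

context dedekind_product
begin

lemma spans_V_linear_image: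
  assumes "linear_auto PK V \<phi>" "spans_V N" "N \<subseteq> carrier V"
  shows "spans_V (\<phi> ` N)"
  unfolding spans_V_def
proof
  note \<phi> = linear_autoD[OF assms(1)]
  fix v assume "v \<in> carrier V"
  then obtain w where w: "w \<in> carrier V" "v = \<phi> w" using \<phi>(1) by (auto simp: bij_betw_def)
  then obtain c where c: "c \<in> carrier PK" "\<forall>i\<in>{1..n}. c i \<noteq> \<zero>\<^bsub>Ks i\<^esub>" "c \<odot>\<^bsub>V\<^esub> w \<in> N"
    using assms(2) unfolding spans_V_def by blast
  then have "c \<odot>\<^bsub>V\<^esub> v \<in> \<phi> ` N" using \<phi>(4)[OF c(1) w(1)] w(2) by (metis imageI)
  then show "\<exists>c\<in>carrier PK. (\<forall>i\<in>{1..n}. c i \<noteq> \<zero>\<^bsub>Ks i\<^esub>) \<and> c \<odot>\<^bsub>V\<^esub> v \<in> \<phi> ` N" using c by blast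
qed

section \<open>The change of coordinates for one step\<close>

text \<open>Let \<open>g v = b v_p + a v_q\<close>. In summand \<open>i\<close>, coordinate
  \<open>p\<close> becomes \<open>g v\<close> and the others become those of
  \<open>v - g(v) x\<close>. If \<open>g x = 1\<close>, this decomposes \<open>v\<close> into a
  multiple of \<open>x\<close> and a vector in the kernel of \<open>g\<close>, and \<open>x\<close>
  goes to the standard vector at \<open>p\<close> in this summand.\<close>

definition shear :: "nat \<Rightarrow> nat \<Rightarrow> nat \<Rightarrow> 'a \<Rightarrow> 'a \<Rightarrow> (nat \<times> nat \<Rightarrow> 'a) \<Rightarrow> (nat \<times> nat \<Rightarrow> 'a) \<Rightarrow> nat \<times> nat \<Rightarrow> 'a" where
  "shear i p q a b x v = (\<lambda>(k, l)\<in>C.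
     if k = i then
       if l = p then b \<otimes>\<^bsub>Ks i\<^esub> v (i, p) \<oplus>\<^bsub>Ks i\<^esub> a \<otimes>\<^bsub>Ks i\<^esub> v (i, q)
       else v (i, l) \<ominus>\<^bsub>Ks i\<^esub> (b \<otimes>\<^bsub>Ks i\<^esub> v (i, p) \<oplus>\<^bsub>Ks i\<^esub> a \<otimes>\<^bsub>Ks i\<^esub> v (i, q)) \<otimes>\<^bsub>Ks i\<^esub> x (i, l)
     else v (k, l))"

lemma linear_auto_shear:
  assumes p: "(i, p) \<in> C" and q: "(i, q) \<in> C" "p \<noteq> q" and x: "x \<in> carrier V"
    and a: "a \<in> carrier (Ks i)" and b: "b \<in> carrier (Ks i)" "b \<noteq> \<zero>\<^bsub>Ks i\<^esub>"
  shows "linear_auto PK V (shear i p q a b x)"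
proof -
  have i: "i \<in> {1..n}" using coordsD(1)[OF p] .
  interpret F: field "Ks i" by (rule field_Ks[OF i])
  define g where "g v = b \<otimes>\<^bsub>Ks i\<^esub> v (i, p) \<oplus>\<^bsub>Ks i\<^esub> a \<otimes>\<^bsub>Ks i\<^esub> v (i, q)" for v
  have sh: "shear i p q a b x v (k, l) = (if k = i then if l = p then g v
      else v (i, l) \<ominus>\<^bsub>Ks i\<^esub> g v \<otimes>\<^bsub>Ks i\<^esub> x (i, l) else v (k, l))" if "(k, l) \<in> C" for v k l
    using that by (simp add: shear_def g_def)
  have gc: "g v \<in> carrier (Ks i)" if "v \<in> carrier V" for v
    using V_mem[OF that p] V_mem[OF that q(1)] a b by (simp add: g_def)
  have shc: "shear i p q a b x v \<in> carrier V" if v: "v \<in> carrier V" for v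
  proof -
    have "shear i p q a b x v \<in> extensional C" by (auto simp: shear_def)
    moreover have "shear i p q a b x v (k, l) \<in> carrier (Ks k)" if kl: "(k, l) \<in> C" for k l
      using gc[OF v] V_mem[OF v kl] V_mem[OF x kl] by (auto simp: sh[OF kl])
    ultimately show ?thesis by (auto simp: V_carrier)
  qed
  have binv: "inv\<^bsub>Ks i\<^esub> b \<in> carrier (Ks i)" "inv\<^bsub>Ks i\<^esub> b \<otimes>\<^bsub>Ks i\<^esub> b = \<one>\<^bsub>Ks i\<^esub>" "b \<otimes>\<^bsub>Ks i\<^esub> inv\<^bsub>Ks i\<^esub> b = \<one>\<^bsub>Ks i\<^esub>"
    using b F.field_Units by auto
  \<comment> \<open>The inverse: for an image \<open>w\<close> of \<open>v\<close>, the value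
    \<open>g v\<close> is \<open>w (i, p)\<close>, so \<open>r w l\<close> recovers
    \<open>v (i, l)\<close> for \<open>l \<noteq> p\<close>, in particular for \<open>q\<close>.
    Then \<open>v (i, p)\<close> is found by solving \<open>g v = w (i, p)\<close>, dividing by
    \<open>b\<close>.\<close>
  define r where "r w l = w (i, l) \<oplus>\<^bsub>Ks i\<^esub> w (i, p) \<otimes>\<^bsub>Ks i\<^esub> x (i, l)" for w l
  define \<psi> where "\<psi> w = (\<lambda>(k, l)\<in>C. if k = i then
      if l = p then inv\<^bsub>Ks i\<^esub> b \<otimes>\<^bsub>Ks i\<^esub> (w (i, p) \<ominus>\<^bsub>Ks i\<^esub> a \<otimes>\<^bsub>Ks i\<^esub> r w q) else r w l else w (k, l))" for w
  have rc: "r w l \<in> carrier (Ks i)" if "w \<in> carrier V" "(i, l) \<in> C" for w l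
    using V_mem[OF that] V_mem[OF that(1) p] V_mem[OF x that(2)] by (simp add: r_def)
  have \<psi>c: "\<psi> w \<in> carrier V" if w: "w \<in> carrier V" for w
  proof -
    have "\<psi> w \<in> extensional C" by (auto simp: \<psi>_def)
    moreover have "\<psi> w (k, l) \<in> carrier (Ks k)" if kl: "(k, l) \<in> C" for k l
      using rc[OF w] V_mem[OF w kl] V_mem[OF w p] q(1) kl a binv(1) by (auto simp: \<psi>_def)
    ultimately show ?thesis by (auto simp: V_carrier)
  qed
  have cancel: "(y \<ominus>\<^bsub>Ks i\<^esub> z) \<oplus>\<^bsub>Ks i\<^esub> z = y" "(y \<oplus>\<^bsub>Ks i\<^esub> z) \<ominus>\<^bsub>Ks i\<^esub> z = y"
    if "y \<in> carrier (Ks i)" "z \<in> carrier (Ks i)" for y z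
    using that by (simp_all add: F.minus_eq F.a_assoc F.l_neg F.r_neg)
  show ?thesis
  proof (rule linear_autoI[where \<psi> = \<psi>])
    fix v assume v: "v \<in> carrier V"
    note m = V_mem[OF v p] V_mem[OF v q(1)]
    show "shear i p q a b x v \<in> carrier V" by (rule shc[OF v])
    show "\<psi> v \<in> carrier V" by (rule \<psi>c[OF v])
    show "\<psi> (shear i p q a b x v) = v"
    proof (rule V_ext[OF \<psi>c[OF shc[OF v]] v])
      fix k l assume kl: "(k, l) \<in> C"
      have r: "r (shear i p q a b x v) l' = v (i, l')" if "(i, l') \<in> C" "l' \<noteq> p" for l'
        using that cancel(1) V_mem[OF v that(1)] V_mem[OF x that(1)] gc[OF v]
        by (simp add: r_def sh[OF that(1)] sh[OF p])
      have "inv\<^bsub>Ks i\<^esub> b \<otimes>\<^bsub>Ks i\<^esub> (g v \<ominus>\<^bsub>Ks i\<^esub> a \<otimes>\<^bsub>Ks i\<^esub> v (i, q)) = inv\<^bsub>Ks i\<^esub> b \<otimes>\<^bsub>Ks i\<^esub> (b \<otimes>\<^bsub>Ks i\<^esub> v (i, p))"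
        using cancel(2)[of "b \<otimes>\<^bsub>Ks i\<^esub> v (i, p)" "a \<otimes>\<^bsub>Ks i\<^esub> v (i, q)"] m a b by (simp add: g_def)
      also have "\<dots> = v (i, p)" using m binv b by (simp flip: F.m_assoc)
      finally show "\<psi> (shear i p q a b x v) (k, l) = v (k, l)"
        using kl q r[of q] r[of l] by (auto simp: \<psi>_def sh)
    qed
    show "shear i p q a b x (\<psi> v) = v"
    proof (rule V_ext[OF shc[OF \<psi>c[OF v]] v])
      fix k l assume kl: "(k, l) \<in> C"
      have "g (\<psi> v) = b \<otimes>\<^bsub>Ks i\<^esub> (inv\<^bsub>Ks i\<^esub> b \<otimes>\<^bsub>Ks i\<^esub> (v (i, p) \<ominus>\<^bsub>Ks i\<^esub> a \<otimes>\<^bsub>Ks i\<^esub> r v q)) \<oplus>\<^bsub>Ks i\<^esub> a \<otimes>\<^bsub>Ks i\<^esub> r v q"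
        using p q by (simp add: g_def \<psi>_def)
      also have "\<dots> = v (i, p)"
        using m a b binv rc[OF v q(1)] cancel(1) by (simp flip: F.m_assoc)
      finally have g: "g (\<psi> v) = v (i, p)" .
      show "shear i p q a b x (\<psi> v) (k, l) = v (k, l)"
      proof (cases "k = i \<and> l \<noteq> p")
        case True
        then have "(i, l) \<in> C" using kl by simp
        then have "\<psi> v (i, l) \<ominus>\<^bsub>Ks i\<^esub> v (i, p) \<otimes>\<^bsub>Ks i\<^esub> x (i, l) = v (i, l)"
          using True cancel(2) m V_mem[OF v] V_mem[OF x] by (simp add: \<psi>_def r_def)
        then show ?thesis using True g kl by (simp add: sh)
      next
        case False
        then show ?thesis using kl g by (auto simp: sh[OF kl] \<psi>_def)
      qed
    qed
    show "shear i p q a b x (c \<odot>\<^bsub>V\<^esub> v) = c \<odot>\<^bsub>V\<^esub> shear i p q a b x v" if c: "c \<in> carrier PK" for c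
    proof (rule V_ext[OF shc[OF V_smult_closed[OF c v]] V_smult_closed[OF c shc[OF v]]])
      have ci: "c i \<in> carrier (Ks i)" by (rule PK_mem[OF c i])
      have g: "g (c \<odot>\<^bsub>V\<^esub> v) = c i \<otimes>\<^bsub>Ks i\<^esub> g v"
        using m ci a b by (simp add: g_def V_apply[OF p] V_apply[OF q(1)] F.r_distr F.m_lcomm)
      fix k l assume kl: "(k, l) \<in> C"
      show "shear i p q a b x (c \<odot>\<^bsub>V\<^esub> v) (k, l) = (c \<odot>\<^bsub>V\<^esub> shear i p q a b x v) (k, l)"
      proof (cases "k = i")
        case True
        then have il: "(i, l) \<in> C" using kl by simp
        show ?thesis using True g ci gc[OF v] V_mem[OF v il] V_mem[OF x il]
          by (simp add: sh[OF il] V_apply[OF il] F.minus_eq F.r_distr F.r_minus F.m_assoc)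
      next
        case False
        then show ?thesis by (simp add: sh[OF kl] V_apply[OF kl])
      qed
    qed
    show "shear i p q a b x (v \<oplus>\<^bsub>V\<^esub> w) = shear i p q a b x v \<oplus>\<^bsub>V\<^esub> shear i p q a b x w"
      if w: "w \<in> carrier V" for w
    proof (rule V_ext[OF shc[OF V_add_closed[OF v w]] V_add_closed[OF shc[OF v] shc[OF w]]])
      have g: "g (v \<oplus>\<^bsub>V\<^esub> w) = g v \<oplus>\<^bsub>Ks i\<^esub> g w"
        using m V_mem[OF w p] V_mem[OF w q(1)] a b
        by (simp add: g_def V_apply[OF p] V_apply[OF q(1)] F.r_distr F.a_ac)
      fix k l assume kl: "(k, l) \<in> C"
      show "shear i p q a b x (v \<oplus>\<^bsub>V\<^esub> w) (k, l) = (shear i p q a b x v \<oplus>\<^bsub>V\<^esub> shear i p q a b x w) (k, l)"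
      proof (cases "k = i")
        case True
        then have il: "(i, l) \<in> C" using kl by simp
        show ?thesis using True g gc[OF v] gc[OF w] V_mem[OF v il] V_mem[OF w il] V_mem[OF x il]
          by (simp add: sh[OF il] V_apply[OF il] F.minus_eq F.l_distr F.minus_add F.a_ac)
      next
        case False
        then show ?thesis by (simp add: sh[OF kl] V_apply[OF kl])
      qed
    qed
  qed
qed

text \<open>Coordinates split off earlier survive: their standard vectors avoid \<open>p\<close> and
  \<open>q\<close>, so \<open>g\<close> kills them and they are fixed. The coordinates themselves
  change at most by a multiple of a coordinate of \<open>x\<close>, which is integral because
  \<open>x \<in> N\<close>.\<close>

lemma split_off_coordinate:
  assumes N: "submodule N OK V" "coord_bounded N" "spans_V N" "splits_at D N"
    and D: "D \<subseteq> C" and p: "(i, p) \<in> C" and q: "(i, q) \<in> C" "p \<noteq> q" "(i, q) \<notin> D"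
  shows "\<exists>\<phi>. linear_auto PK V \<phi> \<and> coord_bounded (\<phi> ` N) \<and> splits_at (insert (i, p) D) (\<phi> ` N)"
proof -
  have i: "i \<in> {1..n}" using coordsD(1)[OF p] .
  interpret F: dedekind_subring "Ks i" "As i" by (rule dedekind[OF i])
  note ND = PO_submoduleD[OF N(1)]
  obtain a b y where ab: "a \<in> carrier (Ks i)" "b \<in> carrier (Ks i)" "b \<noteq> \<zero>\<^bsub>Ks i\<^esub>"
    "\<forall>v\<in>N. b \<otimes>\<^bsub>Ks i\<^esub> v (i, p) \<oplus>\<^bsub>Ks i\<^esub> a \<otimes>\<^bsub>Ks i\<^esub> v (i, q) \<in> As i"
    and y: "y \<in> N" "b \<otimes>\<^bsub>Ks i\<^esub> y (i, p) \<oplus>\<^bsub>Ks i\<^esub> a \<otimes>\<^bsub>Ks i\<^esub> y (i, q) = \<one>\<^bsub>Ks i\<^esub>"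
    using unimodular_functional[OF N(1-3) p q(1,2)] by blast
  define g where "g v = b \<otimes>\<^bsub>Ks i\<^esub> v (i, p) \<oplus>\<^bsub>Ks i\<^esub> a \<otimes>\<^bsub>Ks i\<^esub> v (i, q)" for v
  \<comment> \<open>The \<open>i\<close>-th component of \<open>y\<close>, cut out by the
    idempotent: \<open>g\<close> has the same value on it, and with zeros in the other summands its
    image is exactly the standard vector at \<open>p\<close>.\<close>
  define x where "x = at_comp i \<one>\<^bsub>Ks i\<^esub> \<odot>\<^bsub>V\<^esub> y"
  have xN: "x \<in> N" unfolding x_def using ND(4)[OF at_comp_PO[OF i] y(1)] by simp
  have xV: "x \<in> carrier V" by (rule ND(1)[OF xN])
  have yV: "y \<in> carrier V" by (rule ND(1)[OF y(1)])
  have xi: "x (i, l) = y (i, l)" if "(i, l) \<in> C" for l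
    using V_mem[OF yV that] by (simp add: x_def at_comp_smult_apply[OF yV that])
  have x0: "x (k, l) = \<zero>\<^bsub>Ks k\<^esub>" if "(k, l) \<in> C" "k \<noteq> i" for k l
    using that by (simp add: x_def at_comp_smult_apply[OF yV that(1)])
  have gx: "g x = \<one>\<^bsub>Ks i\<^esub>" using y(2) by (simp add: g_def xi p q)
  have gA: "g v \<in> As i" if "v \<in> N" for v using ab(4) that by (simp add: g_def)
  define \<phi> where "\<phi> = shear i p q a b x"
  have lin: "linear_auto PK V \<phi>" unfolding \<phi>_def
    by (rule linear_auto_shear[OF p q(1,2) xV ab(1-3)])
  have sh: "\<phi> v (k, l) = (if k = i then if l = p then g v
      else v (i, l) \<ominus>\<^bsub>Ks i\<^esub> g v \<otimes>\<^bsub>Ks i\<^esub> x (i, l) else v (k, l))" if "(k, l) \<in> C" for v k l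
    using that by (simp add: \<phi>_def shear_def g_def)
  have "coord_bounded (\<phi> ` N)" unfolding coord_bounded_def
  proof (intro allI impI)
    fix k l assume kl: "(k, l) \<in> C"
    obtain c where c: "c \<in> carrier (Ks k)" "c \<noteq> \<zero>\<^bsub>Ks k\<^esub>" "\<And>v. v \<in> N \<Longrightarrow> c \<otimes>\<^bsub>Ks k\<^esub> v (k, l) \<in> As k"
      using N(2) kl unfolding coord_bounded_def by blast
    show "\<exists>c\<in>carrier (Ks k). c \<noteq> \<zero>\<^bsub>Ks k\<^esub> \<and> (\<forall>v\<in>\<phi> ` N. c \<otimes>\<^bsub>Ks k\<^esub> v (k, l) \<in> As k)"
    proof (cases "k = i")
      case False
      then show ?thesis using c by (intro bexI[of _ c]) (auto simp: sh[OF kl])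
    next
      case True
      then have il: "(i, l) \<in> C" using kl by simp
      show ?thesis
      proof (cases "l = p")
        case True
        then show ?thesis using \<open>k = i\<close> gA by (intro bexI[of _ "\<one>\<^bsub>Ks i\<^esub>"]) (auto simp: sh[OF p])
      next
        case False
        \<comment> \<open>The old denominator \<open>c\<close> still works, because \<open>v\<close>
          and \<open>x\<close> both lie in \<open>N\<close> and \<open>g v\<close> is
          integral.\<close>
        have "c \<otimes>\<^bsub>Ks i\<^esub> (v (i, l) \<ominus>\<^bsub>Ks i\<^esub> g v \<otimes>\<^bsub>Ks i\<^esub> x (i, l)) \<in> As i" if v: "v \<in> N" for v
        proof -
          have *: "v (i, l) \<in> carrier (Ks i)" "x (i, l) \<in> carrier (Ks i)" "c \<in> carrier (Ks i)" "g v \<in> carrier (Ks i)"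
            using V_mem[OF ND(1)[OF v] il] V_mem[OF xV il] c(1) True gA[OF v] by auto
          have "c \<otimes>\<^bsub>Ks i\<^esub> (v (i, l) \<ominus>\<^bsub>Ks i\<^esub> g v \<otimes>\<^bsub>Ks i\<^esub> x (i, l))
            = (c \<otimes>\<^bsub>Ks i\<^esub> v (i, l)) \<ominus>\<^bsub>Ks i\<^esub> g v \<otimes>\<^bsub>Ks i\<^esub> (c \<otimes>\<^bsub>Ks i\<^esub> x (i, l))"
            using * by (simp add: F.minus_eq F.r_distr F.r_minus F.m_lcomm)
          also have "\<dots> \<in> As i" using c(3)[OF v] c(3)[OF xN] gA[OF v] True by simp
          finally show ?thesis .
        qed
        then show ?thesis using c True False by (intro bexI[of _ c]) (auto simp: sh[OF il])
      qed
    qed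
  qed
  moreover have "splits_at (insert (i, p) D) (\<phi> ` N)" unfolding splits_at_def
  proof (intro allI impI)
    fix k l assume "(k, l) \<in> insert (i, p) D"
    then consider "(k, l) = (i, p)" | "(k, l) \<in> D" "(k, l) \<noteq> (i, p)" by blast
    then show "single k l \<one>\<^bsub>Ks k\<^esub> \<in> \<phi> ` N \<and> (\<forall>v\<in>\<phi> ` N. v (k, l) \<in> As k)"
    proof cases
      case 1
      have "\<phi> x = single i p \<one>\<^bsub>Ks i\<^esub>"
      proof (rule V_ext[OF linear_autoD(2)[OF lin xV] single_closed[OF p]])
        fix k l assume kl: "(k, l) \<in> C"
        show "\<phi> x (k, l) = single i p \<one>\<^bsub>Ks i\<^esub> (k, l)"
          using gx x0[OF kl] V_mem[OF xV kl] by (auto simp: sh[OF kl] single_apply[OF kl] F.minus_eq F.r_neg)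
      qed simp
      then show ?thesis using 1 xN gA by (auto simp: sh[OF p] intro: rev_image_eqI)
    next
      case 2
      have kl: "(k, l) \<in> C" using 2 D by blast
      have k: "k \<in> {1..n}" using coordsD(1)[OF kl] .
      interpret G: dedekind_subring "Ks k" "As k" by (rule dedekind[OF k])
      have sN: "single k l \<one>\<^bsub>Ks k\<^esub> \<in> N" and vA: "\<And>v. v \<in> N \<Longrightarrow> v (k, l) \<in> As k"
        using N(4) 2 unfolding splits_at_def by blast+
      have g0: "g (single k l \<one>\<^bsub>Ks k\<^esub>) = \<zero>\<^bsub>Ks i\<^esub>"
        using 2 q(3) ab(1,2) by (auto simp: g_def single_apply[OF p] single_apply[OF q(1)])
      have "\<phi> (single k l \<one>\<^bsub>Ks k\<^esub>) = single k l \<one>\<^bsub>Ks k\<^esub>"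
      proof (rule V_ext[OF linear_autoD(2)[OF lin ND(1)[OF sN]] ND(1)[OF sN]])
        fix k' l' assume kl': "(k', l') \<in> C"
        show "\<phi> (single k l \<one>\<^bsub>Ks k\<^esub>) (k', l') = single k l \<one>\<^bsub>Ks k\<^esub> (k', l')"
          using g0 2 V_mem[OF xV kl'] kl'
          by (auto simp: sh single_apply F.minus_eq)
      qed
      then have "single k l \<one>\<^bsub>Ks k\<^esub> \<in> \<phi> ` N" using sN by (metis imageI)
      moreover have "\<phi> v (k, l) \<in> As k" if v: "v \<in> N" for v
        using vA[OF v] vA[OF xN] gA[OF v] 2 by (auto simp: sh[OF kl])
      ultimately show ?thesis by blast
    qed
  qed
  ultimately show ?thesis using lin by blast
qed

lemma split_off_coordinates:
  assumes N: "submodule N OK V" "coord_bounded N" "spans_V N"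
    and D: "finite D" "D \<subseteq> {(i, j) \<in> C. j < s i}"
  shows "\<exists>\<phi>. linear_auto PK V \<phi> \<and> coord_bounded (\<phi> ` N) \<and> splits_at D (\<phi> ` N)"
  using D
proof (induction D)
  case empty
  show ?case using N linear_auto_id[of PK V]
    by (intro exI[of _ "\<lambda>x. x"]) (auto simp: splits_at_def)
next
  case (insert c D)
  then obtain \<phi> where \<phi>: "linear_auto PK V \<phi>" "coord_bounded (\<phi> ` N)" "splits_at D (\<phi> ` N)" by blast
  obtain i p where c: "c = (i, p)" by (cases c)
  have p: "(i, p) \<in> C" "p < s i" using insert.prems c by auto
  \<comment> \<open>The partner is always the last coordinate of the summand. It is never in
    \<open>D\<close>, so it stays available for every step.\<close>
  have q: "(i, s i) \<in> C" using p by (auto simp: coords_def)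
  have "(i, s i) \<notin> D" using insert.prems by auto
  moreover have "submodule (\<phi> ` N) OK V"
    by (rule O.submodule_linear_image[OF linear_auto_subring[OF \<phi>(1) subring_PO] N(1)])
  moreover have "spans_V (\<phi> ` N)"
    using PO_submoduleD(1)[OF N(1)] by (intro spans_V_linear_image[OF \<phi>(1) N(3)]) blast
  ultimately obtain \<psi> where \<psi>: "linear_auto PK V \<psi>" "coord_bounded (\<psi> ` \<phi> ` N)" "splits_at (insert c D) (\<psi> ` \<phi> ` N)"
    using split_off_coordinate[of "\<phi> ` N" D i p "s i"] \<phi>(2,3) p q insert.prems c by auto
  then show ?case using linear_auto_comp[OF \<phi>(1) \<psi>(1)] unfolding image_comp by blast
qed

text \<open>The projection to the last coordinate is a direct summand because the other coordinates
  of a vector of \<open>N\<close> can be cleared inside \<open>N\<close>.\<close>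

lemma eq_split_sum:
  assumes N: "submodule N OK V" and sp: "splits_at {(i, j) \<in> C. j < s i} N"
  shows "N = split_sum n s As (\<lambda>i. (\<lambda>v. v (i, s i)) ` N)"
proof
  note ND = PO_submoduleD[OF N]
  let ?I = "\<lambda>i. (\<lambda>v. v (i, s i)) ` N"
  have As_mem: "v (i, j) \<in> As i" and single_mem: "single i j \<one>\<^bsub>Ks i\<^esub> \<in> N"
    if "v \<in> N" "(i, j) \<in> C" "j < s i" for v i j
    using sp that unfolding splits_at_def by blast+
  show "N \<subseteq> split_sum n s As ?I"
  proof
    fix v assume v: "v \<in> N"
    have "v (i, j) \<in> (if j < s i then As i else ?I i)" if "(i, j) \<in> C" for i j
      using As_mem[OF v that] v coordsD(3)[OF that] by (cases "j = s i") auto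
    moreover have "v \<in> extensional C" using ND(1)[OF v] by (simp add: V_carrier)
    ultimately show "v \<in> split_sum n s As ?I" by (auto simp: split_sum_def PiE_iff)
  qed
  have last: "single i (s i) (w (i, s i)) \<in> N" if w: "w \<in> N" and q: "(i, s i) \<in> C" for w i
  proof -
    have i: "i \<in> {1..n}" using coordsD(1)[OF q] .
    interpret F: dedekind_subring "Ks i" "As i" by (rule dedekind[OF i])
    have wV: "w \<in> carrier V" by (rule ND(1)[OF w])
    \<comment> \<open>The \<open>i\<close>-th component of \<open>w\<close> with the coordinates in
      \<open>J\<close> cleared. Each is cleared by subtracting an integral multiple of the standard
      vector at that coordinate, which lies in \<open>N\<close>.\<close>
    define t where "t J = (\<lambda>(k, l)\<in>C. if k = i \<and> l \<notin> J then w (k, l) else \<zero>\<^bsub>Ks k\<^esub>)" for J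
    have tV: "t J \<in> carrier V" for J
      using V_mem[OF wV] zero_Ks coordsD(1) by (auto simp: V_carrier t_def)
    have "t J \<in> N" if "finite J" "J \<subseteq> {1..<s i}" for J
      using that
    proof (induction J)
      case empty
      have "at_comp i \<one>\<^bsub>Ks i\<^esub> \<odot>\<^bsub>V\<^esub> w = t {}"
      proof (rule V_ext[OF V_smult_closed[OF at_comp_closed[OF F.one_closed] wV] tV])
        fix k l assume kl: "(k, l) \<in> C"
        show "(at_comp i \<one>\<^bsub>Ks i\<^esub> \<odot>\<^bsub>V\<^esub> w) (k, l) = t {} (k, l)"
          using V_mem[OF wV kl] kl by (auto simp: at_comp_smult_apply[OF wV kl] t_def)
      qed
      then show ?case using ND(4)[OF at_comp_PO[OF i] w] by (metis F.A_closed(2))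
    next
      case (insert j J)
      have j: "(i, j) \<in> C" "j < s i" using insert.prems i by (auto simp: coords_def)
      let ?c = "\<ominus>\<^bsub>Ks i\<^esub> w (i, j)"
      have cA: "?c \<in> As i" using As_mem[OF w j] by simp
      have sm: "at_comp i ?c \<odot>\<^bsub>V\<^esub> single i j \<one>\<^bsub>Ks i\<^esub> \<in> N"
        using ND(4)[OF at_comp_PO[OF i cA] single_mem[OF w j]] .
      have "t (insert j J) = t J \<oplus>\<^bsub>V\<^esub> at_comp i ?c \<odot>\<^bsub>V\<^esub> single i j \<one>\<^bsub>Ks i\<^esub>"
      proof (rule V_ext[OF tV V_add_closed[OF tV ND(1)[OF sm]]])
        fix k l assume kl: "(k, l) \<in> C"
        interpret k: cring "Ks k" using cring_Ks coordsD(1)[OF kl] .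
        show "t (insert j J) (k, l) = (t J \<oplus>\<^bsub>V\<^esub> at_comp i ?c \<odot>\<^bsub>V\<^esub> single i j \<one>\<^bsub>Ks i\<^esub>) (k, l)"
          unfolding at_comp_smult_single[OF j(1) F.A_carrier[OF cA] F.one_closed]
          using V_mem[OF wV kl] V_mem[OF wV j(1)] kl insert.hyps cA
          by (auto simp: V_apply[OF kl] t_def single_apply[OF kl] F.r_neg)
      qed
      then show ?case using ND(3)[OF _ sm] insert by simp
    qed
    then have "t {1..<s i} \<in> N" by simp
    moreover have "t {1..<s i} = single i (s i) (w (i, s i))"
    proof (rule V_ext[OF tV single_closed[OF q V_mem[OF wV q]]])
      fix k l assume kl: "(k, l) \<in> C"
      then show "t {1..<s i} (k, l) = single i (s i) (w (i, s i)) (k, l)"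
        using coordsD[OF kl] by (auto simp: t_def single_apply)
    qed
    ultimately show ?thesis by simp
  qed
  show "split_sum n s As ?I \<subseteq> N"
  proof
    fix v assume v: "v \<in> split_sum n s As ?I"
    then have vm: "v (i, j) \<in> (if j < s i then As i else ?I i)" if "(i, j) \<in> C" for i j
      using that by (auto simp: split_sum_def PiE_iff)
    have single_in: "single i j (v (i, j)) \<in> N \<and> v (i, j) \<in> carrier (Ks i)" if ij: "(i, j) \<in> C" for i j
    proof (cases "j < s i")
      case True
      have i: "i \<in> {1..n}" using coordsD(1)[OF ij] .
      interpret F: dedekind_subring "Ks i" "As i" by (rule dedekind[OF i])
      have vA: "v (i, j) \<in> As i" using vm[OF ij] True by simp
      then have "at_comp i (v (i, j)) \<odot>\<^bsub>V\<^esub> single i j \<one>\<^bsub>Ks i\<^esub> \<in> N"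
        using ND(4)[OF at_comp_PO[OF i] single_mem[OF ND(2) ij True]] by blast
      then show ?thesis
        using vA by (simp add: at_comp_smult_single[OF ij])
    next
      case False
      then have [simp]: "j = s i" using coordsD(3)[OF ij] by simp
      obtain w where "w \<in> N" "v (i, s i) = w (i, s i)" using vm[OF ij] by auto
      then show ?thesis using last[of w i] ij V_mem[OF ND(1)] by simp
    qed
    show "v \<in> N"
    proof (rule mem_if_singles_mem[OF ND(2,3)])
      show "v \<in> carrier V" using single_in v by (auto simp: V_carrier split_sum_def PiE_iff)
    qed (use single_in in auto)
  qed
qed

end

section \<open>Components of orders\<close>

text \<open>The vectors with a nonzero \<open>Z\<close>-multiple in \<open>L\<close> form a
  \<open>Q\<close>-subspace, since every scalar is a fraction of elements of \<open>Z\<close>; it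
  contains a basis and hence is everything.\<close>

lemma lattice_multiple:
  assumes W: "module Q W" and frac: "is_fraction_field_of Q Z" and L: "is_lattice Z Q W L"
    and w: "w \<in> carrier W"
  shows "\<exists>z\<in>Z - {\<zero>\<^bsub>Q\<^esub>}. z \<odot>\<^bsub>W\<^esub> w \<in> L"
proof -
  interpret Q: field Q using frac by (simp add: is_fraction_field_of_def)
  interpret W: module Q W by fact
  have Z: "subring Z Q" using frac by (simp add: is_fraction_field_of_def)
  note ZD = subringE[OF Z]
  interpret Z: module "Q\<lparr>carrier := Z\<rparr>" W by (rule module_subring[OF W Z])
  obtain B where B: "B \<subseteq> L" "is_basis Q W B" and sL: "submodule L (Q\<lparr>carrier := Z\<rparr>) W"
    using L by (auto simp: is_lattice_def fin_gen_submodule_def)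
  have LD: "\<And>x. x \<in> L \<Longrightarrow> x \<in> carrier W" "\<zero>\<^bsub>W\<^esub> \<in> L" "\<And>x y. x \<in> L \<Longrightarrow> y \<in> L \<Longrightarrow> x \<oplus>\<^bsub>W\<^esub> y \<in> L"
    "\<And>a x. a \<in> Z \<Longrightarrow> x \<in> L \<Longrightarrow> a \<odot>\<^bsub>W\<^esub> x \<in> L"
    using sL unfolding Z.submodule_iff by auto
  have Zc: "\<And>z. z \<in> Z \<Longrightarrow> z \<in> carrier Q" using ZD(1) by blast
  have nz: "x \<otimes>\<^bsub>Q\<^esub> y \<in> Z - {\<zero>\<^bsub>Q\<^esub>}" if "x \<in> Z - {\<zero>\<^bsub>Q\<^esub>}" "y \<in> Z - {\<zero>\<^bsub>Q\<^esub>}" for x y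
    using that ZD(6)[of x y] Q.integral[of x y] Zc by blast
  define N where "N = {w \<in> carrier W. \<exists>z\<in>Z - {\<zero>\<^bsub>Q\<^esub>}. z \<odot>\<^bsub>W\<^esub> w \<in> L}"
  have one: "\<one>\<^bsub>Q\<^esub> \<in> Z - {\<zero>\<^bsub>Q\<^esub>}" using ZD(3) Q.one_not_zero by blast
  have LN: "L \<subseteq> N"
  proof
    fix x assume x: "x \<in> L"
    then have "\<one>\<^bsub>Q\<^esub> \<odot>\<^bsub>W\<^esub> x \<in> L" using LD(1) by simp
    then show "x \<in> N" using one x LD(1) unfolding N_def by blast
  qed
  have "submodule N Q W" unfolding W.submodule_iff
  proof (intro conjI ballI)
    show "N \<subseteq> carrier W" by (auto simp: N_def)
    show "\<zero>\<^bsub>W\<^esub> \<in> N" using LN LD(2) by blast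
  next
    fix x y assume "x \<in> N" "y \<in> N"
    then obtain a b where *: "x \<in> carrier W" "y \<in> carrier W" "a \<in> Z - {\<zero>\<^bsub>Q\<^esub>}" "b \<in> Z - {\<zero>\<^bsub>Q\<^esub>}"
      "a \<odot>\<^bsub>W\<^esub> x \<in> L" "b \<odot>\<^bsub>W\<^esub> y \<in> L" by (auto simp: N_def)
    have ab: "a \<in> carrier Q" "b \<in> carrier Q" using * Zc by auto
    have "(a \<otimes>\<^bsub>Q\<^esub> b) \<odot>\<^bsub>W\<^esub> (x \<oplus>\<^bsub>W\<^esub> y) = b \<odot>\<^bsub>W\<^esub> (a \<odot>\<^bsub>W\<^esub> x) \<oplus>\<^bsub>W\<^esub> a \<odot>\<^bsub>W\<^esub> (b \<odot>\<^bsub>W\<^esub> y)"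
      using * ab by (simp add: W.smult_r_distr W.smult_assoc1[symmetric] Q.m_comm)
    also have "\<dots> \<in> L" using * LD by auto
    finally show "x \<oplus>\<^bsub>W\<^esub> y \<in> N" using nz[OF *(3,4)] * unfolding N_def by blast
  next
    fix q x assume q: "q \<in> carrier Q" and "x \<in> N"
    then obtain z where z: "x \<in> carrier W" "z \<in> Z - {\<zero>\<^bsub>Q\<^esub>}" "z \<odot>\<^bsub>W\<^esub> x \<in> L" by (auto simp: N_def)
    obtain a b where ab: "a \<in> Z" "b \<in> Z - {\<zero>\<^bsub>Q\<^esub>}" "q = a \<otimes>\<^bsub>Q\<^esub> inv\<^bsub>Q\<^esub> b"
      using frac q unfolding is_fraction_field_of_def by blast
    have c: "a \<in> carrier Q" "b \<in> carrier Q" "z \<in> carrier Q" "b \<noteq> \<zero>\<^bsub>Q\<^esub>" using ab z Zc by auto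
    have binv: "inv\<^bsub>Q\<^esub> b \<in> carrier Q" "b \<otimes>\<^bsub>Q\<^esub> inv\<^bsub>Q\<^esub> b = \<one>\<^bsub>Q\<^esub>" using c Q.field_Units by auto
    have "(z \<otimes>\<^bsub>Q\<^esub> b) \<otimes>\<^bsub>Q\<^esub> q = (a \<otimes>\<^bsub>Q\<^esub> z) \<otimes>\<^bsub>Q\<^esub> (b \<otimes>\<^bsub>Q\<^esub> inv\<^bsub>Q\<^esub> b)"
      unfolding ab(3) using c binv(1) by (simp add: Q.m_ac)
    then have "(z \<otimes>\<^bsub>Q\<^esub> b) \<odot>\<^bsub>W\<^esub> (q \<odot>\<^bsub>W\<^esub> x) = a \<odot>\<^bsub>W\<^esub> (z \<odot>\<^bsub>W\<^esub> x)"
      using c binv q z by (simp add: W.smult_assoc1[symmetric])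
    also have "\<dots> \<in> L" using LD(4)[OF ab(1) z(3)] .
    finally show "q \<odot>\<^bsub>W\<^esub> x \<in> N" using nz[OF z(2) ab(2)] q z unfolding N_def by blast
  qed
  then have "generated_submodule Q W B \<subseteq> N" using B LN by (intro generated_submodule_least) auto
  then show ?thesis using w B(2) unfolding N_def is_basis_def by blast
qed

lemma (in dedekind_subring) common_denominator:
  assumes "finite T" "T \<subseteq> carrier K"
  shows "\<exists>c\<in>A - {\<zero>}. \<forall>t\<in>T. c \<otimes> t \<in> A"
  using assms
proof (induction T)
  case empty
  then show ?case using one_not_zero A_closed(2) by blast
next
  case (insert t T)
  then obtain c where c: "c \<in> A - {\<zero>}" "\<forall>t\<in>T. c \<otimes> t \<in> A" by blast
  obtain b where b: "b \<in> A - {\<zero>}" "b \<otimes> t \<in> A" using denominator insert.prems by blast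
  have "b \<otimes> c \<in> A - {\<zero>}" using b c integral[of b c] by auto
  moreover have "(b \<otimes> c) \<otimes> t' \<in> A" if "t' \<in> insert t T" for t'
  proof (cases "t' = t")
    case True
    have "(b \<otimes> c) \<otimes> t = c \<otimes> (b \<otimes> t)" using b c insert.prems by (simp add: m_ac)
    then show ?thesis using True b c by auto
  next
    case False
    then have "(b \<otimes> c) \<otimes> t' = b \<otimes> (c \<otimes> t')" using b c insert.prems that by (auto simp: m_assoc)
    then show ?thesis using that False b c by auto
  qed
  ultimately show ?case by blast
qed

lemma (in ring) submod_mono: "submod A N \<Longrightarrow> B \<subseteq> A \<Longrightarrow> submod B N"
  by (auto simp: submod_def)

text \<open>Over the larger ring fewer sets are submodules, so there are fewer chains.\<close>

lemma (in ring) acc_on_antimono: "acc_on B U \<Longrightarrow> B \<subseteq> A \<Longrightarrow> acc_on A U"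
  unfolding acc_on_def by (erule wf_subset) (auto intro: submod_mono)

section \<open>From the hypotheses on \<open>Z\<close> to the rings \<open>\<O>_i\<close>\<close>

locale order_setting = field_product n s Ks
  for n :: nat and s :: "nat \<Rightarrow> nat" and Ks :: "nat \<Rightarrow> ('a, 'k) ring_scheme" +
  fixes Z :: "'q set" and Q :: "('q, 'm) ring_scheme" and h :: "nat \<Rightarrow> 'q \<Rightarrow> 'a"
    and As :: "nat \<Rightarrow> 'a set" and R :: "(nat \<Rightarrow> 'a) set"
  assumes Z: "dedekind_domain_with_fraction_field Z Q"
    and hom_h: "\<And>i. i \<in> {1..n} \<Longrightarrow> h i \<in> ring_hom Q (Ks i)"
    and As: "\<And>i. i \<in> {1..n} \<Longrightarrow> As i = integral_closure (h i ` Z) (Ks i)"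
    and ring_As: "\<And>i. i \<in> {1..n} \<Longrightarrow> ring (Ks i\<lparr>carrier := As i\<rparr>)"
    and fin: "fin_gen_submodule (\<Pi>\<^sub>E i\<in>{1..n}. As i) (Q\<lparr>carrier := Z\<rparr>)
      (restrict_scalars (diagonal {1..n} h) (regular_module PK))"
    and R: "is_order Z Q (diagonal {1..n} h) PK R"
begin

abbreviation "d \<equiv> diagonal {1..n} h"
abbreviation "ZQ \<equiv> Q\<lparr>carrier := Z\<rparr>"

lemma frac: "is_fraction_field_of Q Z"
  using Z by (simp add: dedekind_domain_with_fraction_field_def)

lemma field_Q: "field Q" and subring_Z: "subring Z Q"
  using frac by (auto simp: is_fraction_field_of_def)

lemma field_subring_Z: "field_subring Q Z"
  using field_Q subring_Z by (simp add: field_subring_def field_subring_axioms_def)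

lemma d_hom: "d \<in> ring_hom Q PK"
  by (rule diagonal_ring_hom[OF hom_h])

lemma d_apply: "i \<in> {1..n} \<Longrightarrow> d q i = h i q"
  by (simp add: diagonal_def)

lemma d_closed: "q \<in> carrier Q \<Longrightarrow> d q \<in> carrier PK"
  by (rule ring_hom_closed[OF d_hom])

lemma cring_Q: "cring Q"
  using field_Q field.axioms(1) domain.axioms(1) by blast

lemma module_restrict_V: "module Q (restrict_scalars d V)"
  by (rule module_restrict_scalars[OF module_V cring_Q d_hom])

lemma module_restrict_PK: "module Q (restrict_scalars d (regular_module PK))"
  by (rule module_restrict_scalars[OF module_regular[OF cring_PK] cring_Q d_hom])

sublocale ZV: module ZQ "restrict_scalars d V"
  by (rule module_subring[OF module_restrict_V subring_Z])

sublocale ZK: module ZQ "restrict_scalars d (regular_module PK)"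
  by (rule module_subring[OF module_restrict_PK subring_Z])

lemma subring_hom_h: "i \<in> {1..n} \<Longrightarrow> subring_hom Q Z (Ks i) (h i)"
  using field_subring_Z field_Ks hom_h by (simp add: subring_hom_def subring_hom_axioms_def)

lemma h_nonzero:
  assumes "z \<in> Z - {\<zero>\<^bsub>Q\<^esub>}" "i \<in> {1..n}"
  shows "h i z \<noteq> \<zero>\<^bsub>Ks i\<^esub>"
proof
  interpret H: subring_hom Q Z "Ks i" "h i" by (rule subring_hom_h[OF assms(2)])
  assume "h i z = \<zero>\<^bsub>Ks i\<^esub>"
  then have "h i z = h i \<zero>\<^bsub>Q\<^esub>" by simp
  then have "z = \<zero>\<^bsub>Q\<^esub>" using inj_onD[OF H.h_inj] assms H.Q.A_carrier H.Q.zero_closed by blast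
  then show False using assms by blast
qed

text \<open>Turns generation in \<open>K\<close>, where \<open>generated_submodule\<close> is an
  intersection, into explicit combinations in the single field \<open>K_i\<close>: the condition on
  the \<open>i\<close>-th component defines a \<open>Z\<close>-submodule containing the generators.
  Applied both to \<O> and to \<open>R\<close>.\<close>

lemma component_in_span:
  assumes L: "fin_gen_submodule L ZQ (restrict_scalars d (regular_module PK))" and i: "i \<in> {1..n}"
  shows "\<exists>ts. set ts \<subseteq> carrier (Ks i) \<and> (\<forall>x\<in>L. x i \<in> ring.span_list (Ks i) (h i ` Z) ts)"
proof -
  interpret H: subring_hom Q Z "Ks i" "h i" by (rule subring_hom_h[OF i])
  interpret B: field_subring "Ks i" "h i ` Z" by (rule H.image_field_subring)
  obtain S where S: "finite S" "S \<subseteq> carrier PK" "L = generated_submodule ZQ (restrict_scalars d (regular_module PK)) S"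
    using L by (auto simp: fin_gen_submodule_def)
  obtain xs where xs: "set xs = S" using S(1) finite_list by blast
  define ts where "ts = map (\<lambda>x. x i) xs"
  have ts: "set ts \<subseteq> carrier (Ks i)" using PK_mem[OF subsetD[OF S(2)] i] xs by (auto simp: ts_def)
  define N where "N = {x \<in> carrier PK. x i \<in> H.K.span_list (h i ` Z) ts}"
  note SD = H.K.submodD[OF B.submod_span_list[OF ts]]
  have "submodule N ZQ (restrict_scalars d (regular_module PK))"
    unfolding ZK.submodule_iff
  proof (intro conjI ballI)
    show "N \<subseteq> carrier (restrict_scalars d (regular_module PK))" by (auto simp: N_def)
    have "\<zero>\<^bsub>PK\<^esub> \<in> carrier PK" by (rule M.R.zero_closed)
    then show "\<zero>\<^bsub>restrict_scalars d (regular_module PK)\<^esub> \<in> N" using SD(2) i by (simp add: N_def)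
  next
    fix x y assume "x \<in> N" "y \<in> N"
    then have *: "x \<in> carrier PK" "y \<in> carrier PK" "x i \<in> H.K.span_list (h i ` Z) ts" "y i \<in> H.K.span_list (h i ` Z) ts"
      unfolding N_def by blast+
    have "x \<oplus>\<^bsub>PK\<^esub> y \<in> carrier PK" by (rule M.R.a_closed[OF *(1,2)])
    then show "x \<oplus>\<^bsub>restrict_scalars d (regular_module PK)\<^esub> y \<in> N"
      using SD(3)[OF *(3,4)] i by (simp add: N_def)
  next
    fix a x assume a: "a \<in> carrier ZQ" and "x \<in> N"
    then have *: "a \<in> Z" "x \<in> carrier PK" "x i \<in> H.K.span_list (h i ` Z) ts"
      unfolding N_def by auto
    have "a \<in> carrier Q" using * subringE(1)[OF subring_Z] by blast
    then have "d a \<otimes>\<^bsub>PK\<^esub> x \<in> carrier PK" by (intro M.R.m_closed[OF d_closed *(2)])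
    then show "a \<odot>\<^bsub>restrict_scalars d (regular_module PK)\<^esub> x \<in> N"
      using SD(4)[OF imageI[OF *(1)] *(3)] i by (simp add: N_def d_apply)
  qed
  moreover have "S \<subseteq> N" using B.span_list_superset[OF ts] S(2) xs by (auto simp: N_def ts_def)
  ultimately have "L \<subseteq> N" unfolding S(3) by (rule generated_submodule_least)
  then show ?thesis using ts unfolding N_def by blast
qed

lemma acc_image: "i \<in> {1..n} \<Longrightarrow> ring.acc_on (Ks i) (h i ` Z) (h i ` Z)"
proof -
  assume i: "i \<in> {1..n}"
  interpret H: subring_hom Q Z "Ks i" "h i" by (rule subring_hom_h[OF i])
  have "noetherian_ring ZQ"
    using Z by (simp add: dedekind_domain_with_fraction_field_def noetherian_domain_def)
  then show ?thesis by (rule H.acc_on_image[OF H.Q.noetherian_acc])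
qed

text \<open>The projection of \<open>R\<close> to \<open>K_i\<close> is nonzero, lies in a finitely
  generated module over the image of \<open>Z\<close>, and is stable under multiplication by
  \<open>x i\<close> because \<open>R\<close> is a ring. So \<open>stabilizer_integral\<close>
  applies.\<close>

lemma order_component_integral:
  assumes x: "x \<in> R" and i: "i \<in> {1..n}"
  shows "x i \<in> As i"
proof -
  interpret H: subring_hom Q Z "Ks i" "h i" by (rule subring_hom_h[OF i])
  interpret B: field_subring "Ks i" "h i ` Z" by (rule H.image_field_subring)
  have sR: "subring R PK" and fR: "fin_gen_submodule R ZQ (restrict_scalars d (regular_module PK))"
    using R by (auto simp: is_order_def is_lattice_def)
  note RD = subringE[OF sR]
  obtain ts where ts: "set ts \<subseteq> carrier (Ks i)" "\<forall>x\<in>R. x i \<in> H.K.span_list (h i ` Z) ts"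
    using component_in_span[OF fR i] by blast
  have "submodule R ZQ (restrict_scalars d (regular_module PK))"
    using fR by (simp add: fin_gen_submodule_def)
  then have RZ: "d a \<otimes>\<^bsub>PK\<^esub> y \<in> R" if "a \<in> Z" "y \<in> R" for a y
    using that unfolding ZK.submodule_iff by simp
  let ?L = "(\<lambda>y. y i) ` R"
  have Rc: "y i \<in> carrier (Ks i)" if "y \<in> R" for y using PK_mem[OF subsetD[OF RD(1) that] i] .
  have "H.K.submod (h i ` Z) ?L"
  proof (rule H.K.submodI)
    show "?L \<subseteq> carrier (Ks i)" using Rc by blast
    have "\<zero>\<^bsub>PK\<^esub> i = \<zero>\<^bsub>Ks i\<^esub>" using i by simp
    then show "\<zero>\<^bsub>Ks i\<^esub> \<in> ?L" using RD(2) by (metis imageI)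
  next
    fix u v assume "u \<in> ?L" "v \<in> ?L"
    then obtain y z where yz: "y \<in> R" "z \<in> R" "u = y i" "v = z i" by blast
    have "u \<oplus>\<^bsub>Ks i\<^esub> v = (y \<oplus>\<^bsub>PK\<^esub> z) i" using yz i by simp
    then show "u \<oplus>\<^bsub>Ks i\<^esub> v \<in> ?L" using RD(7)[OF yz(1,2)] by blast
  next
    fix a u assume "a \<in> h i ` Z" "u \<in> ?L"
    then obtain z y where zy: "z \<in> Z" "y \<in> R" "a = h i z" "u = y i" by blast
    have "a \<otimes>\<^bsub>Ks i\<^esub> u = (d z \<otimes>\<^bsub>PK\<^esub> y) i" using zy i by (simp add: d_apply)
    then show "a \<otimes>\<^bsub>Ks i\<^esub> u \<in> ?L" using RZ[OF zy(1,2)] by blast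
  qed
  moreover have "?L \<subseteq> H.K.span_list (h i ` Z) ts" using ts(2) by blast
  moreover have "?L \<noteq> {\<zero>\<^bsub>Ks i\<^esub>}"
  proof -
    have "\<one>\<^bsub>PK\<^esub> i = \<one>\<^bsub>Ks i\<^esub>" using i by simp
    then have "\<one>\<^bsub>Ks i\<^esub> \<in> ?L" using RD(3) by (metis imageI)
    then show ?thesis using H.K.one_not_zero by blast
  qed
  moreover have "x i \<otimes>\<^bsub>Ks i\<^esub> l \<in> ?L" if l: "l \<in> ?L" for l
  proof -
    obtain y where y: "y \<in> R" "l = y i" using l by blast
    have "x i \<otimes>\<^bsub>Ks i\<^esub> l = (x \<otimes>\<^bsub>PK\<^esub> y) i" using y i by simp
    then show ?thesis using RD(6)[OF x y(1)] by blast
  qed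
  ultimately show ?thesis
    unfolding As[OF i] using B.stabilizer_integral[OF acc_image[OF i] ts(1)] Rc[OF x] by blast
qed

text \<open>Chain condition and \<open>stabilizer\<close> both come from the inclusion of
  \<open>\<O>_i\<close> in a finitely generated module over the image of \<open>Z\<close>, since an
  \<open>\<O>_i\<close>-submodule is also a submodule over this image. The dimension passes up along
  the integral extension, and denominators come from the order \<open>R\<close>.\<close>

lemma dedekind_As:
  assumes i: "i \<in> {1..n}"
  shows "dedekind_subring (Ks i) (As i)"
proof -
  interpret H: subring_hom Q Z "Ks i" "h i" by (rule subring_hom_h[OF i])
  interpret B: field_subring "Ks i" "h i ` Z" by (rule H.image_field_subring)
  have sub: "As i \<subseteq> carrier (Ks i)" unfolding As[OF i] integral_closure_def by blast
  have sA: "subring (As i) (Ks i)" by (rule H.K.ring_incl_imp_subring[OF sub ring_As[OF i]])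
  interpret A: field_subring "Ks i" "As i"
    using sA H.K.field_axioms by (simp add: field_subring_def field_subring_axioms_def)
  have BA: "h i ` Z \<subseteq> As i" unfolding As[OF i] by (rule B.subset_integral_closure)
  obtain ts where ts: "set ts \<subseteq> carrier (Ks i)" "\<forall>x\<in>\<Pi>\<^sub>E i\<in>{1..n}. As i. x i \<in> H.K.span_list (h i ` Z) ts"
    using component_in_span[OF fin i] by blast
  have span: "As i \<subseteq> H.K.span_list (h i ` Z) ts"
  proof
    fix a assume a: "a \<in> As i"
    have zero: "\<zero>\<^bsub>Ks k\<^esub> \<in> As k" if k: "k \<in> {1..n}" for k
    proof -
      interpret Hk: subring_hom Q Z "Ks k" "h k" by (rule subring_hom_h[OF k])
      interpret Bk: field_subring "Ks k" "h k ` Z" by (rule Hk.image_field_subring)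
      show ?thesis unfolding As[OF k] using Bk.subset_integral_closure Bk.A_closed(1) by blast
    qed
    \<comment> \<open>Extended by zero in the other factors, \<open>a\<close> becomes an element of
      \<O>, whose \<open>i\<close>-th components are known to lie in the span.\<close>
    have "at_comp i a \<in> (\<Pi>\<^sub>E i\<in>{1..n}. As i)" using zero a by (auto simp: at_comp_def)
    then have "at_comp i a i \<in> H.K.span_list (h i ` Z) ts" using ts(2) by blast
    then show "a \<in> H.K.span_list (h i ` Z) ts" using i by (simp add: at_comp_apply)
  qed
  show ?thesis
  proof (unfold_locales)
    show "H.K.acc_on (As i) (As i)"
      using H.K.acc_on_antimono[OF H.K.acc_on_mono[OF B.acc_on_span_list[OF acc_image[OF i] ts(1)] span] BA] .
    have "H.Q.dim_le_one Z"
      using Z by (intro H.Q.prime_maximal_dim) (auto simp: dedekind_domain_with_fraction_field_def)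
    then have "H.K.dim_le_one (h i ` Z)" by (rule H.dim_le_one_image)
    then show "H.K.dim_le_one (As i)"
      using A.dim_le_one_integral[OF B.field_subring_axioms BA] As[OF i] by blast
    show "x \<in> As i" if "H.K.submod (As i) L" "L \<subseteq> As i" "L \<noteq> {\<zero>\<^bsub>Ks i\<^esub>}" "x \<in> carrier (Ks i)"
      "\<And>l. l \<in> L \<Longrightarrow> x \<otimes>\<^bsub>Ks i\<^esub> l \<in> L" for L x
      unfolding As[OF i]
      by (rule B.stabilizer_integral[OF acc_image[OF i] ts(1) H.K.submod_mono[OF that(1) BA] _ that(3-5)])
        (use that(2) span in blast)
    show "\<exists>c\<in>As i - {\<zero>\<^bsub>Ks i\<^esub>}. c \<otimes>\<^bsub>Ks i\<^esub> y \<in> As i" if y: "y \<in> carrier (Ks i)" for y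
    proof -
      \<comment> \<open>Placed in the \<open>i\<close>-th factor, \<open>y\<close> has a nonzero
        \<open>Z\<close>-multiple in the lattice \<open>R\<close>, and components of elements of
        \<open>R\<close> are integral.\<close>
      have "at_comp i y \<in> carrier (restrict_scalars d (regular_module PK))"
        using at_comp_closed[OF y] by simp
      moreover have "is_lattice Z Q (restrict_scalars d (regular_module PK)) R"
        using R by (simp add: is_order_def)
      ultimately obtain z where z: "z \<in> Z - {\<zero>\<^bsub>Q\<^esub>}"
        "z \<odot>\<^bsub>restrict_scalars d (regular_module PK)\<^esub> at_comp i y \<in> R"
        using lattice_multiple[OF module_restrict_PK frac] by blast
      have "(z \<odot>\<^bsub>restrict_scalars d (regular_module PK)\<^esub> at_comp i y) i = h i z \<otimes>\<^bsub>Ks i\<^esub> y"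
        using i by (simp add: d_apply at_comp_apply)
      then have "h i z \<otimes>\<^bsub>Ks i\<^esub> y \<in> As i" using order_component_integral[OF z(2) i] by simp
      moreover have "h i z \<in> As i" using BA z by blast
      moreover have "h i z \<noteq> \<zero>\<^bsub>Ks i\<^esub>" by (rule h_nonzero[OF z(1) i])
      ultimately show ?thesis by blast
    qed
  qed
qed

sublocale dedekind_product n s Ks As
  by (intro dedekind_product.intro dedekind_product_axioms.intro field_product_axioms dedekind_As)

lemma d_in_PO: "z \<in> Z \<Longrightarrow> d z \<in> PO"
proof -
  assume z: "z \<in> Z"
  have "h i z \<in> As i" if i: "i \<in> {1..n}" for i
  proof -
    interpret H: subring_hom Q Z "Ks i" "h i" by (rule subring_hom_h[OF i])
    interpret B: field_subring "Ks i" "h i ` Z" by (rule H.image_field_subring)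
    show ?thesis unfolding As[OF i] using B.subset_integral_closure z by blast
  qed
  then show ?thesis by (auto simp: diagonal_def)
qed

lemma PO_submodule_imp_Z_submodule:
  "submodule N OK V \<Longrightarrow> submodule N ZQ (restrict_scalars d V)"
  unfolding ZV.submodule_iff O.submodule_iff using d_in_PO by simp

end

section \<open>Lattices over an order\<close>

context order_setting
begin

lemma subring_R: "subring R PK"
  using R by (simp add: is_order_def)

sublocale RV: module "PK\<lparr>carrier := R\<rparr>" V
  by (rule module_subring[OF module_V subring_R])

text \<open>Finite generation of \<open>M\<O>\<close> as an induction principle: an \<O>-submodule
  containing the finitely many \<open>Z\<close>-generators of \<open>M\<close> contains
  \<open>M\<close>, hence \<open>M\<O>\<close>.\<close>

lemma lattice_generators:
  assumes "is_lattice Z Q (restrict_scalars d V) M"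
  obtains S where "finite S" "S \<subseteq> carrier V" "S \<subseteq> M"
    "\<And>N. submodule N OK V \<Longrightarrow> S \<subseteq> N \<Longrightarrow> generated_submodule OK V M \<subseteq> N"
proof -
  obtain S where S: "finite S" "S \<subseteq> carrier V" "M = generated_submodule ZQ (restrict_scalars d V) S"
    using assms by (auto simp: is_lattice_def fin_gen_submodule_def)
  have "generated_submodule OK V M \<subseteq> N" if N: "submodule N OK V" "S \<subseteq> N" for N
  proof (rule generated_submodule_least[OF N(1)])
    show "M \<subseteq> N" unfolding S(3)
      by (rule generated_submodule_least[OF PO_submodule_imp_Z_submodule[OF N(1)] N(2)])
  qed
  moreover have "S \<subseteq> M" unfolding S(3) by (rule generated_submodule_superset)
  ultimately show ?thesis using that S(1,2) by blast
qed

text \<open>The test submodules for \<open>lattice_generators\<close>: used with the identity to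
  bound coordinates, and with the final \<phi> to find generators of the ideals
  \<open>I_i\<close>.\<close>

lemma coordinate_preimage_submodule:
  assumes ij: "(i, j) \<in> C" and \<phi>: "linear_auto PK V \<phi>" and T: "ring.submod (Ks i) (As i) T"
  shows "submodule {v \<in> carrier V. \<phi> v (i, j) \<in> T} OK V"
proof -
  have i: "i \<in> {1..n}" using coordsD(1)[OF ij] .
  interpret F: dedekind_subring "Ks i" "As i" by (rule dedekind[OF i])
  note TD = F.submodD[OF T]
  note \<phi>D = linear_autoD[OF \<phi>]
  have z: "\<phi> \<zero>\<^bsub>V\<^esub> = \<zero>\<^bsub>V\<^esub>"
    using \<phi>D(4)[of "\<zero>\<^bsub>PK\<^esub>" "\<zero>\<^bsub>V\<^esub>"] \<phi>D(2)[of "\<zero>\<^bsub>V\<^esub>"] M.smult_l_null M.R.zero_closed M.M.zero_closed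
    by metis
  show ?thesis unfolding O.submodule_iff
  proof (intro conjI ballI)
    show "\<zero>\<^bsub>V\<^esub> \<in> {v \<in> carrier V. \<phi> v (i, j) \<in> T}" using z TD(2) by (simp add: V_apply[OF ij])
  next
    fix v w assume "v \<in> {v \<in> carrier V. \<phi> v (i, j) \<in> T}" "w \<in> {v \<in> carrier V. \<phi> v (i, j) \<in> T}"
    then show "v \<oplus>\<^bsub>V\<^esub> w \<in> {v \<in> carrier V. \<phi> v (i, j) \<in> T}"
      using TD(3) by (simp add: \<phi>D(3) V_apply[OF ij])
  next
    fix a v assume a: "a \<in> carrier OK" and v: "v \<in> {v \<in> carrier V. \<phi> v (i, j) \<in> T}"
    have aK: "a \<in> carrier PK" using a subringE(1)[OF subring_PO] by auto
    have "a i \<in> As i" using a i by auto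
    then show "a \<odot>\<^bsub>V\<^esub> v \<in> {v \<in> carrier V. \<phi> v (i, j) \<in> T}"
      using TD(4) v V_smult_closed[OF aK] by (simp add: \<phi>D(4)[OF aK] V_apply[OF ij])
  qed auto
qed

lemma lattice_coord_bounded:
  assumes "is_lattice Z Q (restrict_scalars d V) M"
  shows "coord_bounded (generated_submodule OK V M)"
  unfolding coord_bounded_def
proof (intro allI impI)
  obtain S where S: "finite S" "S \<subseteq> carrier V"
    "\<And>N. submodule N OK V \<Longrightarrow> S \<subseteq> N \<Longrightarrow> generated_submodule OK V M \<subseteq> N"
    by (rule lattice_generators[OF assms]) blast
  fix i j assume ij: "(i, j) \<in> C"
  have i: "i \<in> {1..n}" using coordsD(1)[OF ij] .
  interpret F: dedekind_subring "Ks i" "As i" by (rule dedekind[OF i])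
  have "finite ((\<lambda>v. v (i, j)) ` S)" "(\<lambda>v. v (i, j)) ` S \<subseteq> carrier (Ks i)"
    using S V_mem[OF _ ij] by auto
  then obtain c where c: "c \<in> As i - {\<zero>\<^bsub>Ks i\<^esub>}" "\<forall>t\<in>(\<lambda>v. v (i, j)) ` S. c \<otimes>\<^bsub>Ks i\<^esub> t \<in> As i"
    using F.common_denominator by blast
  have cc: "c \<in> carrier (Ks i)" using c(1) by auto
  \<comment> \<open>\<open>\<O>_i\<close> divided by \<open>c\<close>, the common denominator of
    this coordinate on the finitely many generators.\<close>
  define T where "T = {t \<in> carrier (Ks i). c \<otimes>\<^bsub>Ks i\<^esub> t \<in> As i}"
  have "F.submod (As i) T"
  proof (rule F.submodI)
    show "a \<otimes>\<^bsub>Ks i\<^esub> t \<in> T" if "a \<in> As i" "t \<in> T" for a t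
      using that cc by (simp add: T_def F.m_lcomm)
  qed (use cc in \<open>auto simp: T_def F.r_distr\<close>)
  then have "submodule {v \<in> carrier V. (\<lambda>x. x) v (i, j) \<in> T} OK V"
    by (rule coordinate_preimage_submodule[OF ij linear_auto_id])
  then have "submodule {v \<in> carrier V. v (i, j) \<in> T} OK V" by simp
  moreover have "S \<subseteq> {v \<in> carrier V. v (i, j) \<in> T}"
    using S(2) c(2) V_mem[OF _ ij] by (auto simp: T_def)
  ultimately have "generated_submodule OK V M \<subseteq> {v \<in> carrier V. v (i, j) \<in> T}" by (rule S(3))
  then show "\<exists>c\<in>carrier (Ks i). c \<noteq> \<zero>\<^bsub>Ks i\<^esub> \<and> (\<forall>v\<in>generated_submodule OK V M. c \<otimes>\<^bsub>Ks i\<^esub> v (i, j) \<in> As i)"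
    using c(1) cc unfolding T_def by blast
qed

lemma lattice_spans_V:
  assumes "is_lattice Z Q (restrict_scalars d V) M" "M \<subseteq> N"
  shows "spans_V N"
  unfolding spans_V_def
proof
  fix v assume "v \<in> carrier V"
  then obtain z where z: "z \<in> Z - {\<zero>\<^bsub>Q\<^esub>}" "z \<odot>\<^bsub>restrict_scalars d V\<^esub> v \<in> M"
    using lattice_multiple[OF module_restrict_V frac assms(1)] by auto
  have "z \<in> carrier Q" using z(1) subringE(1)[OF subring_Z] by blast
  then have "d z \<in> carrier PK" by (rule d_closed)
  moreover have "\<forall>i\<in>{1..n}. d z i \<noteq> \<zero>\<^bsub>Ks i\<^esub>" using h_nonzero[OF z(1)] by (simp add: d_apply)
  moreover have "d z \<odot>\<^bsub>V\<^esub> v \<in> N" using z(2) assms(2) by auto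
  ultimately show "\<exists>c\<in>carrier PK. (\<forall>i\<in>{1..n}. c i \<noteq> \<zero>\<^bsub>Ks i\<^esub>) \<and> c \<odot>\<^bsub>V\<^esub> v \<in> N" by blast
qed

text \<open>The vectors with all conductor multiples in \<open>M\<close> form an \<O>-submodule,
  because \<open>y (a v) = (y a) v\<close> and the conductor is an ideal of \<O>. It contains
  \<open>M\<close>, because the conductor lies in \<open>R\<close> on account of
  \<open>\<one> \<in> \<O>\<close>.\<close>

lemma conductor_smult:
  assumes M: "submodule M (PK\<lparr>carrier := R\<rparr>) V"
    and x: "x \<in> conductor PK R PO" and w: "w \<in> generated_submodule OK V M"
  shows "x \<odot>\<^bsub>V\<^esub> w \<in> M"
proof -
  let ?f = "conductor PK R PO"
  have MD: "\<And>x. x \<in> M \<Longrightarrow> x \<in> carrier V" "\<zero>\<^bsub>V\<^esub> \<in> M" "\<And>x y. x \<in> M \<Longrightarrow> y \<in> M \<Longrightarrow> x \<oplus>\<^bsub>V\<^esub> y \<in> M"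
    "\<And>a x. a \<in> R \<Longrightarrow> x \<in> M \<Longrightarrow> a \<odot>\<^bsub>V\<^esub> x \<in> M"
    using M unfolding RV.submodule_iff by auto
  note POD = subringE[OF subring_PO]
  have fK: "y \<in> carrier PK" if "y \<in> ?f" for y using that unfolding conductor_def by blast
  have fR: "y \<in> R" if y: "y \<in> ?f" for y
  proof -
    have "y \<otimes>\<^bsub>PK\<^esub> \<one>\<^bsub>PK\<^esub> \<in> R" using y POD(3) unfolding conductor_def by blast
    then show ?thesis unfolding M.R.r_one[OF fK[OF y]] .
  qed
  have fO: "y \<otimes>\<^bsub>PK\<^esub> a \<in> ?f" if y: "y \<in> ?f" and a: "a \<in> PO" for y a
  proof -
    have aK: "a \<in> carrier PK" using POD(1) a by blast
    have "y \<otimes>\<^bsub>PK\<^esub> a \<otimes>\<^bsub>PK\<^esub> b \<in> R" if b: "b \<in> PO" for b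
    proof -
      have "b \<in> carrier PK" using POD(1) b by blast
      then have "y \<otimes>\<^bsub>PK\<^esub> a \<otimes>\<^bsub>PK\<^esub> b = y \<otimes>\<^bsub>PK\<^esub> (a \<otimes>\<^bsub>PK\<^esub> b)" by (rule M.R.m_assoc[OF fK[OF y] aK])
      moreover have "y \<otimes>\<^bsub>PK\<^esub> (a \<otimes>\<^bsub>PK\<^esub> b) \<in> R" using y POD(6)[OF a b] unfolding conductor_def by blast
      ultimately show ?thesis by (simp only:)
    qed
    then show ?thesis using M.R.m_closed[OF fK[OF y] aK] unfolding conductor_def by blast
  qed
  define N where "N = {w \<in> carrier V. \<forall>y\<in>?f. y \<odot>\<^bsub>V\<^esub> w \<in> M}"
  have "submodule N OK V" unfolding O.submodule_iff
  proof (intro conjI ballI)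
    show "N \<subseteq> carrier V" by (auto simp: N_def)
    show "\<zero>\<^bsub>V\<^esub> \<in> N" using MD(2) M.smult_r_null[OF fK] by (simp add: N_def)
  next
    fix v u assume "v \<in> N" "u \<in> N"
    then show "v \<oplus>\<^bsub>V\<^esub> u \<in> N"
      using MD(3) M.smult_r_distr[OF fK] by (simp add: N_def V_add_closed)
  next
    fix a v assume a: "a \<in> carrier OK" and v: "v \<in> N"
    have aO: "a \<in> PO" using a by simp
    have aK: "a \<in> carrier PK" using aO POD(1) by blast
    have vV: "v \<in> carrier V" using v by (simp add: N_def)
    have "y \<odot>\<^bsub>V\<^esub> (a \<odot>\<^bsub>V\<^esub> v) \<in> M" if y: "y \<in> ?f" for y
      using v fO[OF y aO] unfolding M.smult_assoc1[OF fK[OF y] aK vV, symmetric] N_def by blast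
    then show "a \<odot>\<^bsub>V\<^esub> v \<in> N" using V_smult_closed[OF aK vV] unfolding N_def by blast
  qed
  moreover have "M \<subseteq> N" using MD(1) MD(4)[OF fR] by (auto simp: N_def)
  ultimately have "generated_submodule OK V M \<subseteq> N" by (rule generated_submodule_least)
  then show ?thesis using w x unfolding N_def by blast
qed

theorem order_lattice_standard_form:
  assumes s: "\<And>i. i \<in> {1..n} \<Longrightarrow> 1 \<le> s i"
    and f_ideal: "\<And>i. i \<in> {1..n} \<Longrightarrow> ideal (f i) (Ks i\<lparr>carrier := As i\<rparr>)"
    and f: "conductor PK R PO = (\<Pi>\<^sub>E i\<in>{1..n}. f i)"
    and M: "submodule M (PK\<lparr>carrier := R\<rparr>) V"
    and M_lattice: "is_lattice Z Q (restrict_scalars d V) M"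
  shows "\<exists>M' I.
    submodule M' (PK\<lparr>carrier := R\<rparr>) V \<and>
    is_lattice Z Q (restrict_scalars d V) M' \<and>
    (\<forall>i\<in>{1..n}. fractional_ideal (I i) (As i) (Ks i)) \<and>
    modules_isomorphic (PK\<lparr>carrier := R\<rparr>) (V\<lparr>carrier := M'\<rparr>) (V\<lparr>carrier := M\<rparr>) \<and>
    generated_submodule OK V M' = split_sum n s As I \<and>
    split_sum n s f (\<lambda>i. ideal_prod (Ks i) (f i) (I i)) \<subseteq> M' \<and>
    M' \<subseteq> split_sum n s As I"
proof -
  have MV: "M \<subseteq> carrier V" using M unfolding RV.submodule_iff by blast
  define N where "N = generated_submodule OK V M"
  have N: "submodule N OK V" unfolding N_def by (rule O.generated_submodule_submodule[OF MV])
  have MN: "M \<subseteq> N" unfolding N_def by (rule generated_submodule_superset)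
  have bounded: "coord_bounded N" unfolding N_def by (rule lattice_coord_bounded[OF M_lattice])
  have spans: "spans_V N" by (rule lattice_spans_V[OF M_lattice MN])
  have "finite {(i, j) \<in> C. j < s i}" using finite_C by (rule rev_finite_subset) auto
  then obtain \<phi> where \<phi>: "linear_auto PK V \<phi>" "splits_at {(i, j) \<in> C. j < s i} (\<phi> ` N)"
    using split_off_coordinates[OF N bounded spans] by blast
  note \<phi>D = linear_autoD[OF \<phi>(1)]
  have \<phi>O: "linear_auto OK V \<phi>" by (rule linear_auto_subring[OF \<phi>(1) subring_PO])
  have \<phi>R: "linear_auto (PK\<lparr>carrier := R\<rparr>) V \<phi>" by (rule linear_auto_subring[OF \<phi>(1) subring_R])
  have \<phi>Q: "linear_auto Q (restrict_scalars d V) \<phi>"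
    using d_closed by (intro linear_auto_restrict_scalars[OF \<phi>(1)]) blast
  define N' where "N' = \<phi> ` N"
  define M' where "M' = \<phi> ` M"
  define I where "I i = (\<lambda>v. v (i, s i)) ` N'" for i
  have N': "submodule N' OK V" unfolding N'_def by (rule O.submodule_linear_image[OF \<phi>O N])
  note ND = PO_submoduleD[OF N']
  have eq: "N' = split_sum n s As I"
    unfolding I_def by (rule eq_split_sum[OF N']) (use \<phi>(2) in \<open>simp add: N'_def\<close>)
  \<comment> \<open>Generating an \<O>-module commutes with the \<O>-linear \<phi>; with
    \<open>eq\<close> this is claim (ii).\<close>
  have gen: "generated_submodule OK V M' = N'"
    unfolding M'_def N'_def N_def by (rule O.generated_submodule_linear_image[OF \<phi>O MV])
  have M': "submodule M' (PK\<lparr>carrier := R\<rparr>) V"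
    unfolding M'_def by (rule RV.submodule_linear_image[OF \<phi>R M])
  have M'N': "M' \<subseteq> N'" unfolding M'_def N'_def using MN by blast
  have last: "(i, s i) \<in> C" if "i \<in> {1..n}" for i using s[OF that] that by (auto simp: coords_def)
  have Isub: "ring.submod (Ks i) (As i) (I i)" if i: "i \<in> {1..n}" for i
  proof -
    interpret F: dedekind_subring "Ks i" "As i" by (rule dedekind[OF i])
    note q = last[OF i]
    show ?thesis unfolding I_def
      by (rule functional_image_submod[OF N' i])
        (auto simp: V_mem[OF _ q] V_apply[OF q] at_comp_apply[OF i])
  qed

  have lattice: "is_lattice Z Q (restrict_scalars d V) M'"
    unfolding M'_def by (rule module.is_lattice_linear_image[OF module_restrict_V \<phi>Q subring_Z M_lattice])

  have frac_ideal: "fractional_ideal (I i) (As i) (Ks i)" if i: "i \<in> {1..n}" for i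
  proof -
    interpret F: dedekind_subring "Ks i" "As i" by (rule dedekind[OF i])
    interpret FR: module "Ks i\<lparr>carrier := As i\<rparr>" "regular_module (Ks i)"
      by (rule module_subring[OF module_regular[OF cring_Ks[OF i]] subring_As[OF i]])
    have sub_iff: "submodule T (Ks i\<lparr>carrier := As i\<rparr>) (regular_module (Ks i)) \<longleftrightarrow> F.submod (As i) T" for T
      unfolding FR.submodule_iff F.submod_def by simp
    note q = last[OF i]
    obtain S where S: "finite S" "S \<subseteq> carrier V" "S \<subseteq> M"
      "\<And>N. submodule N OK V \<Longrightarrow> S \<subseteq> N \<Longrightarrow> generated_submodule OK V M \<subseteq> N"
      by (rule lattice_generators[OF M_lattice]) blast
    \<comment> \<open>Generators of \<open>I i\<close>: the last coordinates of \<phi> on the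
      \<open>Z\<close>-generators of \<open>M\<close>. A submodule containing them has a preimage in
      \<open>V\<close> that contains \<open>S\<close>, hence \<open>N\<close>.\<close>
    define T where "T = (\<lambda>v. \<phi> v (i, s i)) ` S"
    have T: "finite T" "T \<subseteq> carrier (Ks i)"
      using S(1,2) V_mem[OF \<phi>D(2) q] by (auto simp: T_def)
    have "generated_submodule (Ks i\<lparr>carrier := As i\<rparr>) (regular_module (Ks i)) T = I i"
    proof
      have "T \<subseteq> I i" using S(3) MN by (auto simp: T_def I_def N'_def)
      then show "generated_submodule (Ks i\<lparr>carrier := As i\<rparr>) (regular_module (Ks i)) T \<subseteq> I i"
        using Isub[OF i] by (intro generated_submodule_least) (simp_all add: sub_iff)
      show "I i \<subseteq> generated_submodule (Ks i\<lparr>carrier := As i\<rparr>) (regular_module (Ks i)) T"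
        unfolding generated_submodule_def
      proof (rule Inter_greatest)
        fix X' assume "X' \<in> {N. submodule N (Ks i\<lparr>carrier := As i\<rparr>) (regular_module (Ks i)) \<and> T \<subseteq> N}"
        then have X': "F.submod (As i) X'" "T \<subseteq> X'" by (auto simp: sub_iff)
        have "S \<subseteq> {v \<in> carrier V. \<phi> v (i, s i) \<in> X'}" using S(2) X'(2) by (auto simp: T_def)
        then have "N \<subseteq> {v \<in> carrier V. \<phi> v (i, s i) \<in> X'}"
          unfolding N_def by (rule S(4)[OF coordinate_preimage_submodule[OF q \<phi>(1) X'(1)]])
        then show "I i \<subseteq> X'" by (auto simp: I_def N'_def)
      qed
    qed
    moreover have "I i \<noteq> {\<zero>\<^bsub>Ks i\<^esub>}"
    proof -
      have "spans_V N'" unfolding N'_def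
        using PO_submoduleD(1)[OF N] by (intro spans_V_linear_image[OF \<phi>(1) spans]) blast
      then obtain c where c: "c \<in> carrier (Ks i)" "c \<noteq> \<zero>\<^bsub>Ks i\<^esub>" "single i (s i) c \<in> N'"
        using spans_V_single q by blast
      then have "c \<in> I i" unfolding I_def using q
        by (intro image_eqI[where x = "single i (s i) c"]) (auto simp: single_apply)
      then show ?thesis using c(2) by blast
    qed
    ultimately show ?thesis
      unfolding fractional_ideal_def fin_gen_submodule_def using T Isub[OF i]
      by (auto simp: sub_iff)
  qed

  have iso: "modules_isomorphic (PK\<lparr>carrier := R\<rparr>) (V\<lparr>carrier := M'\<rparr>) (V\<lparr>carrier := M\<rparr>)"
  proof -
    \<comment> \<open>The isomorphism is asked for from \<open>M'\<close> to \<open>M\<close>, so it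
      is the inverse of \<phi>.\<close>
    let ?\<psi> = "inv_into (carrier V) \<phi>"
    note \<psi> = linear_autoD[OF RV.linear_auto_inv[OF \<phi>R]]
    have M'V: "x \<in> carrier V" if "x \<in> M'" for x using that M'N' ND(1) by blast
    have "inj_on ?\<psi> M'"
      by (rule inj_on_subset[OF bij_betw_imp_inj_on[OF \<psi>(1)]]) (use M'V in blast)
    moreover have "?\<psi> ` M' = M"
    proof -
      have "(\<lambda>x. ?\<psi> (\<phi> x)) ` M = (\<lambda>x. x) ` M"
        using bij_betw_inv_into_left[OF \<phi>D(1)] MV by (intro image_cong) auto
      then show ?thesis by (simp add: M'_def image_image)
    qed
    ultimately have "bij_betw ?\<psi> M' M" by (simp add: bij_betw_def)
    then show ?thesis unfolding modules_isomorphic_def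
      using \<psi>(3,4) M'V by (intro exI[of _ ?\<psi>]) simp
  qed

  have lower: "split_sum n s f (\<lambda>i. ideal_prod (Ks i) (f i) (I i)) \<subseteq> M'"
  proof
    fix v assume v: "v \<in> split_sum n s f (\<lambda>i. ideal_prod (Ks i) (f i) (I i))"
    have MD: "\<zero>\<^bsub>V\<^esub> \<in> M'" "\<And>x y. x \<in> M' \<Longrightarrow> y \<in> M' \<Longrightarrow> x \<oplus>\<^bsub>V\<^esub> y \<in> M'"
      using M' unfolding RV.submodule_iff by auto
    have fsub: "ring.submod (Ks i) (As i) (f i) \<and> f i \<subseteq> As i" if i: "i \<in> {1..n}" for i
    proof -
      interpret F: dedekind_subring "Ks i" "As i" by (rule dedekind[OF i])
      show ?thesis using f_ideal[OF i] unfolding F.ideal_iff_submod .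
    qed
    have zero_in: "\<zero>\<^bsub>Ks i\<^esub> \<in> f i" "\<zero>\<^bsub>Ks i\<^esub> \<in> I i" "\<zero>\<^bsub>Ks i\<^esub> \<in> As i" if i: "i \<in> {1..n}" for i
    proof -
      interpret F: dedekind_subring "Ks i" "As i" by (rule dedekind[OF i])
      show "\<zero>\<^bsub>Ks i\<^esub> \<in> f i" "\<zero>\<^bsub>Ks i\<^esub> \<in> I i" "\<zero>\<^bsub>Ks i\<^esub> \<in> As i"
        using F.submodD(2) fsub[OF i] Isub[OF i] by auto
    qed
    \<comment> \<open>A coordinate vector of \<open>N'\<close> is multiplied by the conductor
      element with the single nonzero component \<open>a\<close>; \<open>conductor_smult\<close>
      puts the product in \<open>M'\<close>.\<close>
    have f_single: "single i j (a \<otimes>\<^bsub>Ks i\<^esub> x) \<in> M'"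
      if ij: "(i, j) \<in> C" and a: "a \<in> f i" and x: "x \<in> (if j < s i then As i else I i)" for i j a x
    proof -
      have i: "i \<in> {1..n}" using coordsD(1)[OF ij] .
      interpret F: dedekind_subring "Ks i" "As i" by (rule dedekind[OF i])
      have "single i j x \<in> N'"
        unfolding eq split_sum_def using x zero_in coordsD(1)
        by (auto simp: single_def PiE_iff)
      moreover have "at_comp i a \<in> conductor PK R PO"
        unfolding f using a zero_in by (auto simp: at_comp_def)
      ultimately have "at_comp i a \<odot>\<^bsub>V\<^esub> single i j x \<in> M'"
        using conductor_smult[OF M'] gen by blast
      moreover have "a \<in> carrier (Ks i)" using a fsub[OF i] by auto
      moreover have "x \<in> carrier (Ks i)" using x F.submodD(1)[OF Isub[OF i]] by (auto split: if_splits)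
      ultimately show ?thesis by (simp add: at_comp_smult_single[OF ij])
    qed
    have single_in: "single i j (v (i, j)) \<in> M' \<and> v (i, j) \<in> carrier (Ks i)" if ij: "(i, j) \<in> C" for i j
    proof -
      have i: "i \<in> {1..n}" using coordsD(1)[OF ij] .
      interpret F: dedekind_subring "Ks i" "As i" by (rule dedekind[OF i])
      show ?thesis
      proof (cases "j < s i")
        case True
        then have vf: "v (i, j) \<in> f i" using v ij by (auto simp: split_sum_def PiE_iff)
        then have "v (i, j) \<in> As i" using fsub[OF i] by blast
        \<comment> \<open>Here the entry of \<open>f i\<close> is the first factor and
          \<open>\<one> \<in> \<O>_i\<close> the second.\<close>
        then show ?thesis using f_single[OF ij vf, of "\<one>\<^bsub>Ks i\<^esub>"] True by simp
      next
        case False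
        then have vp: "v (i, j) \<in> ideal_prod (Ks i) (f i) (I i)"
          using v ij by (auto simp: split_sum_def PiE_iff)
        \<comment> \<open>Elements of the product of \<open>f i\<close> and \<open>I i\<close> are
          sums of products, so the induction is on their construction; \<open>single\<close> is
          additive in its entry.\<close>
        have "single i j y \<in> M' \<and> y \<in> carrier (Ks i)" if "y \<in> ideal_prod (Ks i) (f i) (I i)" for y
          using that
        proof (induction rule: ideal_prod.induct)
          case (prod a b)
          then have "a \<in> As i" "b \<in> carrier (Ks i)"
            using fsub[OF i] F.submodD(1)[OF Isub[OF i]] by auto
          then show ?case using f_single[OF ij prod(1), of b] prod(2) False by simp
        next
          case (sum a b)
          then show ?case using MD(2)[of "single i j a" "single i j b"] single_add[OF ij, of a b] by simp
        qed
        then show ?thesis using vp by blast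
      qed
    qed
    show "v \<in> M'"
    proof (rule mem_if_singles_mem[OF MD])
      show "v \<in> carrier V" using single_in v by (auto simp: V_carrier split_sum_def PiE_iff)
    qed (use single_in in auto)
  qed
  show ?thesis
    using M' lattice frac_ideal iso gen[unfolded eq] lower M'N'[unfolded eq] by blast
qed

end

theorem theorem3p2:
  fixes Z :: "'q set" and Q :: "('q, 'm) ring_scheme"
    and n :: nat and s :: "nat \<Rightarrow> nat"
    and Ks :: "nat \<Rightarrow> ('a, 'k) ring_scheme" and h :: "nat \<Rightarrow> 'q \<Rightarrow> 'a"
    and K :: "(nat \<Rightarrow> 'a) ring" and d :: "'q \<Rightarrow> nat \<Rightarrow> 'a"
    and \<O>s :: "nat \<Rightarrow> 'a set" and \<O> :: "(nat \<Rightarrow> 'a) set"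
    and V :: "(nat \<Rightarrow> 'a, nat \<times> nat \<Rightarrow> 'a) module"
    and R :: "(nat \<Rightarrow> 'a) set" and f :: "nat \<Rightarrow> 'a set"
    and M :: "(nat \<times> nat \<Rightarrow> 'a) set"
  assumes Z: "dedekind_domain_with_fraction_field Z Q"
    and Ks: "\<And>i. i \<in> {1..n} \<Longrightarrow> finite_field_extension Q (h i) (Ks i)"
    and K: "K = product_ring {1..n} Ks"
    and d: "d = diagonal {1..n} h"
    and \<O>s: "\<And>i. i \<in> {1..n} \<Longrightarrow> \<O>s i = integral_closure (h i ` Z) (Ks i)"
    and \<O>: "\<O> = (\<Pi>\<^sub>E i\<in>{1..n}. \<O>s i)"
    and fin: "fin_gen_submodule \<O> (Q\<lparr>carrier := Z\<rparr>) (restrict_scalars d (regular_module K))"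
    and s: "\<And>i. i \<in> {1..n} \<Longrightarrow> 1 \<le> s i"
    and V: "V = power_sum_module n s Ks"
    and R: "is_order Z Q d K R"
    and f_ideal: "\<And>i. i \<in> {1..n} \<Longrightarrow> ideal (f i) (Ks i\<lparr>carrier := \<O>s i\<rparr>)"
    and f: "conductor K R \<O> = (\<Pi>\<^sub>E i\<in>{1..n}. f i)"
    and M: "submodule M (K\<lparr>carrier := R\<rparr>) V"
    and M_lattice: "is_lattice Z Q (restrict_scalars d V) M"
  shows "\<exists>M' I.
    submodule M' (K\<lparr>carrier := R\<rparr>) V \<and>
    is_lattice Z Q (restrict_scalars d V) M' \<and>
    (\<forall>i\<in>{1..n}. fractional_ideal (I i) (\<O>s i) (Ks i)) \<and>
    modules_isomorphic (K\<lparr>carrier := R\<rparr>) (V\<lparr>carrier := M'\<rparr>) (V\<lparr>carrier := M\<rparr>) \<and>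
    generated_submodule (K\<lparr>carrier := \<O>\<rparr>) V M' = split_sum n s \<O>s I \<and>
    split_sum n s f (\<lambda>i. ideal_prod (Ks i) (f i) (I i)) \<subseteq> M' \<and>
    M' \<subseteq> split_sum n s \<O>s I"
proof -
  interpret field_product n s Ks
    using Ks by (auto intro!: field_product.intro simp: finite_field_extension_def)
  have S: "order_setting n Ks Z Q h \<O>s R"
  proof (intro order_setting.intro order_setting_axioms.intro field_product_axioms)
    show "h i \<in> ring_hom Q (Ks i)" if "i \<in> {1..n}" for i
      using Ks[OF that] by (simp add: finite_field_extension_def)
    \<comment> \<open>Closure of the integral closure under the ring operations comes from
      \<open>f_ideal\<close>: to be an ideal of a structure includes that the structure is a
      ring.\<close>
    show "ring (Ks i\<lparr>carrier := \<O>s i\<rparr>)" if "i \<in> {1..n}" for i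
      using f_ideal[OF that] ideal.axioms(2) by blast
  qed (use Z \<O>s fin R in \<open>simp_all only: K d \<O>\<close>)
  show ?thesis unfolding K d V \<O>
    by (rule order_setting.order_lattice_standard_form[OF S s f_ideal
          f[unfolded K \<O>] M[unfolded K V] M_lattice[unfolded d V]])
qed

end
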